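(* Let $Q \subset \mathbb{R}^2$ be a (non-degenerate) parallelogram with side lengths $a \ge b > 0$ and smallest interior angle $\alpha$. Let $R$ be a rectangle with the same area (two-dimensional volume) as $Q$ and with the same shorter side length $b$ as $Q$. If $\dfrac{b}{a} \le \sin\alpha$, then $$\mu_2(Q) \le \mu_2(R).$$
   Context: For a bounded planar domain $\Omega$ with sufficiently regular boundary (in particular, the interior of a convex polygon), the Neumann spectrum of the Laplacian on $\Omega$ is discrete. Its Neumann eigenvalues (for $-\Delta u = \mu u$ in $\Omega$ with $\partial u/\partial n = 0$ on $\partial\Omega$, understood in the weak sense) are listed with multiplicity as $0 = \mu_1(\Omega) < \mu_2(\Omega) \le \mu_3(\Omega) \le \dots$. The first eigenvalue $\mu_1(\Omega)=0$ corresponds to constant functions, so $\mu_2(\Omega)$ is the first non-zero Neumann eigenvalue. Equivalently, $$\mu_2(\Omega) = \min\left\{ \frac{\int_\Omega |\nabla u|^2\,dx\,dy}{\int_\Omega u^2\,dx\,dy} : u \in H^1(\Omega),\ u \ne 0,\ \int_\Omega u\,dx\,dy = 0 \right\}.$$ For a parallelogram or a rectangle, $\mu_2$ denotes this quantity for its interior. *)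

theory Defs
  imports "HOL-Analysis.Analysis"
begin

section \<open>The Sobolev space of functions with square-integrable weak gradient\<close>

text \<open>
  Elements of \<open>L\<^sup>2(\<Omega>)\<close> are represented by Borel measurable functions; every almost-everywhere
  class of Lebesgue measurable functions has such a representative. Values outside \<open>\<Omega>\<close> are
  irrelevant throughout.
\<close>

definition square_integrable_on ::
    "('a::euclidean_space \<Rightarrow> 'b::euclidean_space) \<Rightarrow> 'a set \<Rightarrow> bool"  (infixr "square'_integrable'_on" 46)
  where "f square_integrable_on \<Omega> \<longleftrightarrow>
    set_borel_measurable lborel \<Omega> f \<and> set_integrable lborel \<Omega> (\<lambda>x. (norm (f x))\<^sup>2)"

text \<open>
  \<open>test_function \<Omega> \<phi> g\<close>: \<open>\<phi>\<close> is continuously differentiable with gradient \<open>g\<close> and its support is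
  a compact subset of \<open>\<Omega>\<close>. Weak derivatives of first order are tested against \<open>C\<^sup>1\<close> functions, as
  in Gilbarg and Trudinger, Elliptic Partial Differential Equations of Second Order, Section 7.3.
\<close>

definition test_function ::
    "'a::euclidean_space set \<Rightarrow> ('a \<Rightarrow> real) \<Rightarrow> ('a \<Rightarrow> 'a) \<Rightarrow> bool"
  where "test_function \<Omega> \<phi> g \<longleftrightarrow>
    (\<forall>x. GDERIV \<phi> x :> g x) \<and> continuous_on UNIV g \<and>
    compact (closure {x. \<phi> x \<noteq> 0}) \<and> closure {x. \<phi> x \<noteq> 0} \<subseteq> \<Omega>"

text \<open>
  \<open>sobolev_H1 \<Omega> u G\<close>: \<open>u\<close> belongs to \<open>H\<^sup>1(\<Omega>)\<close> and \<open>G\<close> is its weak gradient (for open \<open>\<Omega>\<close>, unique up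
  to null sets). The displayed identity is between vectors, so it comprises the identities for all
  partial derivatives.
\<close>

definition sobolev_H1 ::
    "'a::euclidean_space set \<Rightarrow> ('a \<Rightarrow> real) \<Rightarrow> ('a \<Rightarrow> 'a) \<Rightarrow> bool"
  where "sobolev_H1 \<Omega> u G \<longleftrightarrow>
    u square_integrable_on \<Omega> \<and> G square_integrable_on \<Omega> \<and>
    (\<forall>\<phi> g. test_function \<Omega> \<phi> g \<longrightarrow>
      (LINT x:\<Omega>|lborel. u x *\<^sub>R g x) = - (LINT x:\<Omega>|lborel. \<phi> x *\<^sub>R G x))"

section \<open>Neumann eigenvalues of the Laplacian\<close>

text \<open>
  Weak form of \<open>-\<Delta>u = \<mu>u\<close> in \<open>\<Omega>\<close> with \<open>\<partial>u/\<partial>n = 0\<close> on the boundary: the functions \<open>v\<close> range over all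
  of \<open>H\<^sup>1(\<Omega>)\<close>, without any boundary condition.
\<close>

definition neumann_eigenfunction ::
    "'a::euclidean_space set \<Rightarrow> real \<Rightarrow> ('a \<Rightarrow> real) \<Rightarrow> bool"
  where "neumann_eigenfunction \<Omega> \<mu> u \<longleftrightarrow>
    \<not> (AE x in lborel. x \<in> \<Omega> \<longrightarrow> u x = 0) \<and>
    (\<exists>G. sobolev_H1 \<Omega> u G \<and>
      (\<forall>v V. sobolev_H1 \<Omega> v V \<longrightarrow>
        (LINT x:\<Omega>|lborel. G x \<bullet> V x) = \<mu> * (LINT x:\<Omega>|lborel. u x * v x)))"

definition independent_AE_on :: "'a::euclidean_space set \<Rightarrow> nat \<Rightarrow> (nat \<Rightarrow> 'a \<Rightarrow> real) \<Rightarrow> bool"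
  where "independent_AE_on \<Omega> k u \<longleftrightarrow>
    (\<forall>c. (AE x in lborel. x \<in> \<Omega> \<longrightarrow> (\<Sum>i<k. c i * u i x) = 0) \<longrightarrow> (\<forall>i<k. c i = 0))"

text \<open>
  The \<open>k\<close>-th entry (\<open>k \<ge> 1\<close>) of the nondecreasing list of the eigenvalues repeated according to
  multiplicity is the least \<open>t\<close> such that the eigenspaces with eigenvalue at most \<open>t\<close> have total
  dimension at least \<open>k\<close>. When the spectrum is discrete, the infimum below is attained.
\<close>

definition neumann_mu :: "nat \<Rightarrow> 'a::euclidean_space set \<Rightarrow> real"
  where "neumann_mu k \<Omega> =
    Inf {t. \<exists>\<nu> u. (\<forall>i<k. neumann_eigenfunction \<Omega> (\<nu> i) (u i) \<and> \<nu> i \<le> t) \<and>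
                  independent_AE_on \<Omega> k u}"

section \<open>Parallelograms\<close>

text \<open>The parallelogram with vertex \<open>p\<close> and sides \<open>v\<close>, \<open>w\<close> at that vertex, as a closed region.\<close>

definition parallelogram :: "'a::euclidean_space \<Rightarrow> 'a \<Rightarrow> 'a \<Rightarrow> 'a set"
  where "parallelogram p v w = {p + s *\<^sub>R v + t *\<^sub>R w | s t. s \<in> {0..1} \<and> t \<in> {0..1}}"

definition angle_between :: "'a::euclidean_space \<Rightarrow> 'a \<Rightarrow> real"
  where "angle_between v w = arccos (v \<bullet> w / (norm v * norm w))"

text \<open>The interior angles at the vertices \<open>p\<close>, \<open>p + v\<close>, \<open>p + v + w\<close> and \<open>p + w\<close>, in this order.\<close>

definition interior_angles :: "'a::euclidean_space \<Rightarrow> 'a \<Rightarrow> real set"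
  where "interior_angles v w =
    {angle_between v w, angle_between (- v) w, angle_between (- v) (- w), angle_between v (- w)}"

end

theory Submission
  imports Defs "HOL-Complex_Analysis.Great_Picard"
begin

text \<open>
  On a parallelogram with sides \<open>v\<close> and \<open>w\<close>, let \<open>s\<close> be the affine coordinate along \<open>v\<close>. The trial function
  \<open>cos (\<pi> s)\<close> has mean zero and Rayleigh quotient \<open>\<pi>\<^sup>2 / d\<^sup>2\<close>, where \<open>d\<close> is the distance between the sides
  parallel to \<open>w\<close>, that is, the area divided by \<open>norm w\<close>. If \<open>w\<close> is the shorter side then \<open>d\<close> is
  the longer side of the rectangle \<open>R\<close>, and \<open>\<pi>\<^sup>2 / d\<^sup>2 = \<mu>\<^sub>2(R)\<close>.

  Since the eigenvalues are defined through weak eigenfunctions, the variational bound requires that the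
  Rayleigh quotient attains its minimum. In affine coordinates the products \<open>cos (m \<pi> s) cos (n \<pi> t)\<close> form
  a complete orthogonal system on any parallelogram. Integration by parts against \<open>sin (m \<pi> s) cos (n \<pi> t)\<close>,
  which vanishes on two opposite sides and needs no trace theory, bounds the weighted sum of the squared Fourier
  coefficients by the Dirichlet energy; this gives compactness of the embedding of \<open>H\<^sup>1\<close> into \<open>L\<^sup>2\<close>. On a
  rectangle the same products are eigenfunctions, so an eigenfunction with eigenvalue below \<open>\<pi>\<^sup>2 / d\<^sup>2\<close>
  is orthogonal to all of them but the constant.
\<close>

section \<open>Square-integrable functions\<close>

text \<open>The obstacle is the boundary. The sine-cosine products vanish on one pair of opposite
  sides only, whereas test functions need compact support in the open parallelogram. The way out is
  to contract gradients with a side vector. With \<open>v'\<close>, \<open>w'\<close> dual to the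
  sides \<open>v\<close>, \<open>w\<close>, a cutoff in the second coordinate has its derivative
  along \<open>w'\<close>, which \<open>v\<close> annihilates, and a cutoff in the first coordinate
  is tamed by the zeros of the sine. The resulting coefficient identity, applied to the cosine modes
  themselves, also yields their orthogonality and the equality of sine and cosine norms. Hence no
  trigonometric integral is evaluated. A minimizing sequence for the Rayleigh quotient converges
  strongly, gradients included, by the parallelogram law; weak compactness does not enter. On a
  general parallelogram the modes are not eigenfunctions, because \<open>v'\<close> and
  \<open>w'\<close> are not perpendicular; they serve there as a basis and as trial functions.
  Perpendicular sides make \<open>v'\<close> a multiple of \<open>v\<close>, so the weak equation
  against a mode closes up in a single Fourier coefficient.\<close>

definition L2 :: "'a measure \<Rightarrow> ('a \<Rightarrow> 'b::euclidean_space) \<Rightarrow> bool"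
  where "L2 M f \<longleftrightarrow> f \<in> borel_measurable M \<and> integrable M (\<lambda>x. (norm (f x))\<^sup>2)"

definition L2_inner :: "'a measure \<Rightarrow> ('a \<Rightarrow> 'b::euclidean_space) \<Rightarrow> ('a \<Rightarrow> 'b) \<Rightarrow> real"
  where "L2_inner M f g = (LINT x|M. f x \<bullet> g x)"

text \<open>Functions are not identified almost everywhere, so this is a seminorm;
  \<open>L2_norm_zero_iff\<close> describes its kernel. Euclidean values cover functions and
  gradients alike.\<close>

definition L2_norm :: "'a measure \<Rightarrow> ('a \<Rightarrow> 'b::euclidean_space) \<Rightarrow> real"
  where "L2_norm M f = sqrt (L2_inner M f f)"

lemma L2_measurable [measurable_dest]: "L2 M f \<Longrightarrow> f \<in> borel_measurable M"
  by (simp add: L2_def)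

lemma integrable_inner:
  assumes "L2 M f" "L2 M g"
  shows "integrable M (\<lambda>x. f x \<bullet> g x)"
proof (rule Bochner_Integration.integrable_bound)
  show "integrable M (\<lambda>x. (norm (f x))\<^sup>2 + (norm (g x))\<^sup>2)"
    using assms by (simp add: L2_def)
  show "(\<lambda>x. f x \<bullet> g x) \<in> borel_measurable M"
    using assms by measurable
  have "\<bar>a \<bullet> b\<bar> \<le> (norm a)\<^sup>2 + (norm b)\<^sup>2" for a b :: 'b
    using Cauchy_Schwarz_ineq2[of a b] sum_squares_bound[of "norm a" "norm b"]
      mult_nonneg_nonneg[OF norm_ge_zero[of a] norm_ge_zero[of b]] by linarith
  then show "AE x in M. norm (f x \<bullet> g x) \<le> norm ((norm (f x))\<^sup>2 + (norm (g x))\<^sup>2)"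
    by (intro always_eventually allI) simp
qed

lemma L2_add:
  assumes "L2 M f" "L2 M g"
  shows "L2 M (\<lambda>x. f x + g x)"
proof -
  have "integrable M (\<lambda>x. f x \<bullet> f x + 2 * (f x \<bullet> g x) + g x \<bullet> g x)"
    using assms by (intro Bochner_Integration.integrable_add integrable_mult_right integrable_inner)
  moreover have "(norm (f x + g x))\<^sup>2 = f x \<bullet> f x + 2 * (f x \<bullet> g x) + g x \<bullet> g x" for x
    by (simp add: power2_norm_eq_inner inner_add inner_commute)
  moreover have "(\<lambda>x. f x + g x) \<in> borel_measurable M"
    using assms by measurable
  ultimately show ?thesis
    by (simp add: L2_def)
qed

lemma L2_scaleR: "L2 M f \<Longrightarrow> L2 M (\<lambda>x. c *\<^sub>R f x)"
  by (auto simp: L2_def power_mult_distrib)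

lemma L2_mult: "L2 M f \<Longrightarrow> L2 M (\<lambda>x. c * f x)" for f :: "'a \<Rightarrow> real"
  using L2_scaleR[of M f c] by simp

lemma L2_uminus: "L2 M f \<Longrightarrow> L2 M (\<lambda>x. - f x)"
  using L2_scaleR[of M f "-1"] by simp

lemma L2_diff: "L2 M f \<Longrightarrow> L2 M g \<Longrightarrow> L2 M (\<lambda>x. f x - g x)"
  using L2_add[of M f "\<lambda>x. - g x"] L2_uminus[of M g] by simp

lemma L2_sum: "finite I \<Longrightarrow> (\<And>i. i \<in> I \<Longrightarrow> L2 M (f i)) \<Longrightarrow> L2 M (\<lambda>x. \<Sum>i\<in>I. f i x)"
proof (induction I rule: finite_induct)
  case empty
  then show ?case by (simp add: L2_def)
next
  case (insert i I)
  then show ?case using L2_add[of M "f i" "\<lambda>x. \<Sum>i\<in>I. f i x"] by simp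
qed

lemma L2_bounded:
  assumes "finite_measure M" "f \<in> borel_measurable M" "\<And>x. x \<in> space M \<Longrightarrow> norm (f x) \<le> B"
  shows "L2 M f"
proof -
  interpret finite_measure M by fact
  have "integrable M (\<lambda>x. (norm (f x))\<^sup>2)"
  proof (rule integrable_const_bound[of _ "B\<^sup>2"])
    show "AE x in M. norm ((norm (f x))\<^sup>2) \<le> B\<^sup>2"
      using assms(3) by (intro AE_I2) (simp add: power_mono)
  qed (use assms(2) in measurable)
  then show ?thesis using assms by (simp add: L2_def)
qed

lemma L2_component: "L2 M f \<Longrightarrow> L2 M (\<lambda>x. f x \<bullet> b)" for f :: "'a \<Rightarrow> 'b::euclidean_space"
proof -
  assume f: "L2 M f"
  have "integrable M (\<lambda>x. (norm (f x \<bullet> b))\<^sup>2)"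
  proof (rule Bochner_Integration.integrable_bound)
    show "integrable M (\<lambda>x. (norm b)\<^sup>2 * (norm (f x))\<^sup>2)"
      using f by (simp add: L2_def)
    show "AE x in M. norm ((norm (f x \<bullet> b))\<^sup>2) \<le> norm ((norm b)\<^sup>2 * (norm (f x))\<^sup>2)"
    proof (intro always_eventually allI)
      fix x
      have "\<bar>f x \<bullet> b\<bar>\<^sup>2 \<le> (norm (f x) * norm b)\<^sup>2"
        using Cauchy_Schwarz_ineq2 by (intro power_mono) auto
      then show "norm ((norm (f x \<bullet> b))\<^sup>2) \<le> norm ((norm b)\<^sup>2 * (norm (f x))\<^sup>2)"
        by (simp add: power_mult_distrib mult.commute)
    qed
  qed (use f in measurable)
  moreover have "(\<lambda>x. f x \<bullet> b) \<in> borel_measurable M"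
    using f by measurable
  ultimately show ?thesis by (simp add: L2_def)
qed

lemma L2_integrable: "finite_measure M \<Longrightarrow> L2 M f \<Longrightarrow> integrable M f" for f :: "'a \<Rightarrow> real"
  using integrable_inner[of M f "\<lambda>_. 1", OF _ L2_bounded[of M "\<lambda>_. 1::real" 1]] by auto

lemma L2_inner_commute: "L2_inner M f g = L2_inner M g f"
  by (simp add: L2_inner_def inner_commute)

lemma L2_inner_add_left:
  "L2 M f \<Longrightarrow> L2 M g \<Longrightarrow> L2 M h \<Longrightarrow> L2_inner M (\<lambda>x. f x + g x) h = L2_inner M f h + L2_inner M g h"
  by (simp add: L2_inner_def inner_add_left integrable_inner)

lemma L2_inner_diff_left:
  "L2 M f \<Longrightarrow> L2 M g \<Longrightarrow> L2 M h \<Longrightarrow> L2_inner M (\<lambda>x. f x - g x) h = L2_inner M f h - L2_inner M g h"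
  by (simp add: L2_inner_def inner_diff_left integrable_inner)

lemma L2_inner_scaleR_left: "L2_inner M (\<lambda>x. c *\<^sub>R f x) h = c * L2_inner M f h"
  by (simp add: L2_inner_def)

lemma L2_inner_mult_left: "L2_inner M (\<lambda>x. c * f x) h = c * L2_inner M f h" for f :: "'a \<Rightarrow> real"
  by (simp add: L2_inner_def mult.assoc)

lemma L2_inner_sum_left:
  "(\<And>i. i \<in> I \<Longrightarrow> L2 M (f i)) \<Longrightarrow> L2 M h \<Longrightarrow>
    L2_inner M (\<lambda>x. \<Sum>i\<in>I. f i x) h = (\<Sum>i\<in>I. L2_inner M (f i) h)"
  by (simp add: L2_inner_def inner_sum_left integrable_inner)

lemma L2_inner_add_right:
  "L2 M f \<Longrightarrow> L2 M g \<Longrightarrow> L2 M h \<Longrightarrow> L2_inner M h (\<lambda>x. f x + g x) = L2_inner M h f + L2_inner M h g"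
  by (simp add: L2_inner_commute[of M h] L2_inner_add_left)

lemma L2_inner_diff_right:
  "L2 M f \<Longrightarrow> L2 M g \<Longrightarrow> L2 M h \<Longrightarrow> L2_inner M h (\<lambda>x. f x - g x) = L2_inner M h f - L2_inner M h g"
  by (simp add: L2_inner_commute[of M h] L2_inner_diff_left)

lemma L2_inner_scaleR_right: "L2_inner M h (\<lambda>x. c *\<^sub>R f x) = c * L2_inner M h f"
  by (simp add: L2_inner_commute[of M h] L2_inner_scaleR_left)

lemma L2_inner_nonneg: "0 \<le> L2_inner M f f"
  by (simp add: L2_inner_def)

lemma L2_norm_nonneg: "0 \<le> L2_norm M f"
  by (simp add: L2_norm_def L2_inner_nonneg)

lemma L2_norm_power2: "(L2_norm M f)\<^sup>2 = L2_inner M f f"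
  by (simp add: L2_norm_def L2_inner_nonneg)

lemma L2_inner_self_add_scaleR:
  assumes "L2 M f" "L2 M g"
  shows "L2_inner M (\<lambda>x. f x + c *\<^sub>R g x) (\<lambda>x. f x + c *\<^sub>R g x) =
    L2_inner M f f + 2 * c * L2_inner M f g + c\<^sup>2 * L2_inner M g g"
  using assms
  by (simp add: L2_inner_add_left L2_inner_add_right L2_add L2_scaleR L2_inner_scaleR_left
      L2_inner_scaleR_right L2_inner_commute[of M g f] power2_eq_square algebra_simps)

text \<open>Used twice: for the Cauchy-Schwarz inequality, and with \<open>a = 0\<close> for the
  first variation of a minimizer, where it forces \<open>b = 0\<close>. The sign of \<open>c\<close>
  is not known in advance in the second use.\<close>

lemma nonneg_quadratic_discriminant:
  fixes a b c :: real
  assumes "\<And>t. 0 \<le> a + 2 * t * b + t\<^sup>2 * c"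
  shows "b\<^sup>2 \<le> a * c"
proof (cases "c = 0")
  case True
  have "b = 0"
  proof (rule ccontr)
    assume "b \<noteq> 0"
    then show False
      using assms[of "- (a + 1) / (2 * b)"] True by (simp add: field_simps)
  qed
  with True show ?thesis by simp
next
  case False
  have "0 < c"
  proof (rule ccontr)
    assume "\<not> 0 < c"
    \<comment> \<open>Chosen so that \<open>(- c) * s\<^sup>2\<close> exceeds
      \<open>\<bar>a\<bar>\<close>. Adding the inequalities at \<open>s\<close> and
      \<open>- s\<close> cancels the linear term and gives the contradiction.\<close>
    define s where "s = 1 + (\<bar>a\<bar> + 1) / - c"
    have "0 < - c" "1 \<le> s" "(- c) * s = - c + \<bar>a\<bar> + 1"
      using \<open>\<not> 0 < c\<close> False by (simp_all add: s_def field_simps)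
    then have "(- c) * s\<^sup>2 \<ge> - c + \<bar>a\<bar> + 1"
      by (metis less_eq_real_def mult_le_cancel_left1 mult_left_mono order_trans not_less power2_eq_square zero_less_one)
    moreover have "0 \<le> 2 * a + 2 * s\<^sup>2 * c"
      using assms[of s] assms[of "-s"] by simp
    ultimately show False
      using \<open>0 < - c\<close> by argo
  qed
  moreover have "0 \<le> a - b\<^sup>2 / c"
    using assms[of "- b / c"] False by (simp add: field_simps power2_eq_square)
  ultimately show ?thesis by (simp add: field_simps)
qed

lemma L2_Cauchy_Schwarz_power2:
  assumes "L2 M f" "L2 M g"
  shows "(L2_inner M f g)\<^sup>2 \<le> L2_inner M f f * L2_inner M g g"
proof (rule nonneg_quadratic_discriminant)
  fix t
  show "0 \<le> L2_inner M f f + 2 * t * L2_inner M f g + t\<^sup>2 * L2_inner M g g"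
    using L2_inner_self_add_scaleR[OF assms, of t] L2_inner_nonneg[of M "\<lambda>x. f x + t *\<^sub>R g x"]
    by simp
qed

lemma L2_Cauchy_Schwarz:
  assumes "L2 M f" "L2 M g"
  shows "\<bar>L2_inner M f g\<bar> \<le> L2_norm M f * L2_norm M g"
proof (rule power2_le_imp_le)
  show "\<bar>L2_inner M f g\<bar>\<^sup>2 \<le> (L2_norm M f * L2_norm M g)\<^sup>2"
    using L2_Cauchy_Schwarz_power2[OF assms] by (simp add: power_mult_distrib L2_norm_power2)
qed (simp add: L2_norm_nonneg)

lemma L2_norm_triangle:
  assumes "L2 M f" "L2 M g"
  shows "L2_norm M (\<lambda>x. f x + g x) \<le> L2_norm M f + L2_norm M g"
proof (rule power2_le_imp_le)
  have "(L2_norm M (\<lambda>x. f x + g x))\<^sup>2 = L2_inner M f f + 2 * L2_inner M f g + L2_inner M g g"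
    using L2_inner_self_add_scaleR[OF assms, of 1] by (simp add: L2_norm_power2)
  also have "\<dots> \<le> (L2_norm M f + L2_norm M g)\<^sup>2"
    using L2_Cauchy_Schwarz[OF assms] by (simp add: power2_sum L2_norm_power2)
  finally show "(L2_norm M (\<lambda>x. f x + g x))\<^sup>2 \<le> (L2_norm M f + L2_norm M g)\<^sup>2" .
qed (simp add: L2_norm_nonneg)

lemma L2_norm_uminus: "L2_norm M (\<lambda>x. - f x) = L2_norm M f"
  by (simp add: L2_norm_def L2_inner_def)

lemma L2_norm_minus_commute: "L2_norm M (\<lambda>x. f x - g x) = L2_norm M (\<lambda>x. g x - f x)"
  using L2_norm_uminus[of M "\<lambda>x. g x - f x"] by simp

lemma L2_norm_zero_iff:
  assumes "L2 M f"
  shows "L2_norm M f = 0 \<longleftrightarrow> (AE x in M. f x = 0)"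
  using integral_nonneg_eq_0_iff_AE[of M "\<lambda>x. f x \<bullet> f x"] assms
  by (simp add: L2_norm_def L2_inner_def integrable_inner)

lemma L2_inner_cong_AE:
  assumes "L2 M f" "L2 M f'" "L2 M g" "AE x in M. f x = f' x"
  shows "L2_inner M f g = L2_inner M f' g"
  unfolding L2_inner_def using assms(4)
  by (intro integral_cong_AE) (use assms in \<open>auto simp: L2_def\<close>)

lemma L2_inner_tendsto:
  assumes f: "\<And>n. L2 M (f n)" "L2 M g" "(\<lambda>n. L2_norm M (\<lambda>x. f n x - g x)) \<longlonglongrightarrow> 0" and h: "L2 M h"
  shows "(\<lambda>n. L2_inner M (f n) h) \<longlonglongrightarrow> L2_inner M g h"
proof (rule Lim_transform2)
  show "(\<lambda>n. L2_inner M g h) \<longlonglongrightarrow> L2_inner M g h" by simp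
  have "(\<lambda>n. L2_norm M (\<lambda>x. f n x - g x) * L2_norm M h) \<longlonglongrightarrow> 0"
    using tendsto_mult_right[OF f(3), of "L2_norm M h"] by simp
  moreover have "norm (L2_inner M (\<lambda>x. f n x - g x) h) \<le> L2_norm M (\<lambda>x. f n x - g x) * L2_norm M h" for n
    using L2_Cauchy_Schwarz[OF L2_diff[OF f(1) f(2)] h] by simp
  ultimately have "(\<lambda>n. L2_inner M (\<lambda>x. f n x - g x) h) \<longlonglongrightarrow> 0"
    by (intro Lim_null_comparison[of "\<lambda>n. L2_inner M (\<lambda>x. f n x - g x) h"] always_eventually allI)
  then have "(\<lambda>n. L2_inner M (f n) h - L2_inner M g h) \<longlonglongrightarrow> 0"
    using f h by (simp add: L2_inner_diff_left)
  from tendsto_minus[OF this] show "(\<lambda>n. L2_inner M g h - L2_inner M (f n) h) \<longlonglongrightarrow> 0"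
    by simp
qed

lemma L2_inner_self_tendsto:
  assumes f: "\<And>n. L2 M (f n)" "L2 M g" "(\<lambda>n. L2_norm M (\<lambda>x. f n x - g x)) \<longlonglongrightarrow> 0"
  shows "(\<lambda>n. L2_inner M (f n) (f n)) \<longlonglongrightarrow> L2_inner M g g"
proof -
  have "\<bar>L2_norm M (f n) - L2_norm M g\<bar> \<le> L2_norm M (\<lambda>x. f n x - g x)" for n
    using L2_norm_triangle[of M "\<lambda>x. f n x - g x" g] L2_norm_triangle[of M "\<lambda>x. g x - f n x" "f n"]
      L2_norm_minus_commute[of M g "f n"] L2_diff[OF f(1)[of n] f(2)] L2_diff[OF f(2) f(1)[of n]] f(1)[of n] f(2)
    by simp
  then have "(\<lambda>n. L2_norm M (f n) - L2_norm M g) \<longlonglongrightarrow> 0"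
    by (intro Lim_null_comparison[OF always_eventually f(3)] allI) simp
  then have "(\<lambda>n. L2_norm M (f n)) \<longlonglongrightarrow> L2_norm M g"
    by (rule LIM_zero_cancel)
  from tendsto_power[OF this, of 2] show ?thesis
    unfolding L2_norm_power2 .
qed

lemma L2_diff_triangle:
  assumes "L2 M f" "L2 M g" "L2 M h"
  shows "L2_norm M (\<lambda>x. f x - h x) \<le> L2_norm M (\<lambda>x. f x - g x) + L2_norm M (\<lambda>x. g x - h x)"
  using L2_norm_triangle[OF L2_diff[OF assms(1,2)] L2_diff[OF assms(2,3)]] by simp

section \<open>Completeness of the space of square-integrable functions\<close>

lemma nn_integral_L2:
  assumes "L2 M f"
  shows "(\<integral>\<^sup>+x. ennreal ((norm (f x))\<^sup>2) \<partial>M) = ennreal ((L2_norm M f)\<^sup>2)"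
  using assms
  by (subst nn_integral_eq_integral) (auto simp: L2_def L2_norm_power2 L2_inner_def power2_norm_eq_inner)

text \<open>Fatou's lemma for the squared norms. Square integrability of the limit is part of the
  conclusion, and the bound is asked only from \<open>N\<close> on so that the lemma applies to
  tails of Cauchy sequences.\<close>

lemma L2_Fatou:
  assumes "\<And>n. L2 M (f n)" "g \<in> borel_measurable M" "AE x in M. (\<lambda>n. f n x) \<longlonglongrightarrow> g x"
    and "\<And>n. n \<ge> N \<Longrightarrow> L2_norm M (f n) \<le> B"
  shows "L2 M g" "L2_norm M g \<le> B"
proof -
  have "0 \<le> B"
    using assms(4)[of N] L2_norm_nonneg[of M "f N"] by linarith
  have [measurable]: "f n \<in> borel_measurable M" for n
    using assms(1) by (simp add: L2_def)
  have "AE x in M. ennreal ((norm (g x))\<^sup>2) = liminf (\<lambda>n. ennreal ((norm (f n x))\<^sup>2))"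
    using assms(3)
  proof (rule AE_mp, intro AE_I2 impI)
    fix x assume "(\<lambda>n. f n x) \<longlonglongrightarrow> g x"
    then have "(\<lambda>n. ennreal ((norm (f n x))\<^sup>2)) \<longlonglongrightarrow> ennreal ((norm (g x))\<^sup>2)"
      by (intro tendsto_ennrealI tendsto_power tendsto_norm)
    then show "ennreal ((norm (g x))\<^sup>2) = liminf (\<lambda>n. ennreal ((norm (f n x))\<^sup>2))"
      using lim_imp_Liminf[OF sequentially_bot] by metis
  qed
  then have "(\<integral>\<^sup>+x. ennreal ((norm (g x))\<^sup>2) \<partial>M) = (\<integral>\<^sup>+x. liminf (\<lambda>n. ennreal ((norm (f n x))\<^sup>2)) \<partial>M)"
    by (rule nn_integral_cong_AE)
  also have "\<dots> \<le> liminf (\<lambda>n. \<integral>\<^sup>+x. ennreal ((norm (f n x))\<^sup>2) \<partial>M)"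
    by (rule nn_integral_liminf) measurable
  also have "\<dots> \<le> liminf (\<lambda>n. ennreal (B\<^sup>2))"
  proof (rule Liminf_mono)
    show "\<forall>\<^sub>F n in sequentially. (\<integral>\<^sup>+x. ennreal ((norm (f n x))\<^sup>2) \<partial>M) \<le> ennreal (B\<^sup>2)"
      using eventually_ge_at_top[of N]
    proof eventually_elim
      case (elim n)
      show ?case
        unfolding nn_integral_L2[OF assms(1)]
        by (intro ennreal_leI power_mono assms(4) elim L2_norm_nonneg)
    qed
  qed
  also have "\<dots> = ennreal (B\<^sup>2)"
    by (simp add: Liminf_const)
  finally have le: "(\<integral>\<^sup>+x. ennreal ((norm (g x))\<^sup>2) \<partial>M) \<le> ennreal (B\<^sup>2)" .
  have "integrable M (\<lambda>x. (norm (g x))\<^sup>2)"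
  proof (rule integrableI_bounded)
    show "(\<lambda>x. (norm (g x))\<^sup>2) \<in> borel_measurable M"
      using assms(2) by measurable
    show "(\<integral>\<^sup>+x. ennreal (norm ((norm (g x))\<^sup>2)) \<partial>M) < \<infinity>"
      using le by (simp add: order_le_less_trans)
  qed
  then show g: "L2 M g"
    using assms(2) by (simp add: L2_def)
  have "(L2_norm M g)\<^sup>2 \<le> B\<^sup>2"
    using le unfolding nn_integral_L2[OF g] by simp
  then show "L2_norm M g \<le> B"
    using \<open>0 \<le> B\<close> by (rule power2_le_imp_le)
qed

text \<open>Weighting the squared increments by \<open>2 ^ k\<close> makes them summable in \<open>L\<^sup>1\<close>, and this controls the
  increments pointwise.\<close>

lemma AE_convergent_if_increments_L2_norm_le:
  fixes f :: "nat \<Rightarrow> 'a \<Rightarrow> 'b::euclidean_space"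
  assumes f: "\<And>n. L2 M (f n)"
    and le: "\<And>k. L2_norm M (\<lambda>x. f (Suc k) x - f k x) \<le> (1 / 2) ^ k"
  shows "AE x in M. convergent (\<lambda>k. f k x)"
proof -
  have [measurable]: "f n \<in> borel_measurable M" for n
    using f by (simp add: L2_def)
  define d where "d k x = f (Suc k) x - f k x" for k x
  have d: "L2 M (d k)" for k
    using f unfolding d_def by (intro L2_diff)
  have [measurable]: "d n \<in> borel_measurable M" for n
    using d by (simp add: L2_def)
  have incr: "(\<integral>\<^sup>+x. ennreal (2 ^ k * (norm (d k x))\<^sup>2) \<partial>M) \<le> ennreal ((1 / 2) ^ k)" for k
  proof -
    have "(\<integral>\<^sup>+x. ennreal (2 ^ k * (norm (d k x))\<^sup>2) \<partial>M) = (\<integral>\<^sup>+x. ennreal (2 ^ k) * ennreal ((norm (d k x))\<^sup>2) \<partial>M)"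
      by (simp add: ennreal_mult'')
    also have "\<dots> = ennreal (2 ^ k) * (\<integral>\<^sup>+x. ennreal ((norm (d k x))\<^sup>2) \<partial>M)"
      by (rule nn_integral_cmult) measurable
    also have "\<dots> = ennreal (2 ^ k * (L2_norm M (d k))\<^sup>2)"
      by (simp add: nn_integral_L2[OF d] ennreal_mult'')
    also have "\<dots> \<le> ennreal (2 ^ k * ((1 / 2) ^ k)\<^sup>2)"
      using le[of k] by (intro ennreal_leI mult_left_mono power_mono) (auto simp: L2_norm_nonneg d_def[abs_def])
    also have "2 ^ k * ((1 / 2) ^ k)\<^sup>2 = (1 / 2 :: real) ^ k"
      by (simp add: power2_eq_square flip: power_mult_distrib)
    finally show ?thesis .
  qed
  have "(\<integral>\<^sup>+x. (\<Sum>k. ennreal (2 ^ k * (norm (d k x))\<^sup>2)) \<partial>M) = (\<Sum>k. \<integral>\<^sup>+x. ennreal (2 ^ k * (norm (d k x))\<^sup>2) \<partial>M)"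
    by (rule nn_integral_suminf) measurable
  also have "\<dots> \<le> (\<Sum>k. ennreal ((1 / 2) ^ k))"
    by (intro suminf_le incr) auto
  also have "\<dots> = ennreal (\<Sum>k. (1 / 2) ^ k)"
    by (intro suminf_ennreal2) (auto simp: summable_geometric)
  finally have fin: "(\<integral>\<^sup>+x. (\<Sum>k. ennreal (2 ^ k * (norm (d k x))\<^sup>2)) \<partial>M) \<noteq> \<infinity>"
    by (auto simp: top_unique)
  have "AE x in M. (\<Sum>k. ennreal (2 ^ k * (norm (d k x))\<^sup>2)) \<noteq> \<infinity>"
    by (rule nn_integral_PInf_AE[OF _ fin]) measurable
  then show ?thesis
  proof (rule AE_mp, intro AE_I2 impI)
    fix x assume "(\<Sum>k. ennreal (2 ^ k * (norm (d k x))\<^sup>2)) \<noteq> \<infinity>"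
    then have "summable (\<lambda>k. 2 ^ k * (norm (d k x))\<^sup>2)"
      by (intro summable_suminf_not_top) auto
    then have "Bseq (\<lambda>k. 2 ^ k * (norm (d k x))\<^sup>2)"
      by (intro convergent_imp_Bseq) (auto simp: convergent_def dest: summable_LIMSEQ_zero)
    then obtain K where K: "0 < K" "\<And>k. 2 ^ k * (norm (d k x))\<^sup>2 \<le> K"
      by (auto simp: Bseq_def)
    \<comment> \<open>Boundedness of the weighted squares is enough: taking roots leaves a geometric
      majorant with ratio \<open>sqrt (1 / 2)\<close>.\<close>
    have "norm (d k x) \<le> sqrt K * (sqrt (1 / 2)) ^ k" for k
    proof (rule power2_le_imp_le)
      have "(sqrt (1 / 2) ^ k)\<^sup>2 = ((sqrt (1 / 2))\<^sup>2 :: real) ^ k"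
        by (simp only: power_mult [symmetric] mult.commute)
      then have "(sqrt K * sqrt (1 / 2) ^ k)\<^sup>2 = K / 2 ^ k"
        using K(1) by (simp add: power_mult_distrib power_one_over field_simps del: real_sqrt_divide)
      moreover have "(norm (d k x))\<^sup>2 \<le> K / 2 ^ k"
        using K(2)[of k] by (simp add: field_simps)
      ultimately show "(norm (d k x))\<^sup>2 \<le> (sqrt K * sqrt (1 / 2) ^ k)\<^sup>2"
        by simp
    qed (use K(1) in auto)
    moreover have "summable (\<lambda>k. sqrt K * (sqrt (1 / 2)) ^ k)"
      by (intro summable_mult summable_geometric) (simp add: real_sqrt_divide)
    ultimately have "summable (\<lambda>k. d k x)"
      by (rule summable_comparison_test'[rotated])
    then show "convergent (\<lambda>k. f k x)"
      by (simp add: d_def summable_iff_convergent sum_lessThan_telescope[of "\<lambda>k. f k x"]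
          convergent_diff_const_right_iff)
  qed
qed

text \<open>Riesz-Fischer. A rapidly Cauchy subsequence converges almost everywhere; Fatou's lemma
  for \<open>f n - f (r k)\<close> with \<open>n\<close> fixed and \<open>k\<close> growing turns
  this into norm convergence of the whole sequence.\<close>

theorem L2_complete:
  fixes f :: "nat \<Rightarrow> 'a \<Rightarrow> 'b::euclidean_space"
  assumes f: "\<And>n. L2 M (f n)"
    and Cauchy: "\<And>e. 0 < e \<Longrightarrow> \<exists>N. \<forall>m\<ge>N. \<forall>n\<ge>N. L2_norm M (\<lambda>x. f m x - f n x) < e"
  obtains g where "L2 M g" "(\<lambda>n. L2_norm M (\<lambda>x. f n x - g x)) \<longlonglongrightarrow> 0"
proof -
  have [measurable]: "f n \<in> borel_measurable M" for n
    using f by (simp add: L2_def)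
  obtain N where N: "\<And>k m n. N k \<le> m \<Longrightarrow> N k \<le> n \<Longrightarrow> L2_norm M (\<lambda>x. f m x - f n x) < (1 / 2) ^ k"
    using Cauchy[of "(1 / 2) ^ k" for k] by (metis zero_less_divide_1_iff zero_less_numeral zero_less_power)
  \<comment> \<open>The sum makes \<open>r\<close> monotone and at least \<open>N k\<close>; the
    summand \<open>k\<close> makes \<open>r k\<close> pass every threshold \<open>N j\<close> once
    \<open>k\<close> does.\<close>
  define r where "r k = (\<Sum>i\<le>k. N i) + k" for k
  have r: "N k \<le> r k" "k \<le> r k" "r k \<le> r (Suc k)" for k
    by (simp_all add: r_def trans_le_add1 member_le_sum)
  have AE: "AE x in M. convergent (\<lambda>k. f (r k) x)"
  proof (rule AE_convergent_if_increments_L2_norm_le)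
    show "L2_norm M (\<lambda>x. f (r (Suc k)) x - f (r k) x) \<le> (1 / 2) ^ k" for k
      using N[of k "r (Suc k)" "r k"] r[of k] by simp
  qed (rule f)
  \<comment> \<open>Where the sequence diverges, \<open>lim\<close> is an unspecified value; this
    happens on a null set only, and measurability holds regardless.\<close>
  define g where "g x = lim (\<lambda>k. f (r k) x)" for x
  have g [measurable]: "g \<in> borel_measurable M"
    unfolding g_def[abs_def] by (rule borel_measurable_lim_metric) measurable
  have conv: "AE x in M. (\<lambda>k. f n x - f (r k) x) \<longlonglongrightarrow> f n x - g x" for n
    using AE by eventually_elim (simp add: g_def convergent_LIMSEQ_iff tendsto_diff)
  have bound: "L2 M (\<lambda>x. f n x - g x)" "L2_norm M (\<lambda>x. f n x - g x) \<le> (1 / 2) ^ j" if "N j \<le> n" for n j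
  proof -
    have "L2_norm M (\<lambda>x. f n x - f (r k) x) \<le> (1 / 2) ^ j" if "k \<ge> N j" for k
      using N[of j n "r k"] \<open>N j \<le> n\<close> that r[of k] by simp
    moreover have "(\<lambda>x. f n x - g x) \<in> borel_measurable M"
      by measurable
    ultimately show "L2 M (\<lambda>x. f n x - g x)" "L2_norm M (\<lambda>x. f n x - g x) \<le> (1 / 2) ^ j"
      using L2_Fatou[of M "\<lambda>k x. f n x - f (r k) x", OF L2_diff[OF f f] _ conv] by blast+
  qed
  show ?thesis
  proof (rule that)
    show "L2 M g"
      using L2_diff[OF f[of "N 0"] bound(1)[of 0 "N 0"]] by simp
    show "(\<lambda>n. L2_norm M (\<lambda>x. f n x - g x)) \<longlonglongrightarrow> 0"
    proof (rule LIMSEQ_I)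
      fix e :: real assume "0 < e"
      then obtain j where j: "(1 / 2) ^ j < e"
        using one_less_numeral_iff real_arch_pow_inv by fastforce
      show "\<exists>no. \<forall>n\<ge>no. norm (L2_norm M (\<lambda>x. f n x - g x) - 0) < e"
      proof (intro exI allI impI)
        fix n assume "N j \<le> n"
        then show "norm (L2_norm M (\<lambda>x. f n x - g x) - 0) < e"
          using bound(2)[of j n] j L2_norm_nonneg[of M "\<lambda>x. f n x - g x"] by simp
      qed
    qed
  qed
qed

section \<open>Bessel's inequality and Parseval's identity for orthogonal families\<close>

definition mode_energy :: "'a measure \<Rightarrow> ('a \<Rightarrow> real) \<Rightarrow> ('a \<Rightarrow> real) \<Rightarrow> real"
  where "mode_energy M f e = (L2_inner M f e)\<^sup>2 / L2_inner M e e"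

lemma mode_energy_nonneg: "0 \<le> mode_energy M f e"
  by (simp add: mode_energy_def L2_inner_nonneg)

text \<open>The family is not normalised: it suffices to know that the norms do not vanish, and
  \<open>mode_energy\<close>, the squared norm of the projection onto one mode, divides by the
  squared norm of the mode.\<close>

locale L2_orthogonal =
  fixes M :: "'a measure" and e :: "'i \<Rightarrow> 'a \<Rightarrow> real" and I :: "'i set"
  assumes L2_e: "i \<in> I \<Longrightarrow> L2 M (e i)"
    and orthogonal: "i \<in> I \<Longrightarrow> j \<in> I \<Longrightarrow> i \<noteq> j \<Longrightarrow> L2_inner M (e i) (e j) = 0"
    and nonzero: "i \<in> I \<Longrightarrow> L2_inner M (e i) (e i) \<noteq> 0"
begin

abbreviation energy :: "('a \<Rightarrow> real) \<Rightarrow> 'i \<Rightarrow> real"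
  where "energy f i \<equiv> mode_energy M f (e i)"

definition partial :: "('a \<Rightarrow> real) \<Rightarrow> 'i set \<Rightarrow> 'a \<Rightarrow> real"
  where "partial f F x = (\<Sum>i\<in>F. L2_inner M f (e i) / L2_inner M (e i) (e i) * e i x)"

lemma L2_partial: "finite F \<Longrightarrow> F \<subseteq> I \<Longrightarrow> L2 M (partial f F)"
  unfolding partial_def[abs_def] by (intro L2_sum L2_mult L2_e) auto

lemma L2_inner_partial:
  assumes "finite F" "F \<subseteq> I" "L2 M h"
  shows "L2_inner M (partial f F) h =
    (\<Sum>i\<in>F. L2_inner M f (e i) * L2_inner M h (e i) / L2_inner M (e i) (e i))"
proof -
  have "L2_inner M (partial f F) h =
      (\<Sum>i\<in>F. L2_inner M (\<lambda>x. L2_inner M f (e i) / L2_inner M (e i) (e i) * e i x) h)"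
    unfolding partial_def[abs_def] using assms by (intro L2_inner_sum_left L2_mult L2_e) auto
  then show ?thesis
    by (simp only: L2_inner_mult_left) (simp add: L2_inner_commute)
qed

lemma L2_inner_partial_e:
  assumes "finite F" "F \<subseteq> I" "i \<in> I"
  shows "L2_inner M (partial f F) (e i) = (if i \<in> F then L2_inner M f (e i) else 0)"
proof -
  have "L2_inner M (partial f F) (e i) =
      (\<Sum>j\<in>F. L2_inner M f (e j) * L2_inner M (e i) (e j) / L2_inner M (e j) (e j))"
    using assms by (intro L2_inner_partial L2_e)
  also have "\<dots> = (\<Sum>j\<in>F. if j = i then L2_inner M f (e i) else 0)"
    using assms orthogonal nonzero by (intro sum.cong) auto
  finally show ?thesis
    using assms(1) by simp
qed

lemma energy_partial_diff:
  assumes "finite F" "F \<subseteq> I" "F' \<subseteq> F"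
  shows "L2_inner M (\<lambda>x. partial f F x - partial f F' x) (\<lambda>x. partial f F x - partial f F' x)
    = (\<Sum>i\<in>F. energy f i) - (\<Sum>i\<in>F'. energy f i)"
proof -
  have fin: "finite (F - F')" "F - F' \<subseteq> I"
    using assms by auto
  have "partial f F x - partial f F' x = partial f (F - F') x" for x
    using assms by (simp add: partial_def sum_diff)
  then have "L2_inner M (\<lambda>x. partial f F x - partial f F' x) (\<lambda>x. partial f F x - partial f F' x)
    = L2_inner M (partial f (F - F')) (partial f (F - F'))"
    by simp
  also have "\<dots> = (\<Sum>i\<in>F - F'. energy f i)"
    unfolding L2_inner_partial[OF fin L2_partial[OF fin]] using fin(2)
    by (intro sum.cong) (auto simp: L2_inner_partial_e[OF fin] subset_iff mode_energy_def power2_eq_square)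
  also have "\<dots> = (\<Sum>i\<in>F. energy f i) - (\<Sum>i\<in>F'. energy f i)"
    using assms by (simp add: sum_diff)
  finally show ?thesis .
qed

lemma energy_remainder:
  assumes "L2 M f" "finite F" "F \<subseteq> I"
  shows "L2_inner M (\<lambda>x. f x - partial f F x) (\<lambda>x. f x - partial f F x)
    = L2_inner M f f - (\<Sum>i\<in>F. energy f i)"
proof -
  have 1: "L2_inner M (partial f F) f = (\<Sum>i\<in>F. energy f i)"
    using assms by (simp add: L2_inner_partial mode_energy_def power2_eq_square)
  have 2: "L2_inner M (partial f F) (partial f F) = (\<Sum>i\<in>F. energy f i)"
    using energy_partial_diff[OF assms(2,3), of "{}" f] by (simp add: partial_def[of f "{}"])
  show ?thesis
    using assms L2_partial[OF assms(2,3)] 1 2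
    by (simp add: L2_inner_diff_left L2_inner_diff_right L2_diff L2_inner_commute[of M f "partial f F"])
qed

lemma Bessel:
  assumes "L2 M f" "finite F" "F \<subseteq> I"
  shows "(\<Sum>i\<in>F. energy f i) \<le> L2_inner M f f"
  using energy_remainder[OF assms] L2_inner_nonneg[of M "\<lambda>x. f x - partial f F x"] by simp

text \<open>By Bessel the partial energies converge, so the partial sums are Cauchy. Their limit has
  the same coefficients as \<open>f\<close>, and totality identifies it with \<open>f\<close> almost
  everywhere.\<close>

lemma Parseval:
  assumes f: "L2 M f"
    and total: "\<And>h. L2 M h \<Longrightarrow> (\<And>i. i \<in> I \<Longrightarrow> L2_inner M h (e i) = 0) \<Longrightarrow> AE x in M. h x = 0"
    and A: "incseq A" "(\<Union>n. A n) = I" "\<And>n::nat. finite (A n)"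
  shows "(\<lambda>n. \<Sum>i\<in>A n. energy f i) \<longlonglongrightarrow> L2_inner M f f"
proof -
  define a where "a n = (\<Sum>i\<in>A n. energy f i)" for n
  define S where "S n = partial f (A n)" for n
  have AI: "A n \<subseteq> I" for n
    using A(2) by auto
  have S: "L2 M (S n)" for n
    unfolding S_def by (intro L2_partial A(3) AI)
  have mono: "A m \<subseteq> A n" if "m \<le> n" for m n
    using A(1) that by (simp add: incseqD)
  have "incseq a"
    unfolding a_def incseq_def using mono A(3) mode_energy_nonneg by (auto intro!: sum_mono2)
  moreover have "a n \<le> L2_inner M f f" for n
    unfolding a_def by (intro Bessel f A(3) AI)
  ultimately have "convergent a"
    using incseq_convergent convergent_def by metis
  then have Cauchy_a: "Cauchy a"
    by (rule convergent_Cauchy)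
  have dist: "(L2_norm M (\<lambda>x. S m x - S n x))\<^sup>2 = \<bar>a m - a n\<bar>" for m n
  proof (induction m n rule: linorder_wlog)
    case (le m n)
    have "a m \<le> a n"
      using \<open>incseq a\<close> le by (simp add: incseqD)
    have "(L2_norm M (\<lambda>x. S m x - S n x))\<^sup>2 = (L2_norm M (\<lambda>x. S n x - S m x))\<^sup>2"
      by (subst L2_norm_minus_commute) simp
    also have "\<dots> = a n - a m"
      unfolding L2_norm_power2 S_def a_def by (rule energy_partial_diff[OF A(3) AI mono[OF le]])
    finally show ?case
      using \<open>a m \<le> a n\<close> by simp
  next
    case (sym m n)
    then show ?case
      by (subst L2_norm_minus_commute) simp
  qed
  obtain g where g: "L2 M g" "(\<lambda>n. L2_norm M (\<lambda>x. S n x - g x)) \<longlonglongrightarrow> 0"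
  proof (rule L2_complete[OF S])
    fix \<epsilon> :: real assume "0 < \<epsilon>"
    then obtain N where N: "\<And>m n. m \<ge> N \<Longrightarrow> n \<ge> N \<Longrightarrow> dist (a m) (a n) < \<epsilon>\<^sup>2"
      using Cauchy_a unfolding Cauchy_def by (meson zero_less_power)
    have "L2_norm M (\<lambda>x. S m x - S n x) < \<epsilon>" if "m \<ge> N" "n \<ge> N" for m n
      using N[OF that] \<open>0 < \<epsilon>\<close> dist[of m n] by (auto simp: dist_real_def intro: power2_less_imp_less)
    then show "\<exists>N. \<forall>m\<ge>N. \<forall>n\<ge>N. L2_norm M (\<lambda>x. S m x - S n x) < \<epsilon>"
      by blast
  qed
  have "AE x in M. f x - g x = 0"
  proof (rule total)
    show "L2 M (\<lambda>x. f x - g x)"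
      using f g by (intro L2_diff)
    fix i assume i: "i \<in> I"
    then obtain N where N: "i \<in> A N"
      using A(2) by blast
    have "L2_inner M (S n) (e i) = L2_inner M f (e i)" if "n \<ge> N" for n
      using N mono[OF that] i unfolding S_def by (auto simp: L2_inner_partial_e[OF A(3) AI])
    then have "(\<lambda>n. L2_inner M (S n) (e i)) \<longlonglongrightarrow> L2_inner M f (e i)"
      using LIMSEQ_offset by (intro tendsto_eventually) (auto simp: eventually_sequentially)
    moreover have "(\<lambda>n. L2_inner M (S n) (e i)) \<longlonglongrightarrow> L2_inner M g (e i)"
      by (intro L2_inner_tendsto S g L2_e i)
    ultimately have "L2_inner M f (e i) = L2_inner M g (e i)"
      by (rule LIMSEQ_unique)
    then show "L2_inner M (\<lambda>x. f x - g x) (e i) = 0"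
      using f g L2_e[OF i] by (simp add: L2_inner_diff_left)
  qed
  then have AE: "AE x in M. f x = g x"
    by simp
  have "(\<lambda>n. L2_inner M (S n) (S n)) \<longlonglongrightarrow> L2_inner M g g"
    by (rule L2_inner_self_tendsto[OF S g])
  moreover have "L2_inner M (S n) (S n) = a n" for n
    using energy_partial_diff[OF A(3) AI, of "{}" n f] by (simp add: S_def a_def partial_def[of f "{}"])
  moreover have "L2_inner M g g = L2_inner M f f"
    using L2_inner_cong_AE[OF f g(1) g(1) AE] L2_inner_cong_AE[OF f g(1) f AE]
    by (simp add: L2_inner_commute)
  ultimately show ?thesis
    by (simp add: a_def)
qed

end

section \<open>Weak gradients on bounded sets\<close>

lemma GDERIV_zero_outside_support:
  assumes "\<And>x. GDERIV \<phi> x :> g x" "x \<notin> closure {x. \<phi> x \<noteq> 0}"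
  shows "g x = 0"
proof -
  have "((\<lambda>_. 0) has_derivative (\<lambda>h. h \<bullet> g x)) (at x)"
  proof (rule has_derivative_transform_within_open)
    show "(\<phi> has_derivative (\<lambda>h. h \<bullet> g x)) (at x)"
      using assms(1) by (simp add: gderiv_def)
    show "open (- closure {x. \<phi> x \<noteq> 0})" "x \<in> - closure {x. \<phi> x \<noteq> 0}"
      using assms(2) by auto
    show "\<phi> y = 0" if "y \<in> - closure {x. \<phi> x \<noteq> 0}" for y
      using that closure_subset[of "{x. \<phi> x \<noteq> 0}"] by blast
  qed
  then have "(\<lambda>h. h \<bullet> g x) = (\<lambda>h. 0)"
    using has_derivative_unique has_derivative_const by blast
  then show ?thesis
    by (metis inner_eq_zero_iff)
qed

lemma GDERIV_continuous_on: "(\<And>x. GDERIV f x :> g x) \<Longrightarrow> continuous_on S f"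
  by (meson continuous_at_imp_continuous_on gderiv_def has_derivative_continuous)

lemma integral_lborel_translation:
  fixes f :: "'a::euclidean_space \<Rightarrow> 'b::{banach, second_countable_topology}"
  assumes "f \<in> borel_measurable borel"
  shows "(LINT x|lborel. f (c + x)) = (LINT x|lborel. f x)"
  using integral_distr[of "(+) c" lborel borel f] assms by (simp add: lborel_distr_plus)

text \<open>Translation invariance makes the integrals of the difference quotients vanish.\<close>

lemma integral_GDERIV_compact_support:
  fixes \<psi> :: "'a::euclidean_space \<Rightarrow> real"
  assumes D: "\<And>x. GDERIV \<psi> x :> g x" and cont: "continuous_on UNIV g"
    and supp: "compact (closure {x. \<psi> x \<noteq> 0})"
  shows "(LINT x|lborel. g x \<bullet> d) = 0"
proof -
  define K where "K = closure {x. \<psi> x \<noteq> 0}"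
  have cont_\<psi>: "continuous_on S \<psi>" for S
    using D by (rule GDERIV_continuous_on)
  have [measurable]: "\<psi> \<in> borel_measurable borel" "g \<in> borel_measurable borel"
    using cont cont_\<psi> by (auto intro: borel_measurable_continuous_onI)
  have "compact (g ` K)"
    using supp cont unfolding K_def by (intro compact_continuous_image) (auto intro: continuous_on_subset)
  then obtain B where B: "0 < B" "\<And>x. x \<in> K \<Longrightarrow> norm (g x) \<le> B"
    using compact_imp_bounded bounded_pos by (metis imageI)
  have gB: "norm (g x) \<le> B" for x
    using B GDERIV_zero_outside_support[OF D, of x] by (cases "x \<in> K") (auto simp: K_def)
  have lip: "\<bar>\<psi> x - \<psi> y\<bar> \<le> B * norm (x - y)" for x y
  proof -
    have "norm (\<psi> x - \<psi> y) \<le> B * norm (x - y)"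
    proof (rule differentiable_bound[OF convex_UNIV])
      show "(\<psi> has_derivative (\<lambda>h. h \<bullet> g z)) (at z within UNIV)" for z
        using D by (simp add: gderiv_def)
      show "onorm (\<lambda>h. h \<bullet> g z) \<le> B" for z
      proof (rule onorm_le)
        show "norm (h \<bullet> g z) \<le> B * norm h" for h
          using Cauchy_Schwarz_ineq2[of h "g z"] mult_left_mono[OF gB[of z], of "norm h"]
          by (simp add: mult.commute)
      qed
    qed auto
    then show ?thesis by simp
  qed
  obtain r where r: "\<And>x. x \<in> K \<Longrightarrow> norm x \<le> r"
    using supp compact_imp_bounded bounded_pos unfolding K_def by metis
  define \<tau> where "\<tau> n = inverse (real (Suc n))" for n
  have \<tau>: "0 < \<tau> n" "\<tau> n \<le> 1" for n
    by (simp_all add: \<tau>_def inverse_le_1_iff)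
  define q where "q n x = (\<psi> (\<tau> n *\<^sub>R d + x) - \<psi> x) / \<tau> n" for n x
  have int_\<psi>: "integrable lborel (\<lambda>x. \<psi> (c + x))" for c
  proof -
    have "integrable lborel \<psi>"
    proof -
      have "integrable lborel (\<lambda>x. indicator K x *\<^sub>R \<psi> x)"
        using supp cont_\<psi> unfolding K_def by (intro borel_integrable_compact)
      moreover have "(\<lambda>x. indicator K x *\<^sub>R \<psi> x) = \<psi>"
        using closure_subset[of "{x. \<psi> x \<noteq> 0}"] by (auto simp: K_def indicator_def fun_eq_iff)
      ultimately show ?thesis by (simp only:)
    qed
    then have "integrable (distr lborel borel ((+) c)) \<psi>"
      by (simp add: lborel_distr_plus)
    then show ?thesis
      by (subst (asm) integrable_distr_eq) auto
  qed
  have q_int: "(LINT x|lborel. q n x) = 0" for n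
    using int_\<psi>[of 0] int_\<psi>[of "\<tau> n *\<^sub>R d"] by (simp add: q_def integral_lborel_translation)
  have "(\<lambda>n. LINT x|lborel. q n x) \<longlonglongrightarrow> (LINT x|lborel. g x \<bullet> d)"
  proof (rule integral_dominated_convergence)
    show "(\<lambda>x. g x \<bullet> d) \<in> borel_measurable lborel" "q n \<in> borel_measurable lborel" for n
      unfolding q_def by measurable
    \<comment> \<open>Since \<open>\<tau> n \<le> 1\<close>, a difference quotient vanishes beyond
      distance \<open>norm d\<close> from the support, so one ball dominates them all.\<close>
    show "integrable lborel (\<lambda>x. indicator (cball 0 (r + norm d)) x * (B * norm d))"
      by (intro integrable_mult_left integrable_real_indicator)
        (use emeasure_bounded_finite[OF bounded_cball, of 0 "r + norm d"] in \<open>auto simp: less_top\<close>)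
    show "AE x in lborel. norm (q n x) \<le> indicator (cball 0 (r + norm d)) x * (B * norm d)" for n
    proof (intro AE_I2)
      fix x
      have "norm (q n x) \<le> B * norm d"
        using lip[of "\<tau> n *\<^sub>R d + x" x] \<tau>[of n] by (simp add: q_def field_simps)
      moreover have "q n x = 0" if "norm x > r + norm d"
      proof -
        have "norm (\<tau> n *\<^sub>R d) \<le> norm d"
          using \<tau>[of n] by (simp add: mult_left_le_one_le)
        then have "norm x - norm d \<le> norm (\<tau> n *\<^sub>R d + x)"
          using norm_diff_ineq[of x "\<tau> n *\<^sub>R d"] by (simp add: add.commute)
        moreover have "0 \<le> norm d" by simp
        ultimately have "\<tau> n *\<^sub>R d + x \<notin> K" "x \<notin> K"
          using that r[of x] r[of "\<tau> n *\<^sub>R d + x"] by linarith+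
        moreover have "\<psi> y = 0" if "y \<notin> K" for y
          using that closure_subset[of "{x. \<psi> x \<noteq> 0}"] by (auto simp: K_def)
        ultimately show ?thesis
          by (simp add: q_def)
      qed
      ultimately show "norm (q n x) \<le> indicator (cball 0 (r + norm d)) x * (B * norm d)"
        by (auto simp: indicator_def)
    qed
    show "AE x in lborel. (\<lambda>n. q n x) \<longlonglongrightarrow> g x \<bullet> d"
    proof (intro AE_I2)
      fix x
      have "((\<lambda>t. x + t *\<^sub>R d) has_derivative (\<lambda>t. t *\<^sub>R d)) (at 0)"
        by (auto intro!: derivative_eq_intros)
      then have "((\<lambda>t. \<psi> (x + t *\<^sub>R d)) has_derivative (\<lambda>t. (t *\<^sub>R d) \<bullet> g x)) (at 0)"
        using has_derivative_compose[of "\<lambda>t. x + t *\<^sub>R d" "\<lambda>t. t *\<^sub>R d" 0 UNIV \<psi> "\<lambda>h. h \<bullet> g x"] D[of x]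
        by (simp add: gderiv_def)
      then have "((\<lambda>t. \<psi> (x + t *\<^sub>R d)) has_field_derivative (g x \<bullet> d)) (at 0)"
        by (simp add: has_field_derivative_def inner_commute mult_commute_abs)
      then have "((\<lambda>t. (\<psi> (x + t *\<^sub>R d) - \<psi> x) / t) \<longlongrightarrow> g x \<bullet> d) (at 0)"
        by (simp add: has_field_derivative_iff)
      moreover have "filterlim \<tau> (at 0) sequentially"
        using LIMSEQ_inverse_real_of_nat \<tau>
        by (auto simp: filterlim_at \<tau>_def[abs_def])
      ultimately show "(\<lambda>n. q n x) \<longlonglongrightarrow> g x \<bullet> d"
        unfolding q_def by (auto simp: add.commute dest: filterlim_compose)
    qed
  qed
  then show ?thesis
    by (simp add: q_int LIMSEQ_const_iff)
qed

section \<open>Weak gradients expressed by inner products on the restricted measure\<close>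

abbreviation lborel_on :: "'a::euclidean_space set \<Rightarrow> 'a measure"
  where "lborel_on \<Omega> \<equiv> restrict_space lborel \<Omega>"

lemma lborel_on_measurable:
  assumes "f \<in> borel_measurable borel"
  shows "f \<in> borel_measurable (lborel_on \<Omega>)"
  using assms by (intro measurable_restrict_space1) simp

lemma square_integrable_on_iff_L2:
  assumes "\<Omega> \<in> sets borel"
  shows "f square_integrable_on \<Omega> \<longleftrightarrow> L2 (lborel_on \<Omega>) f"
  using assms
  by (simp add: square_integrable_on_def L2_def set_borel_measurable_def set_integrable_def
      borel_measurable_restrict_space_iff integrable_restrict_space)

lemma set_integral_eq_lborel_on:
  fixes f :: "'a::euclidean_space \<Rightarrow> 'b::{banach, second_countable_topology}"
  assumes "\<Omega> \<in> sets borel"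
  shows "(LINT x:\<Omega>|lborel. f x) = (LINT x|lborel_on \<Omega>. f x)"
  using assms by (simp add: set_lebesgue_integral_def integral_restrict_space)

lemma finite_measure_lborel_on:
  assumes "bounded \<Omega>" "\<Omega> \<in> sets borel"
  shows "finite_measure (lborel_on \<Omega>)"
  using assms emeasure_bounded_finite[of \<Omega>]
  by (intro finite_measureI) (simp add: emeasure_restrict_space space_restrict_space)

lemma L2_continuous:
  fixes f :: "'a::euclidean_space \<Rightarrow> 'b::euclidean_space"
  assumes "bounded \<Omega>" "\<Omega> \<in> sets borel" "continuous_on UNIV f"
  shows "L2 (lborel_on \<Omega>) f"
proof -
  have "compact (f ` closure \<Omega>)"
    using assms by (intro compact_continuous_image) (auto intro: continuous_on_subset simp: compact_closure)
  then obtain B where "\<And>x. x \<in> closure \<Omega> \<Longrightarrow> norm (f x) \<le> B"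
    using compact_imp_bounded bounded_pos by (metis imageI)
  then show ?thesis
    using assms closure_subset[of \<Omega>]
    by (intro L2_bounded[of _ _ B] finite_measure_lborel_on lborel_on_measurable borel_measurable_continuous_onI)
      (auto simp: space_restrict_space)
qed

lemma integrable_L2_scaleR:
  assumes "L2 M u" "L2 M G"
  shows "integrable M (\<lambda>x. u x *\<^sub>R G x)"
proof (rule Bochner_Integration.integrable_bound)
  show "integrable M (\<lambda>x. (norm (u x))\<^sup>2 + (norm (G x))\<^sup>2)"
    using assms by (simp add: L2_def)
  show "(\<lambda>x. u x *\<^sub>R G x) \<in> borel_measurable M"
    using assms by measurable
  show "AE x in M. norm (u x *\<^sub>R G x) \<le> norm ((norm (u x))\<^sup>2 + (norm (G x))\<^sup>2)"
  proof (intro AE_I2)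
    fix x
    show "norm (u x *\<^sub>R G x) \<le> norm ((norm (u x))\<^sup>2 + (norm (G x))\<^sup>2)"
      using sum_squares_bound[of "norm (u x)" "norm (G x)"]
        mult_nonneg_nonneg[OF norm_ge_zero[of "u x"] norm_ge_zero[of "G x"]]
      unfolding norm_scaleR real_norm_def by linarith
  qed
qed

text \<open>Contracting the vector identity with every fixed direction \<open>d\<close> replaces it
  by scalar inner products, for which linearity and continuity of \<open>L2_inner\<close> are at
  hand.\<close>

lemma sobolev_H1_iff:
  fixes u :: "'a::euclidean_space \<Rightarrow> real"
  assumes "bounded \<Omega>" "\<Omega> \<in> sets borel"
  shows "sobolev_H1 \<Omega> u G \<longleftrightarrow> L2 (lborel_on \<Omega>) u \<and> L2 (lborel_on \<Omega>) G \<and>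
    (\<forall>\<phi> g d. test_function \<Omega> \<phi> g \<longrightarrow>
      L2_inner (lborel_on \<Omega>) u (\<lambda>x. g x \<bullet> d) = - L2_inner (lborel_on \<Omega>) G (\<lambda>x. \<phi> x *\<^sub>R d))"
proof -
  have "(LINT x|lborel_on \<Omega>. u x *\<^sub>R g x) = - (LINT x|lborel_on \<Omega>. \<phi> x *\<^sub>R G x) \<longleftrightarrow>
      (\<forall>d. L2_inner (lborel_on \<Omega>) u (\<lambda>x. g x \<bullet> d) = - L2_inner (lborel_on \<Omega>) G (\<lambda>x. \<phi> x *\<^sub>R d))"
    if u: "L2 (lborel_on \<Omega>) u" and G: "L2 (lborel_on \<Omega>) G" and \<phi>: "test_function \<Omega> \<phi> g" for \<phi> g
  proof -
    have "L2 (lborel_on \<Omega>) \<phi>" "L2 (lborel_on \<Omega>) g"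
      using \<phi> GDERIV_continuous_on[of \<phi> g] by (auto intro!: L2_continuous[OF assms] simp: test_function_def)
    then have "integrable (lborel_on \<Omega>) (\<lambda>x. u x *\<^sub>R g x)" "integrable (lborel_on \<Omega>) (\<lambda>x. \<phi> x *\<^sub>R G x)"
      using u G by (auto intro: integrable_L2_scaleR)
    then have inner: "(LINT x|lborel_on \<Omega>. u x *\<^sub>R g x) \<bullet> d = L2_inner (lborel_on \<Omega>) u (\<lambda>x. g x \<bullet> d)"
      "(LINT x|lborel_on \<Omega>. \<phi> x *\<^sub>R G x) \<bullet> d = L2_inner (lborel_on \<Omega>) G (\<lambda>x. \<phi> x *\<^sub>R d)" for d
      unfolding L2_inner_def by (simp_all flip: integral_inner_left)
    show ?thesis
      using vector_eq_rdot[of "LINT x|lborel_on \<Omega>. u x *\<^sub>R g x" "- (LINT x|lborel_on \<Omega>. \<phi> x *\<^sub>R G x)"]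
      by (simp only: inner_minus_left inner)
  qed
  then show ?thesis
    unfolding sobolev_H1_def square_integrable_on_iff_L2[OF assms(2)] set_integral_eq_lborel_on[OF assms(2)]
    by blast
qed

lemma L2_test_function:
  assumes "bounded \<Omega>" "\<Omega> \<in> sets borel" "test_function \<Omega> \<phi> g"
  shows "L2 (lborel_on \<Omega>) (\<lambda>x. g x \<bullet> d)" "L2 (lborel_on \<Omega>) (\<lambda>x. \<phi> x *\<^sub>R d)"
  using assms(3) GDERIV_continuous_on[of \<phi> g]
  by (auto intro!: L2_continuous[OF assms(1,2)] continuous_intros simp: test_function_def)

lemma sobolev_H1_add_scaleR:
  assumes "bounded \<Omega>" "\<Omega> \<in> sets borel" "sobolev_H1 \<Omega> u G" "sobolev_H1 \<Omega> v H"
  shows "sobolev_H1 \<Omega> (\<lambda>x. u x + c * v x) (\<lambda>x. G x + c *\<^sub>R H x)"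
  using assms(3,4) unfolding sobolev_H1_iff[OF assms(1,2)]
  by (auto simp: L2_add L2_mult L2_scaleR L2_test_function[OF assms(1,2)] L2_inner_add_left
      L2_inner_mult_left L2_inner_scaleR_left)

text \<open>For a fixed test function both sides of the weak identity are continuous in the norm.
  This puts the limit of a minimizing sequence back into the Sobolev space.\<close>

lemma sobolev_H1_closed:
  assumes "bounded \<Omega>" "\<Omega> \<in> sets borel" and H1: "\<And>n. sobolev_H1 \<Omega> (u n) (G n)"
    and u: "L2 (lborel_on \<Omega>) u'" "(\<lambda>n. L2_norm (lborel_on \<Omega>) (\<lambda>x. u n x - u' x)) \<longlonglongrightarrow> 0"
    and G: "L2 (lborel_on \<Omega>) G'" "(\<lambda>n. L2_norm (lborel_on \<Omega>) (\<lambda>x. G n x - G' x)) \<longlonglongrightarrow> 0"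
  shows "sobolev_H1 \<Omega> u' G'"
  unfolding sobolev_H1_iff[OF assms(1,2)]
proof (intro conjI allI impI u G)
  fix \<phi> g d assume \<phi>: "test_function \<Omega> \<phi> g"
  have L2: "L2 (lborel_on \<Omega>) (u n)" "L2 (lborel_on \<Omega>) (G n)" for n
    using H1 by (auto simp: sobolev_H1_iff[OF assms(1,2)])
  have "(\<lambda>n. L2_inner (lborel_on \<Omega>) (u n) (\<lambda>x. g x \<bullet> d)) \<longlonglongrightarrow> L2_inner (lborel_on \<Omega>) u' (\<lambda>x. g x \<bullet> d)"
    by (intro L2_inner_tendsto L2 u L2_test_function[OF assms(1,2) \<phi>])
  moreover have "(\<lambda>n. - L2_inner (lborel_on \<Omega>) (G n) (\<lambda>x. \<phi> x *\<^sub>R d)) \<longlonglongrightarrow>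
      - L2_inner (lborel_on \<Omega>) G' (\<lambda>x. \<phi> x *\<^sub>R d)"
    by (intro tendsto_minus L2_inner_tendsto L2 G L2_test_function[OF assms(1,2) \<phi>])
  moreover have "L2_inner (lborel_on \<Omega>) (u n) (\<lambda>x. g x \<bullet> d) = - L2_inner (lborel_on \<Omega>) (G n) (\<lambda>x. \<phi> x *\<^sub>R d)" for n
    using H1 \<phi> by (auto simp: sobolev_H1_iff[OF assms(1,2)])
  ultimately show "L2_inner (lborel_on \<Omega>) u' (\<lambda>x. g x \<bullet> d) = - L2_inner (lborel_on \<Omega>) G' (\<lambda>x. \<phi> x *\<^sub>R d)"
    using LIMSEQ_unique by fastforce
qed

text \<open>The product of \<open>u\<close> with a test function is \<open>C^1\<close> with compact
  support, so its gradient integrates to zero; the product rule splits this into the two sides of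
  the weak identity.\<close>

lemma sobolev_H1_C1:
  fixes u :: "'a::euclidean_space \<Rightarrow> real"
  assumes \<Omega>: "bounded \<Omega>" "\<Omega> \<in> sets borel"
    and u: "\<And>x. GDERIV u x :> G x" "continuous_on UNIV G"
  shows "sobolev_H1 \<Omega> u G"
  unfolding sobolev_H1_iff[OF \<Omega>]
proof (intro conjI allI impI)
  have cont_u: "continuous_on UNIV u"
    using u(1) by (rule GDERIV_continuous_on)
  show "L2 (lborel_on \<Omega>) u" "L2 (lborel_on \<Omega>) G"
    using \<Omega> cont_u u(2) by (auto intro: L2_continuous)
  fix \<phi> g d assume \<phi>: "test_function \<Omega> \<phi> g"
  have cont_\<phi>: "continuous_on UNIV \<phi>"
    using \<phi> GDERIV_continuous_on[of \<phi> g] by (auto simp: test_function_def)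
  define K where "K = closure {x. \<phi> x \<noteq> 0}"
  have K: "compact K" "K \<subseteq> \<Omega>"
    using \<phi> by (auto simp: test_function_def K_def)
  have zero: "\<phi> x = 0" "g x = 0" if "x \<notin> \<Omega>" for x
    using that K closure_subset[of "{x. \<phi> x \<noteq> 0}"] \<phi> GDERIV_zero_outside_support[of \<phi> g x]
    by (auto simp: test_function_def K_def)
  have "(LINT x|lborel. (u x *\<^sub>R g x + \<phi> x *\<^sub>R G x) \<bullet> d) = 0"
  proof (rule integral_GDERIV_compact_support)
    show "GDERIV (\<lambda>x. u x * \<phi> x) x :> u x *\<^sub>R g x + \<phi> x *\<^sub>R G x" for x
      using u(1) \<phi> by (intro GDERIV_mult) (auto simp: test_function_def)
    show "continuous_on UNIV (\<lambda>x. u x *\<^sub>R g x + \<phi> x *\<^sub>R G x)"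
      using u \<phi> cont_u cont_\<phi> by (intro continuous_intros) (auto simp: test_function_def)
    have "closure {x. u x * \<phi> x \<noteq> 0} \<subseteq> K"
      unfolding K_def by (intro closure_mono) auto
    then show "compact (closure {x. u x * \<phi> x \<noteq> 0})"
      using compact_Int_closed[OF K(1) closed_closure[of "{x. u x * \<phi> x \<noteq> 0}"]]
      by (simp add: Int_absorb1)
  qed
  moreover have "(u x *\<^sub>R g x + \<phi> x *\<^sub>R G x) \<bullet> d = indicator \<Omega> x *\<^sub>R (u x * (g x \<bullet> d) + G x \<bullet> (\<phi> x *\<^sub>R d))" for x
    using zero[of x] by (auto simp: indicator_def inner_add)
  ultimately have "(LINT x|lborel_on \<Omega>. u x * (g x \<bullet> d) + G x \<bullet> (\<phi> x *\<^sub>R d)) = 0"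
    using \<Omega>(2) by (simp add: integral_restrict_space)
  moreover have "integrable (lborel_on \<Omega>) (\<lambda>x. u x \<bullet> (g x \<bullet> d))" "integrable (lborel_on \<Omega>) (\<lambda>x. G x \<bullet> (\<phi> x *\<^sub>R d))"
    by (intro integrable_inner L2_test_function[OF \<Omega> \<phi>] L2_continuous[OF \<Omega>] cont_u u(2))+
  ultimately show "L2_inner (lborel_on \<Omega>) u (\<lambda>x. g x \<bullet> d) = - L2_inner (lborel_on \<Omega>) G (\<lambda>x. \<phi> x *\<^sub>R d)"
    by (simp add: L2_inner_def)
qed

section \<open>Coordinates and integration by parts on a parallelogram\<close>

text \<open>Squaring removes the kink of the positive part, so that cutoffs built from it are
  \<open>C^1\<close>, as \<open>test_function\<close> demands.\<close>

lemma DERIV_max_0_power2: "DERIV (\<lambda>y. (max 0 y)\<^sup>2) y :> 2 * max 0 y" for y :: real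
proof (cases y "0 :: real" rule: linorder_cases)
  case less
  have "DERIV (\<lambda>_. 0 :: real) y :> 0" by simp
  then have "DERIV (\<lambda>y. (max 0 y)\<^sup>2) y :> 0"
    by (rule has_field_derivative_transform_within_open[of _ _ _ "{..<0}"]) (use less in auto)
  with less show ?thesis by simp
next
  case greater
  have "DERIV (\<lambda>y. y\<^sup>2) y :> 2 * y"
    by (auto intro!: derivative_eq_intros)
  then have "DERIV (\<lambda>y. (max 0 y)\<^sup>2) y :> 2 * y"
    by (rule has_field_derivative_transform_within_open[of _ _ _ "{0<..}"]) (use greater in auto)
  with greater show ?thesis by simp
next
  case equal
  have "((\<lambda>h::real. (max 0 h)\<^sup>2 / h) \<longlongrightarrow> 0) (at 0)"
  proof (rule Lim_null_comparison)
    show "\<forall>\<^sub>F h in at 0. norm ((max 0 h)\<^sup>2 / h) \<le> \<bar>h :: real\<bar>"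
      by (intro always_eventually allI) (auto simp: max_def power2_eq_square)
    show "((\<lambda>h::real. \<bar>h\<bar>) \<longlongrightarrow> 0) (at 0)"
      by (auto intro!: tendsto_eq_intros)
  qed
  with equal show ?thesis
    by (simp add: has_field_derivative_iff)
qed

text \<open>A \<open>C\<^sup>1\<close> cutoff supported where \<open>r (1 - r) \<ge> \<epsilon>\<close>; the point of its shape is that
  \<open>r (1 - r)\<close> times its derivative stays bounded as \<open>\<epsilon> \<rightarrow> 0\<close>.\<close>

definition cutoff :: "real \<Rightarrow> real \<Rightarrow> real"
  where "cutoff \<epsilon> r = (max 0 (r * (1 - r) - \<epsilon>))\<^sup>2 / ((max 0 (r * (1 - r) - \<epsilon>))\<^sup>2 + \<epsilon>\<^sup>2)"

definition cutoff' :: "real \<Rightarrow> real \<Rightarrow> real"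
  where "cutoff' \<epsilon> r = 2 * max 0 (r * (1 - r) - \<epsilon>) * (1 - 2 * r) * \<epsilon>\<^sup>2
    / ((max 0 (r * (1 - r) - \<epsilon>))\<^sup>2 + \<epsilon>\<^sup>2)\<^sup>2"

lemma cutoff_denominator_pos: "0 < \<epsilon> \<Longrightarrow> 0 < (max 0 y)\<^sup>2 + \<epsilon>\<^sup>2" for y \<epsilon> :: real
  by (simp add: add_nonneg_pos)

lemma DERIV_cutoff:
  assumes "0 < \<epsilon>"
  shows "DERIV (cutoff \<epsilon>) r :> cutoff' \<epsilon> r"
proof -
  define P where "P r = (max 0 (r * (1 - r) - \<epsilon>))\<^sup>2" for r
  define P' where "P' r = 2 * max 0 (r * (1 - r) - \<epsilon>) * (1 - 2 * r)" for r
  have P: "DERIV P r :> P' r"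
    unfolding P_def P'_def
    by (rule DERIV_chain2[OF DERIV_max_0_power2]) (auto intro!: derivative_eq_intros)
  have pos: "0 < P r + \<epsilon>\<^sup>2"
    unfolding P_def by (rule cutoff_denominator_pos[OF assms])
  have "DERIV (\<lambda>r. P r / (P r + \<epsilon>\<^sup>2)) r :> (P' r * (P r + \<epsilon>\<^sup>2) - P r * P' r) / ((P r + \<epsilon>\<^sup>2) * (P r + \<epsilon>\<^sup>2))"
    using pos by (auto intro!: derivative_eq_intros P)
  also have "(P' r * (P r + \<epsilon>\<^sup>2) - P r * P' r) / ((P r + \<epsilon>\<^sup>2) * (P r + \<epsilon>\<^sup>2)) = cutoff' \<epsilon> r"
    by (simp add: cutoff'_def P_def P'_def power2_eq_square algebra_simps)
  finally show ?thesis
    by (simp add: P_def cutoff_def[abs_def])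
qed

lemma continuous_on_cutoff': "0 < \<epsilon> \<Longrightarrow> continuous_on S (cutoff' \<epsilon>)"
  unfolding cutoff'_def[abs_def] using cutoff_denominator_pos[of \<epsilon>]
  by (intro continuous_intros) (metis less_irrefl power_zero_numeral zero_less_power)

lemma cutoff_bounds: "0 \<le> cutoff \<epsilon> r" "cutoff \<epsilon> r \<le> 1"
proof -
  show "0 \<le> cutoff \<epsilon> r"
    by (simp add: cutoff_def)
  define P where "P = (max 0 (r * (1 - r) - \<epsilon>))\<^sup>2"
  have "cutoff \<epsilon> r \<le> (P + \<epsilon>\<^sup>2) / (P + \<epsilon>\<^sup>2)"
    unfolding cutoff_def P_def[symmetric] by (rule divide_right_mono) (auto simp: P_def)
  also have "\<dots> \<le> 1"
    by (simp add: divide_self_if)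
  finally show "cutoff \<epsilon> r \<le> 1" .
qed

lemma cutoff_eq_0: "r * (1 - r) \<le> \<epsilon> \<Longrightarrow> cutoff \<epsilon> r = 0"
  by (simp add: cutoff_def)

text \<open>With \<open>z\<close> the positive part of \<open>r * (1 - r) - \<epsilon>\<close>, the
  claim reduces to \<open>(z + \<epsilon>) * (z * \<epsilon>\<^sup>2) \<le> (z\<^sup>2 +
  \<epsilon>\<^sup>2)\<^sup>2\<close>. Both sides are homogeneous of degree four, which is why the
  bound does not depend on \<open>\<epsilon>\<close>.\<close>

lemma cutoff'_bound:
  assumes "0 < \<epsilon>" "0 \<le> r" "r \<le> 1"
  shows "r * (1 - r) * \<bar>cutoff' \<epsilon> r\<bar> \<le> 2"
proof -
  define z where "z = max 0 (r * (1 - r) - \<epsilon>)"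
  have z: "0 \<le> z" "r * (1 - r) \<le> z + \<epsilon>"
    by (auto simp: z_def)
  have "r * (1 - r) * \<bar>cutoff' \<epsilon> r\<bar> = (r * (1 - r)) * \<bar>1 - 2 * r\<bar> * (2 * z * \<epsilon>\<^sup>2 / (z\<^sup>2 + \<epsilon>\<^sup>2)\<^sup>2)"
    using z by (simp add: cutoff'_def z_def[symmetric] abs_mult)
  also have "\<dots> \<le> (z + \<epsilon>) * 1 * (2 * z * \<epsilon>\<^sup>2 / (z\<^sup>2 + \<epsilon>\<^sup>2)\<^sup>2)"
    using assms z by (intro mult_mono) auto
  also have "\<dots> \<le> 2"
  proof -
    have "2 * (z * \<epsilon>) \<le> z\<^sup>2 + \<epsilon>\<^sup>2"
      using sum_squares_bound[of z \<epsilon>] by simp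
    then have "z * \<epsilon> \<le> z\<^sup>2 + \<epsilon>\<^sup>2"
      using z assms mult_nonneg_nonneg[of z \<epsilon>] by linarith
    then have "(z * \<epsilon>) * \<epsilon>\<^sup>2 \<le> (z\<^sup>2 + \<epsilon>\<^sup>2) * \<epsilon>\<^sup>2"
      by (rule mult_right_mono) simp
    moreover have "0 \<le> z\<^sup>2 * z\<^sup>2" "0 \<le> z\<^sup>2 * \<epsilon>\<^sup>2" by simp_all
    moreover have "(z\<^sup>2 + \<epsilon>\<^sup>2)\<^sup>2 = z\<^sup>2 * z\<^sup>2 + 2 * (z\<^sup>2 * \<epsilon>\<^sup>2) + \<epsilon>\<^sup>2 * \<epsilon>\<^sup>2"
      "(z\<^sup>2 + \<epsilon>\<^sup>2) * \<epsilon>\<^sup>2 = z\<^sup>2 * \<epsilon>\<^sup>2 + \<epsilon>\<^sup>2 * \<epsilon>\<^sup>2"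
      "(z + \<epsilon>) * (z * \<epsilon>\<^sup>2) = z\<^sup>2 * \<epsilon>\<^sup>2 + (z * \<epsilon>) * \<epsilon>\<^sup>2"
      by (simp_all add: power2_eq_square algebra_simps)
    ultimately have "(z + \<epsilon>) * (z * \<epsilon>\<^sup>2) \<le> (z\<^sup>2 + \<epsilon>\<^sup>2)\<^sup>2"
      by linarith
    moreover have "0 < (z\<^sup>2 + \<epsilon>\<^sup>2)\<^sup>2"
      using assms by (simp add: add_nonneg_eq_0_iff)
    ultimately show ?thesis
      by (simp add: divide_le_eq algebra_simps)
  qed
  finally show ?thesis .
qed

lemma cutoff_tendsto:
  assumes "\<epsilon> \<longlonglongrightarrow> 0" "0 < r" "r < 1"
  shows "(\<lambda>n. cutoff (\<epsilon> n) r) \<longlonglongrightarrow> 1" "(\<lambda>n. cutoff' (\<epsilon> n) r) \<longlonglongrightarrow> 0"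
proof -
  have pos: "0 < r * (1 - r)"
    using assms by simp
  have "(\<lambda>n. max 0 (r * (1 - r) - \<epsilon> n)) \<longlonglongrightarrow> max 0 (r * (1 - r) - 0)"
    using assms(1) by (intro tendsto_intros)
  then have *: "(\<lambda>n. max 0 (r * (1 - r) - \<epsilon> n)) \<longlonglongrightarrow> r * (1 - r)"
    using pos by simp
  have "(\<lambda>n. cutoff (\<epsilon> n) r) \<longlonglongrightarrow> (r * (1 - r))\<^sup>2 / ((r * (1 - r))\<^sup>2 + 0\<^sup>2)"
    unfolding cutoff_def using pos assms by (intro tendsto_intros *) auto
  then show "(\<lambda>n. cutoff (\<epsilon> n) r) \<longlonglongrightarrow> 1"
    using assms by simp
  have "(\<lambda>n. cutoff' (\<epsilon> n) r) \<longlonglongrightarrow>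
      2 * (r * (1 - r)) * (1 - 2 * r) * 0\<^sup>2 / ((r * (1 - r))\<^sup>2 + 0\<^sup>2)\<^sup>2"
    unfolding cutoff'_def using pos assms by (intro tendsto_intros *) auto
  then show "(\<lambda>n. cutoff' (\<epsilon> n) r) \<longlonglongrightarrow> 0"
    by simp
qed

lemma GDERIV_affine: "GDERIV (\<lambda>x. (x - p) \<bullet> d) x :> d"
  unfolding gderiv_def by (auto intro!: derivative_eq_intros)

lemma continuous_bounded_on_unit_interval:
  fixes f :: "real \<Rightarrow> real"
  assumes "continuous_on UNIV f"
  obtains B where "0 \<le> B" "\<And>r. 0 \<le> r \<Longrightarrow> r \<le> 1 \<Longrightarrow> \<bar>f r\<bar> \<le> B"
proof -
  have "compact (f ` {0..1})"
    using assms by (intro compact_continuous_image) (auto intro: continuous_on_subset)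
  then obtain B where B: "0 < B" "\<forall>y\<in>f ` {0..1}. norm y \<le> B"
    using compact_imp_bounded bounded_pos by metis
  show ?thesis
  proof (rule that[of B])
    show "\<bar>f r\<bar> \<le> B" if "0 \<le> r" "r \<le> 1" for r
      using B(2) that by auto
  qed (use B in simp)
qed

text \<open>Linear vanishing at both endpoints, in the form that balances the growth of
  \<open>cutoff'\<close>. Near 0 it is \<open>\<bar>sin x\<bar> \<le> \<bar>x\<bar>\<close>, near 1
  its reflection; the factor 2 pays for the other of the two factors \<open>r\<close> and
  \<open>1 - r\<close>, which is at least one half.\<close>

lemma abs_sin_pi_bound:
  assumes "0 \<le> r" "r \<le> 1"
  shows "\<bar>sin (real m * pi * r)\<bar> \<le> 2 * real m * pi * (r * (1 - r))"
proof (cases "r \<le> 1 / 2")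
  case True
  have "\<bar>sin (real m * pi * r)\<bar> \<le> real m * pi * r * 1"
    using abs_sin_x_le_abs_x[of "real m * pi * r"] assms by simp
  also have "\<dots> \<le> real m * pi * r * (2 * (1 - r))"
    using True assms by (intro mult_left_mono) auto
  finally show ?thesis by (simp add: mult_ac)
next
  case False
  have "sin (real m * pi * r) = sin (real m * pi - real m * pi * (1 - r))"
    by (simp add: algebra_simps)
  also have "\<bar>\<dots>\<bar> = \<bar>sin (real m * pi * (1 - r))\<bar>"
    by (simp add: sin_diff abs_mult mult.commute[of "real m" pi] sin_npi2 cos_npi2 power_abs)
  also have "\<dots> \<le> real m * pi * (1 - r) * 1"
    using abs_sin_x_le_abs_x[of "real m * pi * (1 - r)"] assms by simp
  also have "\<dots> \<le> real m * pi * (1 - r) * (2 * r)"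
    using False assms by (intro mult_left_mono) auto
  finally show ?thesis by (simp add: mult_ac)
qed

text \<open>The vectors \<open>v'\<close> and \<open>w'\<close> form the basis dual to the sides,
  hence are the gradients of the affine coordinates. Keeping them as parameters makes the setting
  symmetric: through \<open>swap\<close>, whatever is proved along \<open>v\<close> transfers to
  \<open>w\<close>.\<close>

locale plane_coordinates =
  fixes p v w v' w' :: "'a::euclidean_space"
  assumes dual: "v \<bullet> v' = 1" "v \<bullet> w' = 0" "w \<bullet> v' = 0" "w \<bullet> w' = 1"
    and spanning: "\<And>x. x = (x \<bullet> v') *\<^sub>R v + (x \<bullet> w') *\<^sub>R w"
begin

lemma swap: "plane_coordinates w v w' v'"
proof
  show "x = (x \<bullet> w') *\<^sub>R w + (x \<bullet> v') *\<^sub>R v" for x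
    using spanning[of x] by (simp only: add.commute)
qed (use dual in auto)

definition c1 where "c1 x = (x - p) \<bullet> v'"

definition c2 where "c2 x = (x - p) \<bullet> w'"

definition cell where "cell = {x. 0 < c1 x \<and> c1 x < 1 \<and> 0 < c2 x \<and> c2 x < 1}"

definition closed_cell where "closed_cell = {x. 0 \<le> c1 x \<and> c1 x \<le> 1 \<and> 0 \<le> c2 x \<and> c2 x \<le> 1}"

abbreviation M where "M \<equiv> lborel_on cell"

lemma coordinates: "x = p + c1 x *\<^sub>R v + c2 x *\<^sub>R w"
  using spanning[of "x - p"] by (simp add: c1_def c2_def algebra_simps)

lemma coordinates_of [simp]: "c1 (p + a *\<^sub>R v + b *\<^sub>R w) = a" "c2 (p + a *\<^sub>R v + b *\<^sub>R w) = b"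
  using dual by (simp_all add: c1_def c2_def inner_add_left)

lemma continuous_on_coordinates [continuous_intros]: "continuous_on S c1" "continuous_on S c2"
  unfolding c1_def[abs_def] c2_def[abs_def] by (auto intro!: continuous_intros)

lemma cell_subset: "cell \<subseteq> closed_cell"
  by (auto simp: cell_def closed_cell_def)

lemma open_cell: "open cell"
  unfolding cell_def by (intro open_Collect_conj open_Collect_less continuous_intros)

lemma cell_borel [simp, measurable]: "cell \<in> sets borel"
  by (intro borel_open open_cell)

lemma bounded_closed_cell: "bounded closed_cell"
proof (rule boundedI)
  fix x assume x: "x \<in> closed_cell"
  have "norm x \<le> norm p + norm (c1 x *\<^sub>R v) + norm (c2 x *\<^sub>R w)"
    using coordinates[of x] norm_triangle_ineq[of "p + c1 x *\<^sub>R v" "c2 x *\<^sub>R w"]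
      norm_triangle_ineq[of p "c1 x *\<^sub>R v"] by simp
  also have "\<dots> \<le> norm p + norm v + norm w"
    using x by (intro add_mono) (auto simp: closed_cell_def mult_left_le_one_le)
  finally show "norm x \<le> norm p + norm v + norm w" .
qed

lemma compact_closed_cell: "compact closed_cell"
  unfolding compact_eq_bounded_closed closed_cell_def
  using bounded_closed_cell
  by (auto simp: closed_cell_def intro!: closed_Collect_conj closed_Collect_le continuous_intros)

lemma bounded_cell: "bounded cell"
  using bounded_closed_cell cell_subset by (rule bounded_subset)

lemma finite_measure_M: "finite_measure M"
  by (intro finite_measure_lborel_on bounded_cell cell_borel)

lemma space_M: "space M = cell"
  by (simp add: space_restrict_space)

lemma mem_cell: "x \<in> cell \<longleftrightarrow> 0 < c1 x \<and> c1 x < 1 \<and> 0 < c2 x \<and> c2 x < 1"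
  by (simp add: cell_def)

lemmas L2_M_continuous = L2_continuous[OF bounded_cell cell_borel]

lemmas sobolev_iff = sobolev_H1_iff[OF bounded_cell cell_borel]

definition tensor :: "(real \<Rightarrow> real) \<Rightarrow> (real \<Rightarrow> real) \<Rightarrow> 'a \<Rightarrow> real"
  where "tensor f h x = f (c1 x) * h (c2 x)"

lemma GDERIV_tensor:
  assumes "\<And>r. DERIV f r :> f' r" "\<And>r. DERIV h r :> h' r"
  shows "GDERIV (tensor f h) x :> tensor f' h x *\<^sub>R v' + tensor f h' x *\<^sub>R w'"
proof -
  have "GDERIV (\<lambda>x. f (c1 x) * h (c2 x)) x :> f (c1 x) *\<^sub>R (h' (c2 x) *\<^sub>R w') + h (c2 x) *\<^sub>R (f' (c1 x) *\<^sub>R v')"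
    using assms GDERIV_affine unfolding c1_def c2_def
    by (intro GDERIV_mult GDERIV_DERIV_compose)
  then show ?thesis
    by (simp add: tensor_def[abs_def] add.commute mult.commute)
qed

lemma continuous_on_tensor:
  assumes "continuous_on UNIV f" "continuous_on UNIV h"
  shows "continuous_on S (tensor f h)"
proof -
  have "continuous_on S (\<lambda>x. f (c1 x))" "continuous_on S (\<lambda>x. h (c2 x))"
    using continuous_on_compose[of S c1 f] continuous_on_compose[of S c2 h]
      continuous_on_subset[OF assms(1)] continuous_on_subset[OF assms(2)]
    by (auto simp: o_def continuous_on_coordinates)
  then show ?thesis
    unfolding tensor_def[abs_def] by (intro continuous_intros)
qed

lemma sobolev_tensor:
  assumes "\<And>r. DERIV f r :> f' r" "\<And>r. DERIV h r :> h' r"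
    and "continuous_on UNIV f'" "continuous_on UNIV h'"
  shows "sobolev_H1 cell (tensor f h) (\<lambda>x. tensor f' h x *\<^sub>R v' + tensor f h' x *\<^sub>R w')"
  using assms
  by (intro sobolev_H1_C1 bounded_cell cell_borel GDERIV_tensor)
    (auto intro!: continuous_intros continuous_on_tensor DERIV_continuous_on)

lemma test_function_tensor_cutoff:
  assumes "0 < \<epsilon>" "\<And>r. DERIV f r :> f' r" "\<And>r. DERIV h r :> h' r"
    and "continuous_on UNIV f'" "continuous_on UNIV h'"
  shows "test_function cell (tensor (\<lambda>r. f r * cutoff \<epsilon> r) (\<lambda>r. h r * cutoff \<epsilon> r))
    (\<lambda>x. tensor (\<lambda>r. f' r * cutoff \<epsilon> r + f r * cutoff' \<epsilon> r) (\<lambda>r. h r * cutoff \<epsilon> r) x *\<^sub>R v'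
       + tensor (\<lambda>r. f r * cutoff \<epsilon> r) (\<lambda>r. h' r * cutoff \<epsilon> r + h r * cutoff' \<epsilon> r) x *\<^sub>R w')"
  unfolding test_function_def
proof (intro conjI allI)
  have cont: "continuous_on UNIV f" "continuous_on UNIV h" "continuous_on UNIV (cutoff \<epsilon>)"
    using assms DERIV_cutoff[OF assms(1)] by (auto intro: DERIV_continuous_on)
  show "GDERIV (tensor (\<lambda>r. f r * cutoff \<epsilon> r) (\<lambda>r. h r * cutoff \<epsilon> r)) x :>
    tensor (\<lambda>r. f' r * cutoff \<epsilon> r + f r * cutoff' \<epsilon> r) (\<lambda>r. h r * cutoff \<epsilon> r) x *\<^sub>R v'
       + tensor (\<lambda>r. f r * cutoff \<epsilon> r) (\<lambda>r. h' r * cutoff \<epsilon> r + h r * cutoff' \<epsilon> r) x *\<^sub>R w'" for x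
    using assms DERIV_cutoff[OF assms(1)]
    by (intro GDERIV_tensor) (auto intro!: derivative_eq_intros)
  show "continuous_on UNIV (\<lambda>x. tensor (\<lambda>r. f' r * cutoff \<epsilon> r + f r * cutoff' \<epsilon> r) (\<lambda>r. h r * cutoff \<epsilon> r) x *\<^sub>R v'
       + tensor (\<lambda>r. f r * cutoff \<epsilon> r) (\<lambda>r. h' r * cutoff \<epsilon> r + h r * cutoff' \<epsilon> r) x *\<^sub>R w')"
    using assms cont continuous_on_cutoff'[OF assms(1)]
    by (intro continuous_intros continuous_on_tensor)
  define K where "K = {x. \<epsilon> \<le> c1 x * (1 - c1 x) \<and> \<epsilon> \<le> c2 x * (1 - c2 x)}"
  have "closed K"
    unfolding K_def by (intro closed_Collect_conj closed_Collect_le continuous_intros)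
  have sub: "K \<subseteq> cell"
  proof
    fix x assume "x \<in> K"
    then have "0 < c1 x * (1 - c1 x)" "0 < c2 x * (1 - c2 x)"
      using \<open>0 < \<epsilon>\<close> by (auto simp: K_def)
    then show "x \<in> cell"
      by (auto simp: cell_def zero_less_mult_iff)
  qed
  have "{x. tensor (\<lambda>r. f r * cutoff \<epsilon> r) (\<lambda>r. h r * cutoff \<epsilon> r) x \<noteq> 0} \<subseteq> K"
    using cutoff_eq_0 linear by (auto simp: K_def tensor_def)
  then have supp: "closure {x. tensor (\<lambda>r. f r * cutoff \<epsilon> r) (\<lambda>r. h r * cutoff \<epsilon> r) x \<noteq> 0} \<subseteq> K"
    using \<open>closed K\<close> by (rule closure_minimal)
  then show "closure {x. tensor (\<lambda>r. f r * cutoff \<epsilon> r) (\<lambda>r. h r * cutoff \<epsilon> r) x \<noteq> 0} \<subseteq> cell"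
    using sub by blast
  then show "compact (closure {x. tensor (\<lambda>r. f r * cutoff \<epsilon> r) (\<lambda>r. h r * cutoff \<epsilon> r) x \<noteq> 0})"
    using bounded_cell by (auto simp: compact_eq_bounded_closed intro: bounded_subset)
qed

text \<open>The test functions cut off both factors, yet only \<open>f\<close> has to vanish at the
  endpoints. Contraction with \<open>v\<close> removes the term containing the derivative of the
  second factor, because \<open>v\<close> is orthogonal to \<open>w'\<close>; so the unbounded
  derivative of that cutoff never enters. In the first factor \<open>f\<close> compensates the
  derivative of the cutoff.\<close>

lemma sobolev_integration_by_parts:
  assumes H1: "sobolev_H1 cell u G"
    and D: "\<And>r. DERIV f r :> f' r" "\<And>r. DERIV h r :> h' r"
    and cont': "continuous_on UNIV f'" "continuous_on UNIV h'"
    and f: "\<And>r. 0 \<le> r \<Longrightarrow> r \<le> 1 \<Longrightarrow> \<bar>f r\<bar> \<le> C * (r * (1 - r))"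
  shows "L2_inner M u (tensor f' h) = - L2_inner M (\<lambda>x. G x \<bullet> v) (tensor f h)"
proof -
  have u: "L2 M u" and Gv: "L2 M (\<lambda>x. G x \<bullet> v)"
    using H1 L2_component by (auto simp: sobolev_iff)
  have int: "integrable M u" "integrable M (\<lambda>x. G x \<bullet> v)"
    using L2_integrable[OF finite_measure_M] u Gv by auto
  have cont: "continuous_on UNIV f" "continuous_on UNIV h"
    using D by (auto intro: DERIV_continuous_on)
  obtain Bf where Bf: "0 \<le> Bf" "\<And>r. 0 \<le> r \<Longrightarrow> r \<le> 1 \<Longrightarrow> \<bar>f r\<bar> \<le> Bf"
    using continuous_bounded_on_unit_interval[OF cont(1)] by blast
  obtain Bf' where Bf': "0 \<le> Bf'" "\<And>r. 0 \<le> r \<Longrightarrow> r \<le> 1 \<Longrightarrow> \<bar>f' r\<bar> \<le> Bf'"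
    using continuous_bounded_on_unit_interval[OF cont'(1)] by blast
  obtain Bh where Bh: "0 \<le> Bh" "\<And>r. 0 \<le> r \<Longrightarrow> r \<le> 1 \<Longrightarrow> \<bar>h r\<bar> \<le> Bh"
    using continuous_bounded_on_unit_interval[OF cont(2)] by blast
  have "0 \<le> C"
    using f[of "1/2"] by simp
  define \<epsilon> where "\<epsilon> n = inverse (real (Suc n))" for n
  have \<epsilon>: "0 < \<epsilon> n" "\<epsilon> \<longlonglongrightarrow> 0" for n
    using LIMSEQ_inverse_real_of_nat by (auto simp: \<epsilon>_def[abs_def])
  define F where "F n r = f r * cutoff (\<epsilon> n) r" for n r
  define F' where "F' n r = f' r * cutoff (\<epsilon> n) r + f r * cutoff' (\<epsilon> n) r" for n r
  define H where "H n r = h r * cutoff (\<epsilon> n) r" for n r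
  define H' where "H' n r = h' r * cutoff (\<epsilon> n) r + h r * cutoff' (\<epsilon> n) r" for n r
  have test: "test_function cell (tensor (F n) (H n))
    (\<lambda>x. tensor (F' n) (H n) x *\<^sub>R v' + tensor (F n) (H' n) x *\<^sub>R w')" for n
    unfolding F_def F'_def H_def H'_def by (rule test_function_tensor_cutoff[OF \<epsilon>(1) D cont'])
  have eq: "L2_inner M u (tensor (F' n) (H n)) = - L2_inner M (\<lambda>x. G x \<bullet> v) (tensor (F n) (H n))" for n
  proof -
    have "L2_inner M u (\<lambda>x. (tensor (F' n) (H n) x *\<^sub>R v' + tensor (F n) (H' n) x *\<^sub>R w') \<bullet> v)
        = - L2_inner M G (\<lambda>x. tensor (F n) (H n) x *\<^sub>R v)"
      using H1 test[of n] by (auto simp: sobolev_iff)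
    then show ?thesis
      using dual by (simp add: L2_inner_def inner_add_right inner_commute[of _ v] mult.commute)
  qed
  have cont_cutoff: "continuous_on UNIV (cutoff (\<epsilon> n))" for n
    using DERIV_cutoff[OF \<epsilon>(1)] by (auto intro: DERIV_continuous_on)
  have cont_F: "continuous_on UNIV (F n)" "continuous_on UNIV (F' n)" "continuous_on UNIV (H n)" for n
    unfolding F_def F'_def H_def
    by (intro continuous_intros cont cont' cont_cutoff continuous_on_cutoff' \<epsilon>)+
  have lim: "(\<lambda>n. F n r) \<longlonglongrightarrow> f r" "(\<lambda>n. F' n r) \<longlonglongrightarrow> f' r" "(\<lambda>n. H n r) \<longlonglongrightarrow> h r"
    if "0 < r" "r < 1" for r
  proof -
    note c = cutoff_tendsto[OF \<epsilon>(2) that]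
    show "(\<lambda>n. F n r) \<longlonglongrightarrow> f r" "(\<lambda>n. H n r) \<longlonglongrightarrow> h r"
      unfolding F_def H_def using tendsto_mult_left[OF c(1)] by fastforce+
    show "(\<lambda>n. F' n r) \<longlonglongrightarrow> f' r"
      unfolding F'_def using tendsto_add[OF tendsto_mult_left[OF c(1), of "f' r"] tendsto_mult_left[OF c(2), of "f r"]]
      by simp
  qed
  \<comment> \<open>Bounds uniform in \<open>n\<close>, as dominated convergence requires. The
    summand \<open>2 * C\<close> combines the assumed decay of \<open>f\<close> with
    \<open>cutoff'_bound\<close>.\<close>
  have bound_H: "\<bar>H n r\<bar> \<le> Bh" and bound_F: "\<bar>F n r\<bar> \<le> Bf" and bound_F': "\<bar>F' n r\<bar> \<le> Bf' + 2 * C"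
    if r: "0 \<le> r" "r \<le> 1" for n r
  proof -
    note b = cutoff_bounds[of "\<epsilon> n" r]
    show "\<bar>H n r\<bar> \<le> Bh" "\<bar>F n r\<bar> \<le> Bf"
      unfolding H_def F_def abs_mult using b Bh(2)[OF r] Bf(2)[OF r]
      by (smt (verit) abs_ge_zero mult_left_le)+
    have "\<bar>f' r * cutoff (\<epsilon> n) r\<bar> \<le> Bf'"
      unfolding abs_mult using b Bf'(2)[OF r] by (smt (verit) abs_ge_zero mult_left_le)
    moreover have "\<bar>f r * cutoff' (\<epsilon> n) r\<bar> \<le> C * (r * (1 - r)) * \<bar>cutoff' (\<epsilon> n) r\<bar>"
      unfolding abs_mult using f[OF r] by (intro mult_right_mono) auto
    moreover have "C * (r * (1 - r) * \<bar>cutoff' (\<epsilon> n) r\<bar>) \<le> C * 2"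
      using cutoff'_bound[OF \<epsilon>(1) r] \<open>0 \<le> C\<close> by (rule mult_left_mono)
    ultimately show "\<bar>F' n r\<bar> \<le> Bf' + 2 * C"
      unfolding F'_def by (simp add: mult.assoc)
  qed
  have meas: "tensor a b \<in> borel_measurable M" if "continuous_on UNIV a" "continuous_on UNIV b" for a b
    using L2_M_continuous[OF continuous_on_tensor[OF that]] by (simp add: L2_def)
  have "(\<lambda>n. L2_inner M u (tensor (F' n) (H n))) \<longlonglongrightarrow> L2_inner M u (tensor f' h)"
    unfolding L2_inner_def inner_real_def
  proof (rule integral_dominated_convergence)
    show "integrable M (\<lambda>x. norm (u x) * ((Bf' + 2 * C) * Bh))"
      using int by (intro integrable_mult_left integrable_norm)
    show "(\<lambda>x. u x * tensor f' h x) \<in> borel_measurable M"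
      "(\<lambda>x. u x * tensor (F' n) (H n) x) \<in> borel_measurable M" for n
      using u by (auto simp: L2_def intro!: borel_measurable_times meas cont cont' cont_F)
    show "AE x in M. (\<lambda>n. u x * tensor (F' n) (H n) x) \<longlonglongrightarrow> u x * tensor f' h x"
      unfolding tensor_def
      by (intro AE_I2 tendsto_mult tendsto_const lim) (auto simp: space_M mem_cell)
    show "AE x in M. norm (u x * tensor (F' n) (H n) x) \<le> norm (u x) * ((Bf' + 2 * C) * Bh)" for n
      unfolding tensor_def real_norm_def abs_mult using Bf' \<open>0 \<le> C\<close>
      by (intro AE_I2 mult_left_mono mult_mono bound_H bound_F') (auto simp: space_M mem_cell)
  qed
  moreover have "(\<lambda>n. L2_inner M (\<lambda>x. G x \<bullet> v) (tensor (F n) (H n))) \<longlonglongrightarrow> L2_inner M (\<lambda>x. G x \<bullet> v) (tensor f h)"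
    unfolding L2_inner_def inner_real_def
  proof (rule integral_dominated_convergence)
    show "integrable M (\<lambda>x. norm (G x \<bullet> v) * (Bf * Bh))"
      using int by (intro integrable_mult_left integrable_norm)
    show "(\<lambda>x. (G x \<bullet> v) * tensor f h x) \<in> borel_measurable M"
      "(\<lambda>x. (G x \<bullet> v) * tensor (F n) (H n) x) \<in> borel_measurable M" for n
      using Gv by (auto simp: L2_def intro!: borel_measurable_times meas cont cont_F)
    show "AE x in M. (\<lambda>n. (G x \<bullet> v) * tensor (F n) (H n) x) \<longlonglongrightarrow> (G x \<bullet> v) * tensor f h x"
      unfolding tensor_def
      by (intro AE_I2 tendsto_mult tendsto_const lim) (auto simp: space_M mem_cell)
    show "AE x in M. norm ((G x \<bullet> v) * tensor (F n) (H n) x) \<le> norm (G x \<bullet> v) * (Bf * Bh)" for n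
      unfolding tensor_def real_norm_def abs_mult using Bf
      by (intro AE_I2 mult_left_mono mult_mono bound_H bound_F) (auto simp: space_M mem_cell)
  qed
  ultimately show ?thesis
    unfolding eq using LIMSEQ_unique tendsto_minus by blast
qed

end

section \<open>Cosine modes\<close>

context plane_coordinates
begin

text \<open>Exchanging the two sides leaves the region unchanged and swaps the factors of a product;
  with the next lemmas this carries results on \<open>fst\<close> over to
  \<open>snd\<close>.\<close>

lemma flip_cell: "plane_coordinates.cell p w' v' = cell"
  by (auto simp: plane_coordinates.cell_def[OF swap] cell_def plane_coordinates.c1_def[OF swap] plane_coordinates.c2_def[OF swap] c1_def c2_def)

lemma flip_tensor: "plane_coordinates.tensor p w' v' f h = tensor h f"
  by (simp add: plane_coordinates.tensor_def[OF swap, abs_def] tensor_def[abs_def] plane_coordinates.c1_def[OF swap]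
      plane_coordinates.c2_def[OF swap] c1_def c2_def mult.commute)

definition cosine :: "nat \<times> nat \<Rightarrow> 'a \<Rightarrow> real"
  where "cosine i = tensor (\<lambda>r. cos (real (fst i) * pi * r)) (\<lambda>r. cos (real (snd i) * pi * r))"

text \<open>Up to a factor, the derivative of the cosine mode along \<open>v\<close>. It vanishes on
  the sides \<open>c1 x = 0\<close> and \<open>c1 x = 1\<close>, but in general not on the other
  two.\<close>

definition sine1 :: "nat \<times> nat \<Rightarrow> 'a \<Rightarrow> real"
  where "sine1 i = tensor (\<lambda>r. sin (real (fst i) * pi * r)) (\<lambda>r. cos (real (snd i) * pi * r))"

definition sine2 :: "nat \<times> nat \<Rightarrow> 'a \<Rightarrow> real"
  where "sine2 i = tensor (\<lambda>r. cos (real (fst i) * pi * r)) (\<lambda>r. sin (real (snd i) * pi * r))"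

lemma flip_cosine: "plane_coordinates.cosine p w' v' (prod.swap i) = cosine i"
  by (simp add: plane_coordinates.cosine_def[OF swap] cosine_def flip_tensor)

lemma flip_sine1: "plane_coordinates.sine1 p w' v' (prod.swap i) = sine2 i"
  by (simp add: plane_coordinates.sine1_def[OF swap] sine2_def flip_tensor)

lemma L2_cosine: "L2 M (cosine i)" and L2_sine1: "L2 M (sine1 i)" and L2_sine2: "L2 M (sine2 i)"
  unfolding cosine_def sine1_def sine2_def
  by (intro L2_M_continuous continuous_on_tensor continuous_intros)+

lemma sobolev_cosine:
  "sobolev_H1 cell (cosine i)
    (\<lambda>x. (- (real (fst i) * pi) * sine1 i x) *\<^sub>R v' + (- (real (snd i) * pi) * sine2 i x) *\<^sub>R w')"
proof -
  have "sobolev_H1 cell (cosine i)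
    (\<lambda>x. tensor (\<lambda>r. - (real (fst i) * pi) * sin (real (fst i) * pi * r)) (\<lambda>r. cos (real (snd i) * pi * r)) x *\<^sub>R v' +
      tensor (\<lambda>r. cos (real (fst i) * pi * r)) (\<lambda>r. - (real (snd i) * pi) * sin (real (snd i) * pi * r)) x *\<^sub>R w')"
    unfolding cosine_def
    by (rule sobolev_tensor) (auto intro!: derivative_eq_intros continuous_intros)
  then show ?thesis
    by (simp add: sine1_def sine2_def tensor_def mult.assoc mult.left_commute)
qed

lemma cosine_coefficient1:
  assumes "sobolev_H1 cell u G"
  shows "real (fst i) * pi * L2_inner M u (cosine i) = - L2_inner M (\<lambda>x. G x \<bullet> v) (sine1 i)"
proof -
  define f where "f = (\<lambda>r. sin (real (fst i) * pi * r))"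
  define h where "h = (\<lambda>r. cos (real (snd i) * pi * r))"
  define f' where "f' = (\<lambda>r. real (fst i) * pi * cos (real (fst i) * pi * r))"
  define h' where "h' = (\<lambda>r. - (real (snd i) * pi) * sin (real (snd i) * pi * r))"
  have "L2_inner M u (tensor f' h) = - L2_inner M (\<lambda>x. G x \<bullet> v) (tensor f h)"
  proof (rule sobolev_integration_by_parts[OF assms])
    show "DERIV f r :> f' r" "DERIV h r :> h' r" for r
      unfolding f_def f'_def h_def h'_def by (auto intro!: derivative_eq_intros)
    show "continuous_on UNIV f'" "continuous_on UNIV h'"
      unfolding f'_def h'_def by (intro continuous_intros)+
    show "\<bar>f r\<bar> \<le> (2 * real (fst i) * pi) * (r * (1 - r))" if "0 \<le> r" "r \<le> 1" for r
      unfolding f_def by (rule abs_sin_pi_bound[OF that])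
  qed
  moreover have "tensor f' h = (\<lambda>x. (real (fst i) * pi) *\<^sub>R cosine i x)"
    by (auto simp: tensor_def f'_def h_def cosine_def)
  ultimately show ?thesis
    by (simp add: L2_inner_scaleR_right sine1_def f_def h_def del: real_scaleR_def)
qed

lemma cosine_coefficient2:
  assumes "sobolev_H1 cell u G"
  shows "real (snd i) * pi * L2_inner M u (cosine i) = - L2_inner M (\<lambda>x. G x \<bullet> w) (sine2 i)"
  using plane_coordinates.cosine_coefficient1[OF swap, where p = p and u = u and G = G and i = "prod.swap i"] assms
  by (simp add: flip_cell flip_cosine flip_sine1 del: swap_simp)

lemma inner_cosine_sine1:
  "real (fst i) * L2_inner M (cosine j) (cosine i) = real (fst j) * L2_inner M (sine1 j) (sine1 i)"
proof -
  have "(\<lambda>x. ((- (real (fst j) * pi) * sine1 j x) *\<^sub>R v' + (- (real (snd j) * pi) * sine2 j x) *\<^sub>R w') \<bullet> v)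
      = (\<lambda>x. (- (real (fst j) * pi)) * sine1 j x)"
    using dual by (simp add: inner_add_left inner_commute[of v' v] inner_commute[of w' v] inner_diff_left)
  then have "real (fst i) * pi * L2_inner M (cosine j) (cosine i)
      = - L2_inner M (\<lambda>x. (- (real (fst j) * pi)) * sine1 j x) (sine1 i)"
    using cosine_coefficient1[OF sobolev_cosine[of j], of i] by (simp only:)
  then have "pi * (real (fst i) * L2_inner M (cosine j) (cosine i)) = pi * (real (fst j) * L2_inner M (sine1 j) (sine1 i))"
    unfolding L2_inner_mult_left by (simp add: mult_ac)
  then show ?thesis by simp
qed

text \<open>The usual argument for distinct eigenvalues: \<open>inner_cosine_sine1\<close> used in
  both orders shows that the inner product has the same multiple by \<open>(fst i)^2\<close> and by
  \<open>(fst j)^2\<close>.\<close>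

lemma cosine_orthogonal_fst:
  assumes "fst i \<noteq> fst j"
  shows "L2_inner M (cosine i) (cosine j) = 0"
proof -
  have "(real (fst i))\<^sup>2 * L2_inner M (cosine i) (cosine j) = (real (fst j))\<^sup>2 * L2_inner M (cosine i) (cosine j)"
    using inner_cosine_sine1[of i j] inner_cosine_sine1[of j i]
    unfolding power2_eq_square L2_inner_commute[of M "cosine j" "cosine i"] L2_inner_commute[of M "sine1 j" "sine1 i"]
    by (metis mult.assoc mult.left_commute)
  moreover have "(real (fst i))\<^sup>2 \<noteq> (real (fst j))\<^sup>2"
    using assms by simp
  ultimately show ?thesis by simp
qed

lemma cosine_orthogonal:
  assumes "i \<noteq> j"
  shows "L2_inner M (cosine i) (cosine j) = 0"
proof (cases "fst i = fst j")
  case False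
  then show ?thesis by (rule cosine_orthogonal_fst)
next
  case True
  then show ?thesis
    using plane_coordinates.cosine_orthogonal_fst[OF swap, where p = p and i = "prod.swap i" and j = "prod.swap j"] assms
    by (simp add: flip_cell flip_cosine prod_eq_iff del: swap_simp)
qed

lemma inner_sine1:
  assumes "0 < fst i" "0 < fst j"
  shows "L2_inner M (sine1 i) (sine1 j) = (if i = j then L2_inner M (cosine i) (cosine i) else 0)"
  using inner_cosine_sine1[of j i] cosine_orthogonal[of i j] assms by auto

text \<open>From \<open>sin^2 + cos^2 = 1\<close> and the equal norms of the sine and cosine modes.
  It reduces the nonvanishing of all norms to the positive area of the cell.\<close>

lemma cosine_norm_fst:
  assumes "0 < fst i"
  shows "L2_inner M (cosine (0, snd i)) (cosine (0, snd i)) = 2 * L2_inner M (cosine i) (cosine i)"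
proof -
  have "cosine (0, snd i) x * cosine (0, snd i) x = cosine i x * cosine i x + sine1 i x * sine1 i x" for x
  proof -
    have "cosine i x * cosine i x + sine1 i x * sine1 i x =
      ((cos (real (fst i) * pi * c1 x))\<^sup>2 + (sin (real (fst i) * pi * c1 x))\<^sup>2) * (cos (real (snd i) * pi * c2 x))\<^sup>2"
      unfolding cosine_def sine1_def tensor_def by algebra
    then show ?thesis
      by (simp add: cosine_def tensor_def power2_eq_square)
  qed
  then have "L2_inner M (cosine (0, snd i)) (cosine (0, snd i)) =
      L2_inner M (cosine i) (cosine i) + L2_inner M (sine1 i) (sine1 i)"
    using integrable_inner[OF L2_cosine[of i] L2_cosine[of i]] integrable_inner[OF L2_sine1[of i] L2_sine1[of i]]
    by (simp add: L2_inner_def)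
  then show ?thesis
    using inner_sine1[of i i] assms by simp
qed

lemma measure_cell_pos: "0 < measure lborel cell"
proof -
  have "p + (1/2) *\<^sub>R v + (1/2) *\<^sub>R w \<in> cell"
    by (simp add: cell_def)
  then have "\<not> negligible cell"
    using open_not_negligible open_cell by blast
  then have "emeasure lborel cell \<noteq> 0"
    unfolding negligible_iff_null_sets using null_sets_completionI[of cell lborel]
    by (auto simp: null_sets_def)
  moreover have "emeasure lborel cell \<noteq> \<infinity>"
    using emeasure_bounded_finite[OF bounded_cell] by simp
  ultimately show ?thesis
    by (simp add: measure_def enn2real_positive_iff less_top zero_less_iff_neq_zero)
qed

lemma cosine_norm_nonzero: "L2_inner M (cosine i) (cosine i) \<noteq> 0"
proof -
  have "L2_inner M (cosine (0, 0)) (cosine (0, 0)) = measure lborel cell"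
    by (simp add: L2_inner_def cosine_def tensor_def measure_restrict_space space_M)
  then have "L2_inner M (cosine (0, 0)) (cosine (0, 0)) \<noteq> 0"
    using measure_cell_pos by simp
  then have 1: "L2_inner M (cosine (0, snd i)) (cosine (0, snd i)) \<noteq> 0"
    using plane_coordinates.cosine_norm_fst[OF swap, where p = p and i = "prod.swap (0, snd i)"] flip_cosine[of "(0, 0)"] flip_cosine[of "(0, snd i)"]
    by (cases "snd i = 0") (auto simp: flip_cell)
  then show ?thesis
    using cosine_norm_fst[of i] by (cases "fst i = 0") (auto simp: prod_eq_iff, metis prod.collapse)
qed

sublocale cosine: L2_orthogonal M cosine UNIV
  by standard (use L2_cosine cosine_orthogonal cosine_norm_nonzero in auto)

text \<open>For \<open>fst i = 0\<close> the sine mode is the zero function, hence the restricted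
  index set.\<close>

sublocale sine1: L2_orthogonal M sine1 "{i. 0 < fst i}"
  by standard (use L2_sine1 inner_sine1 cosine_norm_nonzero in auto)

text \<open>Bessel's inequality for \<open>G x \<bullet> v\<close> in the sine system. Sine and
  cosine modes have equal norms, so each sine energy is exactly the cosine energy of
  \<open>u\<close> times the squared frequency.\<close>

lemma sum_energy1:
  assumes H1: "sobolev_H1 cell u G" and F: "finite F"
  shows "(\<Sum>i\<in>F. (real (fst i) * pi)\<^sup>2 * cosine.energy u i) \<le> L2_inner M (\<lambda>x. G x \<bullet> v) (\<lambda>x. G x \<bullet> v)"
proof -
  have "(\<Sum>i\<in>F. (real (fst i) * pi)\<^sup>2 * cosine.energy u i) =
      (\<Sum>i\<in>F \<inter> {i. 0 < fst i}. (real (fst i) * pi)\<^sup>2 * cosine.energy u i)"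
    by (rule sum.mono_neutral_right) (use F in auto)
  also have "\<dots> = (\<Sum>i\<in>F \<inter> {i. 0 < fst i}. sine1.energy (\<lambda>x. G x \<bullet> v) i)"
  proof (rule sum.cong[OF refl])
    fix i assume "i \<in> F \<inter> {i. 0 < fst i}"
    have "(L2_inner M (\<lambda>x. G x \<bullet> v) (sine1 i))\<^sup>2 = (real (fst i) * pi * L2_inner M u (cosine i))\<^sup>2"
      using cosine_coefficient1[OF H1, of i] by (simp add: power2_eq_square)
    then show "(real (fst i) * pi)\<^sup>2 * cosine.energy u i = sine1.energy (\<lambda>x. G x \<bullet> v) i"
      using inner_sine1[of i i] \<open>i \<in> _\<close>
      by (simp add: mode_energy_def power_mult_distrib)
  qed
  also have "\<dots> \<le> L2_inner M (\<lambda>x. G x \<bullet> v) (\<lambda>x. G x \<bullet> v)"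
    using F H1 by (intro sine1.Bessel) (auto simp: sobolev_iff L2_component)
  finally show ?thesis .
qed

lemma sum_energy2:
  assumes H1: "sobolev_H1 cell u G" and F: "finite F"
  shows "(\<Sum>i\<in>F. (real (snd i) * pi)\<^sup>2 * cosine.energy u i) \<le> L2_inner M (\<lambda>x. G x \<bullet> w) (\<lambda>x. G x \<bullet> w)"
proof -
  have "(\<Sum>i\<in>F. (real (snd i) * pi)\<^sup>2 * cosine.energy u i) =
    (\<Sum>i\<in>prod.swap ` F. (real (fst i) * pi)\<^sup>2 * mode_energy M u (plane_coordinates.cosine p w' v' i))"
    using F by (subst sum.reindex) (auto simp: flip_cosine simp del: swap_simp)
  also have "\<dots> \<le> L2_inner M (\<lambda>x. G x \<bullet> w) (\<lambda>x. G x \<bullet> w)"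
    using plane_coordinates.sum_energy1[OF swap, where p = p and u = u and G = G and F = "prod.swap ` F"] H1 F by (simp add: flip_cell)
  finally show ?thesis .
qed

end

section \<open>Completeness of the cosine modes\<close>

text \<open>The integral vanishes on closed sets by approximating their indicators with
  \<open>max 0 (1 - j * infdist x C)\<close>, hence on all Borel sets.\<close>

lemma AE_zero_if_orthogonal_continuous:
  fixes F :: "'a::euclidean_space \<Rightarrow> real"
  assumes F: "integrable lborel F"
    and orth: "\<And>k. continuous_on UNIV k \<Longrightarrow> (\<And>x. \<bar>k x\<bar> \<le> 1) \<Longrightarrow> (LINT x|lborel. F x * k x) = 0"
  shows "AE x in lborel. F x = 0"
proof (rule sigma_finite_measure.density_zero[OF lborel.sigma_finite_measure_axioms F])
  have [measurable]: "F \<in> borel_measurable borel"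
    using F by simp
  have set_int: "set_integrable lborel A F" if "A \<in> sets borel" for A
    using F that unfolding set_integrable_def by (intro integrable_mult_indicator) auto
  have closed: "set_lebesgue_integral lborel C F = 0" if "closed C" for C
  proof (cases "C = {}")
    case False
    define k where "k j x = max 0 (1 - real j * infdist x C)" for j x
    have cont: "continuous_on UNIV (k j)" for j
      unfolding k_def by (intro continuous_intros)
    have bound: "\<bar>k j x\<bar> \<le> 1" for j x
      by (simp add: k_def infdist_nonneg)
    have lim: "(\<lambda>j. k j x) \<longlonglongrightarrow> indicator C x" for x
    proof (cases "x \<in> C")
      case True
      then show ?thesis by (simp add: k_def)
    next
      case out: False
      then have pos: "0 < infdist x C"
        using infdist_pos_not_in_closed[OF \<open>closed C\<close> False] by simp
      obtain N where N: "1 / infdist x C \<le> real N"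
        using real_arch_simple by blast
      have "k j x = 0" if "j \<ge> N" for j
      proof -
        have "1 / infdist x C \<le> real j"
          using N that by linarith
        then show ?thesis
          using pos by (simp add: k_def field_simps)
      qed
      then have "(\<lambda>j. k j x) \<longlonglongrightarrow> 0"
        by (intro tendsto_eventually) (auto simp: eventually_sequentially)
      with out show ?thesis by simp
    qed
    have [measurable]: "k j \<in> borel_measurable borel" for j
      using cont by (rule borel_measurable_continuous_onI)
    have [measurable]: "C \<in> sets borel"
      using \<open>closed C\<close> by (rule borel_closed)
    have "(\<lambda>j. LINT x|lborel. F x * k j x) \<longlonglongrightarrow> (LINT x|lborel. F x * indicator C x)"
    proof (rule integral_dominated_convergence)
      show "integrable lborel (\<lambda>x. norm (F x))"
        using F by simp
      show "AE x in lborel. (\<lambda>j. F x * k j x) \<longlonglongrightarrow> F x * indicator C x"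
        by (intro AE_I2 tendsto_mult tendsto_const lim)
      show "AE x in lborel. norm (F x * k j x) \<le> norm (F x)" for j
        using bound by (intro AE_I2) (simp add: abs_mult mult_left_le)
    qed measurable
    then show ?thesis
      using orth[OF cont bound] by (simp add: LIMSEQ_const_iff set_lebesgue_integral_def mult.commute)
  qed (simp add: set_lebesgue_integral_def)
  fix A assume "A \<in> sets (lborel :: 'a measure)"
  then have mem: "A \<in> sigma_sets UNIV (Collect closed)"
    by (simp add: borel_eq_closed)
  have "Int_stable (Collect closed :: 'a set set)" "Collect closed \<subseteq> Pow (UNIV :: 'a set)"
    by (auto simp: Int_stable_def)
  from this mem show "set_lebesgue_integral lborel A F = 0"
  proof (induction rule: sigma_sets_induct_disjoint)
    case (basic A)
    then show ?case using closed by simp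
  next
    case empty
    show ?case by (simp add: set_lebesgue_integral_def)
  next
    case (compl A)
    then have A: "A \<in> sets borel"
      by (simp add: borel_eq_closed)
    have "set_lebesgue_integral lborel (A \<union> (UNIV - A)) F =
        set_lebesgue_integral lborel A F + set_lebesgue_integral lborel (UNIV - A) F"
      using A by (intro set_integral_Un set_int) auto
    moreover have "A \<union> (UNIV - A) = UNIV" by auto
    ultimately show ?case
      using compl closed[of UNIV] by simp
  next
    case (union A)
    then have A: "A i \<in> sets borel" for i
      by (auto simp: borel_eq_closed)
    have "set_lebesgue_integral lborel (\<Union>i. A i) F = (\<Sum>i. set_lebesgue_integral lborel (A i) F)"
      using union(1) A
      by (intro lebesgue_integral_countable_add set_int) (auto simp: disjoint_family_on_def)
    then show ?case
      using union by simp
  qed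
qed

text \<open>Shows that multiplication by the lowest cosine stays in the span of the modes. For
  \<open>m = 0\<close> the lower frequency is 1 because the cosine is even, whereas subtraction on
  naturals would give 0.\<close>

lemma cos_pi_mult_cos:
  "cos (pi * r) * cos (real m * pi * r) =
    (cos (real (m + 1) * pi * r) + cos (real (if m = 0 then 1 else m - 1) * pi * r)) / 2"
proof (cases m)
  case 0
  then show ?thesis by (simp add: mult.commute)
next
  case (Suc k)
  have "cos (real m * pi * r) * cos (pi * r) = (cos (real m * pi * r - pi * r) + cos (real m * pi * r + pi * r)) / 2"
    by (rule cos_times_cos)
  moreover have "real m * pi * r - pi * r = real (if m = 0 then 1 else m - 1) * pi * r"
    "real m * pi * r + pi * r = real (m + 1) * pi * r"
    using Suc by (simp_all add: algebra_simps)
  ultimately show ?thesis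
    by (simp only: mult.commute add.commute)
qed

context plane_coordinates
begin

lemma L2_continuous_on_closed_cell:
  fixes k :: "'a \<Rightarrow> real"
  assumes "continuous_on closed_cell k"
  shows "L2 M k"
proof -
  have "compact (k ` closed_cell)"
    using assms compact_closed_cell by (rule compact_continuous_image)
  then obtain B where "\<forall>y\<in>k ` closed_cell. norm y \<le> B"
    using compact_imp_bounded bounded_pos by metis
  moreover have "k \<in> borel_measurable (restrict_space borel cell)"
    using continuous_on_subset[OF assms cell_subset] by (rule borel_measurable_continuous_on_restrict)
  then have "k \<in> borel_measurable M"
    by (simp cong: measurable_cong_sets add: sets_restrict_space)
  ultimately show ?thesis
    using cell_subset by (intro L2_bounded[OF finite_measure_M, of _ B]) (auto simp: space_M)
qed

lemma cosine_0 [simp]: "cosine (0, 0) = (\<lambda>_. 1)"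
  by (simp add: cosine_def tensor_def[abs_def])

lemma continuous_on_cosine: "continuous_on S (cosine i)"
  unfolding cosine_def by (intro continuous_on_tensor continuous_intros)

lemma cosine_times_c1:
  "cos (pi * c1 x) * cosine i x =
    (cosine (fst i + 1, snd i) x + cosine (if fst i = 0 then 1 else fst i - 1, snd i) x) / 2"
proof -
  have "a * (b * z) = (c * z + d * z) / 2" if "a * b = (c + d) / 2" for a b c d z :: real
    using that by algebra
  from this[OF cos_pi_mult_cos] show ?thesis
    unfolding cosine_def tensor_def fst_conv snd_conv .
qed

lemma cosine_times_c2:
  "cos (pi * c2 x) * cosine i x =
    (cosine (fst i, snd i + 1) x + cosine (fst i, if snd i = 0 then 1 else snd i - 1) x) / 2"
proof -
  have "a * (z * b) = (z * c + z * d) / 2" if "a * b = (c + d) / 2" for a b c d z :: real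
    using that by algebra
  from this[OF cos_pi_mult_cos] show ?thesis
    unfolding cosine_def tensor_def fst_conv snd_conv .
qed

text \<open>The functions \<open>g\<close> that preserve the space of all \<open>h\<close> with \<open>f h\<close> orthogonal to every cosine
  form an algebra, to which the Stone-Weierstrass theorem applies.\<close>

lemma orthogonal_continuous_if_orthogonal_cosine:
  assumes f: "L2 M f" and orth: "\<And>i. L2_inner M f (cosine i) = 0"
    and k: "continuous_on closed_cell k"
  shows "L2_inner M f k = 0"
proof -
  define B where "B h \<longleftrightarrow> continuous_on closed_cell h \<and> (\<forall>i. L2_inner M f (\<lambda>x. h x * cosine i x) = 0)" for h
  define A where "A g \<longleftrightarrow> continuous_on closed_cell g \<and> (\<forall>h. B h \<longrightarrow> B (\<lambda>x. g x * h x))" for g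
  have L2: "L2 M (\<lambda>x. h x * cosine i x)" if "continuous_on closed_cell h" for h i
    using that by (intro L2_continuous_on_closed_cell continuous_intros continuous_on_cosine)
  have "A (\<lambda>x. c)" for c
  proof -
    have "L2_inner M f (\<lambda>x. c * h x * cosine i x) = 0" if "B h" for h i
      using that L2_inner_scaleR_right[of M f c "\<lambda>x. h x * cosine i x"] by (simp add: B_def mult.assoc del: split_paired_All)
    then show ?thesis
      by (auto simp: A_def B_def intro!: continuous_intros)
  qed
  moreover have "continuous_on closed_cell g" if "A g" for g
    using that by (simp add: A_def)
  moreover have "A (\<lambda>x. g x + g' x)" if "A g \<and> A g'" for g g'
  proof -
    have "L2_inner M f (\<lambda>x. (g x + g' x) * h x * cosine i x) = 0" if "B h" for h i
    proof -
      have "B (\<lambda>x. g x * h x)" "B (\<lambda>x. g' x * h x)"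
        using that \<open>A g \<and> A g'\<close> by (auto simp: A_def)
      then show ?thesis
        using L2_inner_add_right[OF L2[of "\<lambda>x. g x * h x" i] L2[of "\<lambda>x. g' x * h x" i] f]
        by (simp add: B_def distrib_right del: split_paired_All)
    qed
    then show ?thesis
      using that by (auto simp: A_def B_def intro!: continuous_intros)
  qed
  moreover have "A (\<lambda>x. g x * g' x)" if "A g \<and> A g'" for g g'
    using that by (auto simp: A_def mult.assoc intro!: continuous_intros)
  moreover have "\<exists>g. A g \<and> g x \<noteq> g y" if "x \<in> closed_cell \<and> y \<in> closed_cell \<and> x \<noteq> y" for x y
  proof -
    have half: "L2_inner M f (\<lambda>x. q x * h x * cosine i x) = 0"
      if "B h" "\<And>x. q x * cosine i x = (cosine j x + cosine l x) / 2" for h q i j l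
    proof -
      have "(\<lambda>x. q x * h x * cosine i x) = (\<lambda>x. (1/2) *\<^sub>R (h x * cosine j x + h x * cosine l x))"
      proof
        fix x
        have "q x * h x * cosine i x = h x * (q x * cosine i x)" by simp
        also have "\<dots> = (1/2) *\<^sub>R (h x * cosine j x + h x * cosine l x)"
          unfolding that(2) by (simp add: algebra_simps)
        finally show "q x * h x * cosine i x = (1/2) *\<^sub>R (h x * cosine j x + h x * cosine l x)" .
      qed
      then show ?thesis
        using that(1) L2_inner_add_right[OF L2[of h j] L2[of h l] f]
        by (simp add: L2_inner_scaleR_right B_def del: real_scaleR_def split_paired_All)
    qed
    have A1: "A (\<lambda>x. cos (pi * c1 x))"
      using half[OF _ cosine_times_c1] by (auto simp: A_def B_def intro!: continuous_intros)
    have A2: "A (\<lambda>x. cos (pi * c2 x))"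
      using half[OF _ cosine_times_c2] by (auto simp: A_def B_def intro!: continuous_intros)
    \<comment> \<open>On the closed cell the coordinates lie in the unit interval, and the cosine is
      injective on \<open>[0, pi]\<close>. So the two lowest modes already separate points.\<close>
    have "c1 x \<noteq> c1 y \<or> c2 x \<noteq> c2 y"
      using that coordinates[of x] coordinates[of y] by metis
    then have "cos (pi * c1 x) \<noteq> cos (pi * c1 y) \<or> cos (pi * c2 x) \<noteq> cos (pi * c2 y)"
      using that cos_inj_pi[of "pi * c1 x" "pi * c1 y"] cos_inj_pi[of "pi * c2 x" "pi * c2 y"]
      by (auto simp: closed_cell_def)
    with A1 A2 show ?thesis
      by blast
  qed
  ultimately have approx: "\<exists>g. A g \<and> (\<forall>x\<in>closed_cell. \<bar>k x - g x\<bar> < e)" if "0 < e" for e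
    using Stone_Weierstrass_HOL[of closed_cell A k e] compact_closed_cell k that by blast
  have int: "integrable M (\<lambda>x. \<bar>f x\<bar>)"
    using L2_integrable[OF finite_measure_M f] by simp
  have le: "\<bar>L2_inner M f k\<bar> \<le> (LINT x|M. \<bar>f x\<bar>) * e" if "0 < e" for e
  proof -
    obtain g where g: "A g" "\<And>x. x \<in> closed_cell \<Longrightarrow> \<bar>k x - g x\<bar> < e"
      using approx[OF \<open>0 < e\<close>] by blast
    \<comment> \<open>The hypothesis on \<open>f\<close> says precisely that the constant 1
      satisfies \<open>B\<close>. Multiplying it by \<open>g\<close> and testing with the constant
      mode isolates \<open>g\<close>.\<close>
    have "B (\<lambda>_. 1)"
      using orth by (simp add: B_def)
    then have "B (\<lambda>x. g x * 1)"
      using g(1) unfolding A_def by blast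
    then have "L2_inner M f (\<lambda>x. g x * 1 * cosine (0, 0) x) = 0"
      unfolding B_def by blast
    then have zero: "L2_inner M f g = 0"
      by simp
    have L2kg: "L2 M k" "L2 M g"
      using k g(1) by (auto intro: L2_continuous_on_closed_cell simp: A_def)
    then have "L2_inner M f k = L2_inner M f (\<lambda>x. k x - g x)"
      using f zero by (simp add: L2_inner_diff_right)
    also have "\<bar>\<dots>\<bar> \<le> (LINT x|M. \<bar>f x\<bar> * e)"
    proof -
      have "norm (LINT x|M. f x \<bullet> (k x - g x)) \<le> (LINT x|M. \<bar>f x\<bar> * e)"
      proof (rule Bochner_Integration.integral_norm_bound_integral)
        show "integrable M (\<lambda>x. f x \<bullet> (k x - g x))"
          using f L2kg by (intro integrable_inner L2_diff)
        show "integrable M (\<lambda>x. \<bar>f x\<bar> * e)"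
          using int by simp
        show "norm (f x \<bullet> (k x - g x)) \<le> \<bar>f x\<bar> * e" if "x \<in> space M" for x
          using g(2)[of x] that cell_subset by (auto simp: space_M abs_mult intro!: mult_left_mono)
      qed
      then show ?thesis by (simp add: L2_inner_def)
    qed
    finally show ?thesis by simp
  qed
  show ?thesis
  proof (rule ccontr)
    assume "L2_inner M f k \<noteq> 0"
    define I where "I = (LINT x|M. \<bar>f x\<bar>)"
    have "0 \<le> I" by (simp add: I_def)
    \<comment> \<open>The tolerance makes \<open>I * e\<close> smaller than the left side;
      \<open>I + 1\<close> in place of \<open>I\<close> avoids division by zero.\<close>
    have "\<bar>L2_inner M f k\<bar> \<le> I * (\<bar>L2_inner M f k\<bar> / (2 * (I + 1)))"
      unfolding I_def
      by (rule le) (use \<open>0 \<le> I\<close> \<open>L2_inner M f k \<noteq> 0\<close> in \<open>simp add: I_def add_nonneg_pos\<close>)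
    then have "\<bar>L2_inner M f k\<bar> * (2 * (I + 1)) \<le> I * \<bar>L2_inner M f k\<bar>"
      using \<open>0 \<le> I\<close> by (simp add: field_simps)
    then have "\<bar>L2_inner M f k\<bar> * (I + 2) \<le> 0"
      by (simp add: algebra_simps)
    then show False
      using \<open>0 \<le> I\<close> \<open>L2_inner M f k \<noteq> 0\<close> by (simp add: mult_le_0_iff)
  qed
qed

lemma cosine_total:
  assumes f: "L2 M f" and orth: "\<And>i. L2_inner M f (cosine i) = 0"
  shows "AE x in M. f x = 0"
proof -
  define F where "F x = indicator cell x * f x" for x
  have "AE x in lborel. F x = 0"
  proof (rule AE_zero_if_orthogonal_continuous)
    show "integrable lborel F"
      using L2_integrable[OF finite_measure_M f] by (simp add: integrable_restrict_space F_def[abs_def])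
    show "(LINT x|lborel. F x * k x) = 0" if "continuous_on UNIV k" for k
      using orthogonal_continuous_if_orthogonal_cosine[OF f orth continuous_on_subset[OF that]]
      by (simp add: L2_inner_def integral_restrict_space F_def mult.assoc)
  qed
  then show ?thesis
    by (simp add: AE_restrict_space_iff F_def indicator_def)
qed

lemma cosine_Parseval:
  assumes "L2 M u"
  shows "(\<lambda>n. \<Sum>i\<in>{..n} \<times> {..n}. mode_energy M u (cosine i)) \<longlonglongrightarrow> L2_inner M u u"
proof (rule cosine.Parseval[OF assms])
  show "incseq (\<lambda>n::nat. {..n} \<times> {..n})"
    by (auto simp: incseq_def)
  show "(\<Union>n::nat. {..n} \<times> {..n}) = UNIV"
    by (auto, metis max.cobounded1 max.cobounded2)
qed (use cosine_total in auto)

lemma L2_inner_component_le: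
  assumes "L2 M G"
  shows "L2_inner M (\<lambda>x. G x \<bullet> d) (\<lambda>x. G x \<bullet> d) \<le> (norm d)\<^sup>2 * L2_inner M G G"
proof -
  have "(LINT x|M. (G x \<bullet> d) \<bullet> (G x \<bullet> d)) \<le> (LINT x|M. (norm d)\<^sup>2 * (G x \<bullet> G x))"
  proof (rule integral_mono)
    show "integrable M (\<lambda>x. (G x \<bullet> d) \<bullet> (G x \<bullet> d))" "integrable M (\<lambda>x. (norm d)\<^sup>2 * (G x \<bullet> G x))"
      by (intro integrable_inner L2_component integrable_mult_right assms)+
    show "(G x \<bullet> d) \<bullet> (G x \<bullet> d) \<le> (norm d)\<^sup>2 * (G x \<bullet> G x)" for x
      using Cauchy_Schwarz_ineq[of "G x" d] by (simp add: power2_norm_eq_inner mult.commute flip: power2_eq_square)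
  qed
  then show ?thesis by (simp add: L2_inner_def)
qed

text \<open>Outside the box \<open>{..N} \<times> {..N}\<close> some frequency exceeds
  \<open>N\<close>, so the weighted energy sums bound the tail by \<open>C / N^2\<close> times the
  Dirichlet energy. The set \<open>F\<close> depends on \<open>\<epsilon>\<close> alone and not on
  \<open>u\<close>; this uniformity is the source of compactness.\<close>

lemma high_frequency_estimate:
  assumes "0 < \<epsilon>"
  obtains F where "finite F" "\<And>u G. sobolev_H1 cell u G \<Longrightarrow>
    L2_inner M u u \<le> (\<Sum>i\<in>F. mode_energy M u (cosine i)) + \<epsilon> * L2_inner M G G"
proof -
  \<comment> \<open>By Cauchy-Schwarz, \<open>C\<close> times the Dirichlet energy bounds the sum of
    the squared norms of both side derivatives.\<close>
  define C where "C = (norm v)\<^sup>2 + (norm w)\<^sup>2"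
  obtain N0 where N0: "C / \<epsilon> \<le> real N0"
    using real_arch_simple by blast
  define N where "N = Suc N0"
  have N: "C \<le> \<epsilon> * (real N)\<^sup>2" "1 \<le> real N"
  proof -
    show 1: "1 \<le> real N" by (simp add: N_def)
    have "C \<le> \<epsilon> * real N"
      using N0 assms by (simp add: N_def field_simps)
    also have "\<dots> \<le> \<epsilon> * (real N)\<^sup>2"
      using 1 assms by (simp add: power2_eq_square)
    finally show "C \<le> \<epsilon> * (real N)\<^sup>2" .
  qed
  show ?thesis
  proof (rule that[of "{..N} \<times> {..N}"])
    fix u G assume H1: "sobolev_H1 cell u G"
    then have L2: "L2 M u" "L2 M G"
      by (auto simp: sobolev_iff)
    define E where "E i = mode_energy M u (cosine i)" for i
    have E: "0 \<le> E i" for i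
      by (simp add: E_def mode_energy_nonneg)
    have "(\<Sum>i\<in>{..n} \<times> {..n}. E i) \<le> (\<Sum>i\<in>{..N} \<times> {..N}. E i) + \<epsilon> * L2_inner M G G" for n
    proof -
      define T where "T = {..n} \<times> {..n} - {..N} \<times> {..N}"
      have [simp]: "finite T" by (simp add: T_def)
      have "(real N)\<^sup>2 * (\<Sum>i\<in>T. E i) \<le> (\<Sum>i\<in>T. (real (fst i) * pi)\<^sup>2 * E i + (real (snd i) * pi)\<^sup>2 * E i)"
        unfolding sum_distrib_left
      proof (rule sum_mono)
        fix i assume "i \<in> T"
        then have "real N \<le> real (fst i) \<or> real N \<le> real (snd i)"
          by (cases i) (auto simp: T_def)
        moreover have "a\<^sup>2 \<le> (b * pi)\<^sup>2" if "a \<le> b" "0 \<le> a" for a b :: real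
          using that pi_ge_two mult_mono[of a b 1 pi] by (intro power_mono) auto
        ultimately have "(real N)\<^sup>2 \<le> (real (fst i) * pi)\<^sup>2 \<or> (real N)\<^sup>2 \<le> (real (snd i) * pi)\<^sup>2"
          by auto
        then have "(real N)\<^sup>2 \<le> (real (fst i) * pi)\<^sup>2 + (real (snd i) * pi)\<^sup>2"
          using zero_le_power2[of "real (fst i) * pi"] zero_le_power2[of "real (snd i) * pi"] by linarith
        from mult_right_mono[OF this E[of i]]
        show "(real N)\<^sup>2 * E i \<le> (real (fst i) * pi)\<^sup>2 * E i + (real (snd i) * pi)\<^sup>2 * E i"
          by (simp add: distrib_right)
      qed
      also have "\<dots> \<le> L2_inner M (\<lambda>x. G x \<bullet> v) (\<lambda>x. G x \<bullet> v) + L2_inner M (\<lambda>x. G x \<bullet> w) (\<lambda>x. G x \<bullet> w)"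
        unfolding sum.distrib E_def by (intro add_mono sum_energy1 sum_energy2 H1) auto
      also have "\<dots> \<le> C * L2_inner M G G"
        unfolding C_def distrib_right by (intro add_mono L2_inner_component_le L2)
      also have "\<dots> \<le> (\<epsilon> * (real N)\<^sup>2) * L2_inner M G G"
        by (intro mult_right_mono N L2_inner_nonneg)
      finally have "(real N)\<^sup>2 * (\<Sum>i\<in>T. E i) \<le> (real N)\<^sup>2 * (\<epsilon> * L2_inner M G G)"
        by (simp add: mult_ac)
      then have "(\<Sum>i\<in>T. E i) \<le> \<epsilon> * L2_inner M G G"
        using N(2) by simp
      moreover have "(\<Sum>i\<in>{..n} \<times> {..n}. E i) \<le> (\<Sum>i\<in>{..N} \<times> {..N} \<union> T. E i)"
        using E by (intro sum_mono2) (auto simp: T_def)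
      moreover have "(\<Sum>i\<in>{..N} \<times> {..N} \<union> T. E i) = (\<Sum>i\<in>{..N} \<times> {..N}. E i) + (\<Sum>i\<in>T. E i)"
        by (intro sum.union_disjoint) (auto simp: T_def)
      ultimately show ?thesis by linarith
    qed
    then show "L2_inner M u u \<le> (\<Sum>i\<in>{..N} \<times> {..N}. mode_energy M u (cosine i)) + \<epsilon> * L2_inner M G G"
      using LIMSEQ_le_const2[OF cosine_Parseval[OF L2(1)]] unfolding E_def by blast
  qed simp
qed

end

section \<open>Existence of a second eigenfunction\<close>

lemma L2_inner_parallelogram:
  assumes "L2 M f" "L2 M g"
  shows "L2_inner M (\<lambda>x. f x - g x) (\<lambda>x. f x - g x) =
    2 * L2_inner M f f + 2 * L2_inner M g g - L2_inner M (\<lambda>x. f x + g x) (\<lambda>x. f x + g x)"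
  using L2_inner_self_add_scaleR[OF assms, of 1] L2_inner_self_add_scaleR[OF assms, of "-1"] by simp

context plane_coordinates
begin

lemmas sobolev_add_scaleR = sobolev_H1_add_scaleR[OF bounded_cell cell_borel]

lemma sobolev_diff:
  assumes "sobolev_H1 cell u G" "sobolev_H1 cell z Z"
  shows "sobolev_H1 cell (\<lambda>x. u x - z x) (\<lambda>x. G x - Z x)"
  using sobolev_add_scaleR[OF assms, of "-1"] by simp

lemma sobolev_add:
  assumes "sobolev_H1 cell u G" "sobolev_H1 cell z Z"
  shows "sobolev_H1 cell (\<lambda>x. u x + z x) (\<lambda>x. G x + Z x)"
  using sobolev_add_scaleR[OF assms, of 1] by simp

lemma sobolev_const: "sobolev_H1 cell (\<lambda>_. c) (\<lambda>_. 0)"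
  by (intro sobolev_H1_C1 bounded_cell cell_borel GDERIV_const continuous_intros)

lemma sobolev_scaleR:
  assumes "sobolev_H1 cell u G"
  shows "sobolev_H1 cell (\<lambda>x. c * u x) (\<lambda>x. c *\<^sub>R G x)"
  using sobolev_add_scaleR[OF sobolev_const[of 0] assms, of c] by simp

lemma sobolev_L2: "sobolev_H1 cell u G \<Longrightarrow> L2 M u" "sobolev_H1 cell u G \<Longrightarrow> L2 M G"
  by (auto simp: sobolev_iff)

text \<open>Finitely many cosine coefficients control the \<open>L\<^sup>2\<close> norm up to a small multiple of the Dirichlet
  energy, so it suffices to make each coefficient converge.\<close>

lemma Rellich:
  assumes H1: "\<And>n. sobolev_H1 cell (u n) (G n)"
    and u_le: "\<And>n. L2_inner M (u n) (u n) \<le> B" and G_le: "\<And>n. L2_inner M (G n) (G n) \<le> B"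
  obtains r u' where "strict_mono (r :: nat \<Rightarrow> nat)" "L2 M u'"
    "(\<lambda>n. L2_norm M (\<lambda>x. u (r n) x - u' x)) \<longlonglongrightarrow> 0"
proof -
  note L2 = sobolev_L2[OF H1]
  have "0 \<le> B"
    using u_le[of 0] L2_inner_nonneg[of M "u 0"] by linarith
  define c where "c n i = L2_inner M (u n) (cosine i) / L2_norm M (cosine i)" for n i
  have norm_pos: "0 < L2_norm M (cosine i)" for i
    using cosine_norm_nonzero[of i] L2_norm_nonneg[of M "cosine i"] L2_norm_power2[of M "cosine i"]
    by (cases "L2_norm M (cosine i) = 0") auto
  have energy: "mode_energy M (\<lambda>x. u m x - u n x) (cosine i) = (c m i - c n i)\<^sup>2" for m n i
    using L2 by (simp add: mode_energy_def c_def L2_inner_diff_left L2_cosine power_divide L2_norm_power2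
        flip: diff_divide_distrib)
  have c_bound: "norm (c n i) \<le> sqrt B" for n i
  proof -
    have "\<bar>L2_inner M (u n) (cosine i)\<bar> \<le> L2_norm M (u n) * L2_norm M (cosine i)"
      by (intro L2_Cauchy_Schwarz L2 L2_cosine)
    also have "\<dots> \<le> sqrt B * L2_norm M (cosine i)"
      using u_le[of n] norm_pos[of i] by (intro mult_right_mono) (auto simp: L2_norm_def[of M "u n"])
    finally show ?thesis
      using norm_pos[of i] by (simp add: c_def divide_le_eq abs_divide)
  qed
  \<comment> \<open>Diagonal extraction over the countable set of modes, each coefficient sequence
    being bounded by \<open>sqrt B\<close>.\<close>
  obtain r where r: "strict_mono (r :: nat \<Rightarrow> nat)" "\<And>i. i \<in> UNIV \<Longrightarrow> \<exists>l. (\<lambda>n. c (r n) i) \<longlonglongrightarrow> l"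
    using function_convergent_subsequence[of UNIV c "sqrt B"] c_bound by blast
  then obtain l where l: "\<And>i. (\<lambda>n. c (r n) i) \<longlonglongrightarrow> l i"
    by (metis UNIV_I)
  obtain u' where "L2 M u'" "(\<lambda>n. L2_norm M (\<lambda>x. u (r n) x - u' x)) \<longlonglongrightarrow> 0"
  proof (rule L2_complete[OF L2(1)[of "r _"]])
    fix e :: real assume "0 < e"
    \<comment> \<open>A difference of two gradients has energy at most \<open>4 * B\<close>, so the
      high modes contribute less than \<open>e\<^sup>2 / 2\<close>; the threshold
      \<open>e\<^sup>2 / 8\<close> below leaves the other half to the low modes.\<close>
    define \<delta> where "\<delta> = e\<^sup>2 / (8 * (B + 1))"
    have \<delta>: "0 < \<delta>" "\<delta> * (4 * B) < e\<^sup>2 / 2"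
      using \<open>0 < e\<close> \<open>0 \<le> B\<close> by (simp_all add: \<delta>_def field_simps)
    obtain F where F: "finite F" "\<And>u G. sobolev_H1 cell u G \<Longrightarrow>
        L2_inner M u u \<le> (\<Sum>i\<in>F. mode_energy M u (cosine i)) + \<delta> * L2_inner M G G"
      using high_frequency_estimate[OF \<delta>(1)] by blast
    have "(\<lambda>n. \<Sum>i\<in>F. (c (r n) i - l i)\<^sup>2) \<longlonglongrightarrow> (\<Sum>i\<in>F. (l i - l i)\<^sup>2)"
      by (intro tendsto_intros l)
    then have "\<forall>\<^sub>F n in sequentially. (\<Sum>i\<in>F. (c (r n) i - l i)\<^sup>2) < e\<^sup>2 / 8"
      using \<open>0 < e\<close> by (intro order_tendstoD(2)) auto
    then obtain N where N: "\<And>n. n \<ge> N \<Longrightarrow> (\<Sum>i\<in>F. (c (r n) i - l i)\<^sup>2) < e\<^sup>2 / 8"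
      by (auto simp: eventually_sequentially)
    have "L2_norm M (\<lambda>x. u (r m) x - u (r n) x) < e" if "m \<ge> N" "n \<ge> N" for m n
    proof -
      have "(\<Sum>i\<in>F. mode_energy M (\<lambda>x. u (r m) x - u (r n) x) (cosine i)) \<le>
          (\<Sum>i\<in>F. 2 * (c (r m) i - l i)\<^sup>2 + 2 * (c (r n) i - l i)\<^sup>2)"
        unfolding energy
      proof (rule sum_mono)
        fix i
        have "(a - b)\<^sup>2 \<le> 2 * (a - z)\<^sup>2 + 2 * (b - z)\<^sup>2" for a b z :: real
        proof -
          have "2 * (a - z)\<^sup>2 + 2 * (b - z)\<^sup>2 - (a - b)\<^sup>2 = (a + b - 2 * z)\<^sup>2"
            by (simp add: power2_eq_square algebra_simps)
          then show ?thesis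
            using zero_le_power2[of "a + b - 2 * z"] by linarith
        qed
        then show "(c (r m) i - c (r n) i)\<^sup>2 \<le> 2 * (c (r m) i - l i)\<^sup>2 + 2 * (c (r n) i - l i)\<^sup>2" .
      qed
      also have "\<dots> < e\<^sup>2 / 2"
        using N[OF that(1)] N[OF that(2)] by (simp add: sum.distrib flip: sum_distrib_left)
      finally have low: "(\<Sum>i\<in>F. mode_energy M (\<lambda>x. u (r m) x - u (r n) x) (cosine i)) < e\<^sup>2 / 2" .
      have "L2_inner M (\<lambda>x. G (r m) x - G (r n) x) (\<lambda>x. G (r m) x - G (r n) x) \<le> 4 * B"
        using L2_inner_parallelogram[OF L2(2)[of "r m"] L2(2)[of "r n"]] G_le[of "r m"] G_le[of "r n"]
          L2_inner_nonneg[of M "\<lambda>x. G (r m) x + G (r n) x"] by linarith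
      then have "\<delta> * L2_inner M (\<lambda>x. G (r m) x - G (r n) x) (\<lambda>x. G (r m) x - G (r n) x) \<le> \<delta> * (4 * B)"
        using \<delta>(1) by (intro mult_left_mono) auto
      then have "(L2_norm M (\<lambda>x. u (r m) x - u (r n) x))\<^sup>2 < e\<^sup>2"
        using F(2)[OF sobolev_diff[OF H1[of "r m"] H1[of "r n"]]] low \<delta>(2) unfolding L2_norm_power2 by linarith
      then show ?thesis
        using \<open>0 < e\<close> by (auto intro: power2_less_imp_less)
    qed
    then show "\<exists>N. \<forall>m\<ge>N. \<forall>n\<ge>N. L2_norm M (\<lambda>x. u (r m) x - u (r n) x) < e"
      by blast
  qed
  with r(1) that show ?thesis by blast
qed

abbreviation mean_zero :: "('a \<Rightarrow> real) \<Rightarrow> bool"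
  where "mean_zero u \<equiv> L2_inner M u (\<lambda>_. 1) = 0"

lemma L2_one: "L2 M (\<lambda>_. c)" for c :: real
  by (intro L2_M_continuous continuous_intros)

lemma norm_const: "L2_inner M (\<lambda>_. c) (\<lambda>_. d) = c * d * measure lborel cell"
  by (simp add: L2_inner_def measure_restrict_space space_M)

text \<open>\<open>Rellich\<close> makes the functions of a minimizing sequence converge. Midpoints
  cannot beat the infimum, so the parallelogram law makes the gradients Cauchy as well, and the
  energy passes to the limit. The conclusion is multiplied out so that it also covers functions of
  norm zero.\<close>

lemma Rayleigh_minimizer:
  obtains u G where "sobolev_H1 cell u G" "mean_zero u" "L2_inner M u u = 1"
    "\<And>z Z. sobolev_H1 cell z Z \<Longrightarrow> mean_zero z \<Longrightarrow> L2_inner M G G * L2_inner M z z \<le> L2_inner M Z Z"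
proof -
  define S where "S = {L2_inner M G G | u G. sobolev_H1 cell u G \<and> mean_zero u \<and> L2_inner M u u = 1}"
  define \<nu> where "\<nu> = Inf S"
  have bdd: "bdd_below S"
    by (rule bdd_belowI[of _ 0]) (auto simp: S_def L2_inner_nonneg)
  have normalize: "L2_inner M Z Z / L2_inner M z z \<in> S"
    if "sobolev_H1 cell z Z" "mean_zero z" "L2_inner M z z \<noteq> 0" for z Z
  proof -
    define c where "c = 1 / L2_norm M z"
    have c2: "c * c = 1 / L2_inner M z z"
      by (simp add: c_def flip: L2_norm_power2 power2_eq_square) (simp add: power_divide)
    have "sobolev_H1 cell (\<lambda>x. c * z x) (\<lambda>x. c *\<^sub>R Z x)"
      using that(1) by (rule sobolev_scaleR)
    moreover have "mean_zero (\<lambda>x. c * z x)"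
      using that(2) by (simp add: L2_inner_mult_left)
    moreover have "L2_inner M (\<lambda>x. c * z x) (\<lambda>x. c * z x) = c * c * L2_inner M z z"
      using L2_inner_scaleR_right[of M z c z] by (simp add: L2_inner_mult_left)
    moreover have "L2_inner M (\<lambda>x. c *\<^sub>R Z x) (\<lambda>x. c *\<^sub>R Z x) = c * c * L2_inner M Z Z"
      by (simp add: L2_inner_scaleR_left L2_inner_scaleR_right)
    ultimately show ?thesis
      using that(3) unfolding S_def c2 by (intro CollectI exI[of _ "\<lambda>x. c * z x"] exI[of _ "\<lambda>x. c *\<^sub>R Z x"]) simp
  qed
  have \<nu>_le: "\<nu> * L2_inner M z z \<le> L2_inner M Z Z" if "sobolev_H1 cell z Z" "mean_zero z" for z Z
  proof (cases "L2_inner M z z = 0")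
    case True
    then show ?thesis by (simp add: L2_inner_nonneg)
  next
    case False
    then have "\<nu> \<le> L2_inner M Z Z / L2_inner M z z"
      unfolding \<nu>_def using that by (intro cInf_lower normalize bdd)
    then show ?thesis
      using False L2_inner_nonneg[of M z] by (simp add: pos_le_divide_eq order_less_le)
  qed
  \<comment> \<open>Needed because \<open>Inf\<close> of the empty set of reals is unspecified; the
    first cosine mode is a competitor.\<close>
  have "S \<noteq> {}"
    using normalize[OF sobolev_cosine[of "(1, 0)"]] cosine_orthogonal[of "(1, 0)" "(0, 0)"] cosine_norm_nonzero
    by force
  have "0 \<le> \<nu>"
    unfolding \<nu>_def using \<open>S \<noteq> {}\<close> by (intro cInf_greatest) (auto simp: S_def L2_inner_nonneg)
  have "\<exists>u G. sobolev_H1 cell u G \<and> mean_zero u \<and> L2_inner M u u = 1 \<and>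
      L2_inner M G G < \<nu> + inverse (real (Suc n))" for n
  proof -
    have "Inf S < \<nu> + inverse (real (Suc n))"
      by (simp add: \<nu>_def)
    then obtain y where "y \<in> S" "y < \<nu> + inverse (real (Suc n))"
      using cInf_lessD[OF \<open>S \<noteq> {}\<close>] by blast
    then show ?thesis
      unfolding S_def by blast
  qed
  then obtain u G where uG: "\<And>n. sobolev_H1 cell (u n) (G n)" "\<And>n. mean_zero (u n)" "\<And>n. L2_inner M (u n) (u n) = 1"
    and G_less: "\<And>n. L2_inner M (G n) (G n) < \<nu> + inverse (real (Suc n))"
    by metis
  note L2 = sobolev_L2[OF uG(1)]
  have inv_le: "inverse (real (Suc n)) \<le> 1" for n
    by (simp add: inverse_le_1_iff)
  obtain r u' where r: "strict_mono (r :: nat \<Rightarrow> nat)" and u': "L2 M u'"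
    "(\<lambda>n. L2_norm M (\<lambda>x. u (r n) x - u' x)) \<longlonglongrightarrow> 0"
  proof (rule Rellich[OF uG(1)])
    show "L2_inner M (u n) (u n) \<le> \<nu> + 1" "L2_inner M (G n) (G n) \<le> \<nu> + 1" for n
      using uG(3)[of n] G_less[of n] inv_le[of n] \<open>0 \<le> \<nu>\<close> by linarith+
  qed
  define a where "a n = inverse (real (Suc (r n)))" for n
  have a: "a \<longlonglongrightarrow> 0"
    unfolding a_def using LIMSEQ_subseq_LIMSEQ[OF LIMSEQ_inverse_real_of_nat r] by (simp add: o_def)
  \<comment> \<open>The sum of two unit functions at distance \<open>d\<close> has squared norm
    \<open>4 - d^2\<close>, hence energy at least \<open>\<nu> * (4 - d^2)\<close>. Subtracting this
    in the parallelogram law cancels \<open>4 * \<nu>\<close>.\<close>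
  have G_dist: "L2_inner M (\<lambda>x. G (r m) x - G (r n) x) (\<lambda>x. G (r m) x - G (r n) x) \<le>
      2 * a m + 2 * a n + \<nu> * (L2_norm M (\<lambda>x. u (r m) x - u (r n) x))\<^sup>2" for m n
  proof -
    have "mean_zero (\<lambda>x. u (r m) x + u (r n) x)"
      using uG(2) L2 L2_one by (simp add: L2_inner_add_left)
    from \<nu>_le[OF sobolev_add[OF uG(1) uG(1)] this]
    have "\<nu> * (4 - (L2_norm M (\<lambda>x. u (r m) x - u (r n) x))\<^sup>2) \<le>
        L2_inner M (\<lambda>x. G (r m) x + G (r n) x) (\<lambda>x. G (r m) x + G (r n) x)"
      using L2_inner_parallelogram[OF L2(1)[of "r m"] L2(1)[of "r n"]] uG(3) by (simp add: L2_norm_power2)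
    then show ?thesis
      using L2_inner_parallelogram[OF L2(2)[of "r m"] L2(2)[of "r n"]] G_less[of "r m"] G_less[of "r n"]
      by (simp add: a_def algebra_simps)
  qed
  obtain G' where G': "L2 M G'" "(\<lambda>n. L2_norm M (\<lambda>x. G (r n) x - G' x)) \<longlonglongrightarrow> 0"
  proof (rule L2_complete[OF L2(2)[of "r _"]])
    fix e :: real assume "0 < e"
    define b where "b n = 2 * a n + \<nu> * (2 * (L2_norm M (\<lambda>x. u (r n) x - u' x))\<^sup>2)" for n
    have "b \<longlonglongrightarrow> 2 * 0 + \<nu> * (2 * 0\<^sup>2)"
      unfolding b_def by (intro tendsto_intros a u')
    then have "\<forall>\<^sub>F n in sequentially. b n < e\<^sup>2 / 2"
      using \<open>0 < e\<close> by (intro order_tendstoD(2)) auto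
    then obtain N where N: "\<And>n. n \<ge> N \<Longrightarrow> b n < e\<^sup>2 / 2"
      by (auto simp: eventually_sequentially)
    have "L2_norm M (\<lambda>x. G (r m) x - G (r n) x) < e" if "m \<ge> N" "n \<ge> N" for m n
    proof -
      let ?x = "L2_norm M (\<lambda>x. u (r m) x - u' x)" and ?y = "L2_norm M (\<lambda>x. u (r n) x - u' x)"
      have "L2_norm M (\<lambda>x. u (r m) x - u (r n) x) \<le> ?x + ?y"
        using L2_diff_triangle[OF L2(1)[of "r m"] u'(1) L2(1)[of "r n"]] L2_norm_minus_commute[of M u' "u (r n)"] by simp
      then have "(L2_norm M (\<lambda>x. u (r m) x - u (r n) x))\<^sup>2 \<le> (?x + ?y)\<^sup>2"
        by (intro power_mono L2_norm_nonneg)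
      also have "\<dots> \<le> 2 * ?x\<^sup>2 + 2 * ?y\<^sup>2"
        using sum_squares_bound[of ?x ?y] by (simp add: power2_sum)
      finally have "\<nu> * (L2_norm M (\<lambda>x. u (r m) x - u (r n) x))\<^sup>2 \<le> \<nu> * (2 * ?x\<^sup>2 + 2 * ?y\<^sup>2)"
        using \<open>0 \<le> \<nu>\<close> by (rule mult_left_mono)
      then have "(L2_norm M (\<lambda>x. G (r m) x - G (r n) x))\<^sup>2 < e\<^sup>2"
        using G_dist[of m n] N[OF that(1)] N[OF that(2)] unfolding b_def distrib_left L2_norm_power2 by linarith
      then show ?thesis
        using \<open>0 < e\<close> by (auto intro: power2_less_imp_less)
    qed
    then show "\<exists>N. \<forall>m\<ge>N. \<forall>n\<ge>N. L2_norm M (\<lambda>x. G (r m) x - G (r n) x) < e"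
      by blast
  qed
  have H1': "sobolev_H1 cell u' G'"
    by (rule sobolev_H1_closed[OF bounded_cell cell_borel uG(1)[of "r _"] u' G'])
  have "(\<lambda>n. L2_inner M (u (r n)) (\<lambda>_. 1)) \<longlonglongrightarrow> L2_inner M u' (\<lambda>_. 1)"
    by (intro L2_inner_tendsto L2 u' L2_one)
  then have mean: "mean_zero u'"
    using uG(2) by (simp add: LIMSEQ_const_iff)
  have "(\<lambda>n. L2_inner M (u (r n)) (u (r n))) \<longlonglongrightarrow> L2_inner M u' u'"
    by (intro L2_inner_self_tendsto L2 u')
  then have unit: "L2_inner M u' u' = 1"
    using uG(3) by (simp add: LIMSEQ_const_iff)
  have "(\<lambda>n. L2_inner M (G (r n)) (G (r n))) \<longlonglongrightarrow> L2_inner M G' G'"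
    by (intro L2_inner_self_tendsto L2 G')
  moreover have "(\<lambda>n. \<nu> + a n) \<longlonglongrightarrow> \<nu> + 0"
    by (intro tendsto_intros a)
  ultimately have "L2_inner M G' G' \<le> \<nu>"
    using G_less unfolding a_def by (auto intro: LIMSEQ_le less_imp_le)
  then have "L2_inner M G' G' * L2_inner M z z \<le> L2_inner M Z Z" if "sobolev_H1 cell z Z" "mean_zero z" for z Z
    using \<nu>_le[OF that] L2_inner_nonneg[of M z] by (meson mult_right_mono order_trans)
  with H1' mean unit that show ?thesis by blast
qed

section \<open>From the minimizer to an eigenfunction\<close>

lemma neumann_eigenfunction_iff:
  "neumann_eigenfunction cell \<mu> u \<longleftrightarrow> \<not> (AE x in M. u x = 0) \<and>
    (\<exists>G. sobolev_H1 cell u G \<and>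
      (\<forall>z Z. sobolev_H1 cell z Z \<longrightarrow> L2_inner M G Z = \<mu> * L2_inner M u z))"
  by (simp add: neumann_eigenfunction_def AE_restrict_space_iff set_integral_eq_lborel_on L2_inner_def)

lemma eigenfunction_const: "neumann_eigenfunction cell 0 (\<lambda>_. 1)"
proof -
  have "\<not> (AE x in M. (1 :: real) = 0)"
    using L2_norm_zero_iff[OF L2_one[of 1]] norm_const[of 1 1] measure_cell_pos L2_norm_power2[of M "\<lambda>_. 1 :: real"]
    by auto
  then show ?thesis
    unfolding neumann_eigenfunction_iff using sobolev_const[of 1]
    by (auto simp: L2_inner_def intro!: exI[of _ "\<lambda>_. 0"])
qed

text \<open>Euler-Lagrange equation of the minimizer, first for mean-zero variations. Subtracting
  the mean extends it to all of the Sobolev space: this changes neither the gradient of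
  \<open>z\<close> nor its inner product with the mean-zero \<open>u\<close>.\<close>

lemma second_eigenfunction:
  obtains \<nu> u where "neumann_eigenfunction cell \<nu> u" "0 \<le> \<nu>" "\<nu> \<le> (pi * norm v')\<^sup>2" "mean_zero u"
proof -
  obtain u G where uG: "sobolev_H1 cell u G" "mean_zero u" "L2_inner M u u = 1"
    and min: "\<And>z Z. sobolev_H1 cell z Z \<Longrightarrow> mean_zero z \<Longrightarrow> L2_inner M G G * L2_inner M z z \<le> L2_inner M Z Z"
    using Rayleigh_minimizer by blast
  define \<nu> where "\<nu> = L2_inner M G G"
  note L2 = sobolev_L2[OF uG(1)]
  have EL0: "L2_inner M G Z = \<nu> * L2_inner M u z" if z: "sobolev_H1 cell z Z" "mean_zero z" for z Z
  proof -
    note L2z = sobolev_L2[OF z(1)]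
    \<comment> \<open>The factor 0 is the constant term of the quadratic in \<open>t\<close>: the
      minimality inequality is an equality at \<open>t = 0\<close>.\<close>
    have "(L2_inner M G Z - \<nu> * L2_inner M u z)\<^sup>2 \<le> 0 * (L2_inner M Z Z - \<nu> * L2_inner M z z)"
    proof (rule nonneg_quadratic_discriminant)
      fix t
      have "mean_zero (\<lambda>x. u x + t *\<^sub>R z x)"
        using uG(2) z(2) L2 L2z L2_one L2_scaleR[OF L2z(1), of t]
        by (simp add: L2_inner_add_left L2_inner_mult_left)
      moreover have "sobolev_H1 cell (\<lambda>x. u x + t *\<^sub>R z x) (\<lambda>x. G x + t *\<^sub>R Z x)"
        using sobolev_add_scaleR[OF uG(1) z(1)] by simp
      ultimately have "\<nu> * (L2_inner M u u + 2 * t * L2_inner M u z + t\<^sup>2 * L2_inner M z z) \<le>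
          L2_inner M G G + 2 * t * L2_inner M G Z + t\<^sup>2 * L2_inner M Z Z"
        using min unfolding \<nu>_def L2_inner_self_add_scaleR[OF L2(1) L2z(1), symmetric]
          L2_inner_self_add_scaleR[OF L2(2) L2z(2), symmetric] by blast
      then show "0 \<le> 0 + 2 * t * (L2_inner M G Z - \<nu> * L2_inner M u z) + t\<^sup>2 * (L2_inner M Z Z - \<nu> * L2_inner M z z)"
        using uG(3) by (simp add: \<nu>_def[symmetric] algebra_simps)
    qed
    then show ?thesis by simp
  qed
  have EL: "L2_inner M G Z = \<nu> * L2_inner M u z" if z: "sobolev_H1 cell z Z" for z Z
  proof -
    define m where "m = L2_inner M z (\<lambda>_. 1) / measure lborel cell"
    have "L2_inner M (\<lambda>x. z x - m) (\<lambda>_. 1) = 0"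
      using sobolev_L2(1)[OF z] L2_one norm_const[of m 1] measure_cell_pos
      by (simp add: L2_inner_diff_left m_def)
    moreover have "sobolev_H1 cell (\<lambda>x. z x - m) Z"
      using sobolev_diff[OF z sobolev_const[of m]] by simp
    ultimately have "L2_inner M G Z = \<nu> * L2_inner M u (\<lambda>x. z x - m)"
      by (intro EL0)
    also have "L2_inner M u (\<lambda>x. z x - m) = L2_inner M u z - m * L2_inner M u (\<lambda>_. 1)"
      using sobolev_L2(1)[OF z] L2(1) L2_one L2_inner_scaleR_right[of M u m "\<lambda>_. 1"]
      by (simp add: L2_inner_diff_right)
    finally show ?thesis
      using uG(2) by simp
  qed
  show ?thesis
  proof (rule that[of \<nu> u])
    have "\<not> (AE x in M. u x = 0)"
      using L2_norm_zero_iff[OF L2(1)] L2_norm_power2[of M u] uG(3) by auto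
    then show "neumann_eigenfunction cell \<nu> u"
      unfolding neumann_eigenfunction_iff using uG(1) EL by blast
    show "0 \<le> \<nu>" by (simp add: \<nu>_def L2_inner_nonneg)
    show "mean_zero u" by (rule uG(2))
    \<comment> \<open>The trial function \<open>cos (pi * c1 x)\<close>. Its gradient is a sine
      times \<open>v'\<close>, and \<open>norm v'\<close> is the reciprocal of the distance between
      the sides on which \<open>c1\<close> is 0 and 1.\<close>
    let ?e = "cosine (1, 0)" and ?Z = "\<lambda>x. (- pi * sine1 (1, 0) x) *\<^sub>R v'"
    have "sobolev_H1 cell ?e ?Z"
      using sobolev_cosine[of "(1, 0)"] by simp
    moreover have "mean_zero ?e"
      using cosine_orthogonal[of "(1, 0)" "(0, 0)"] by simp
    ultimately have "\<nu> * L2_inner M ?e ?e \<le> L2_inner M ?Z ?Z"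
      unfolding \<nu>_def by (rule min)
    also have "L2_inner M ?Z ?Z = (pi * norm v')\<^sup>2 * L2_inner M (sine1 (1, 0)) (sine1 (1, 0))"
      unfolding L2_inner_def integral_mult_right_zero[symmetric]
      by (simp add: dot_square_norm power2_eq_square mult_ac)
    also have "L2_inner M (sine1 (1, 0)) (sine1 (1, 0)) = L2_inner M ?e ?e"
      using inner_sine1[of "(1, 0)" "(1, 0)"] by simp
    finally show "\<nu> \<le> (pi * norm v')\<^sup>2"
      using cosine_norm_nonzero[of "(1, 0)"] L2_inner_nonneg[of M ?e]
      by (simp add: order_less_le)
  qed
qed

end

section \<open>The second eigenvalue\<close>

context plane_coordinates
begin

abbreviation neumann_bounds :: "real set"
  where "neumann_bounds \<equiv> {t. \<exists>\<nu> u. (\<forall>i<2. neumann_eigenfunction cell (\<nu> i) (u i) \<and> \<nu> i \<le> t) \<and>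
    independent_AE_on cell 2 u}"

lemma eigenvalue_nonneg:
  assumes "neumann_eigenfunction cell \<mu> u"
  shows "0 \<le> \<mu>"
proof -
  obtain G where G: "sobolev_H1 cell u G" "L2_inner M G G = \<mu> * L2_inner M u u"
    and nz: "\<not> (AE x in M. u x = 0)"
    using assms unfolding neumann_eigenfunction_iff by blast
  have "L2_inner M u u \<noteq> 0"
    using nz L2_norm_zero_iff[OF sobolev_L2(1)[OF G(1)]] by (auto simp: L2_norm_def)
  then have "0 < L2_inner M u u"
    using L2_inner_nonneg[of M u] by linarith
  moreover have "0 \<le> \<mu> * L2_inner M u u"
    using L2_inner_nonneg[of M G] G(2) by simp
  ultimately show ?thesis
    by (simp add: zero_le_mult_iff)
qed

lemma independent_const_mean_zero:
  assumes "L2 M u" "mean_zero u" "\<not> (AE x in M. u x = 0)"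
  shows "independent_AE_on cell 2 (\<lambda>i. if i = 0 then (\<lambda>_. 1) else u)"
  unfolding independent_AE_on_def
proof (intro allI impI)
  fix c :: "nat \<Rightarrow> real" and i :: nat
  assume "AE x in lborel. x \<in> cell \<longrightarrow> (\<Sum>i<2. c i * (if i = 0 then (\<lambda>_. 1) else u) x) = 0" and i: "i < 2"
  then have AE: "AE x in M. c 0 + c 1 * u x = 0"
    by (simp add: AE_restrict_space_iff numeral_2_eq_2)
  have L2: "L2 M (\<lambda>x. c 0 + c 1 * u x)"
    using assms(1) L2_one by (intro L2_add L2_mult)
  have "L2_norm M (\<lambda>x. c 0 + c 1 * u x) = 0"
    using L2_norm_zero_iff[OF L2] AE by simp
  then have "L2_inner M (\<lambda>x. c 0 + c 1 * u x) (\<lambda>_. 1) = 0"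
    using L2_Cauchy_Schwarz[OF L2 L2_one[of 1]] by simp
  moreover have "L2_inner M (\<lambda>x. c 0 + c 1 * u x) (\<lambda>_. 1) = c 0 * measure lborel cell"
    using L2_inner_add_left[OF L2_one[of "c 0"] L2_mult[OF assms(1), of "c 1"] L2_one[of 1]] norm_const[of "c 0" 1] assms(2)
    by (simp add: L2_inner_mult_left)
  ultimately have c0: "c 0 = 0"
    using measure_cell_pos by simp
  have "c 1 = 0"
  proof (rule ccontr)
    assume "c 1 \<noteq> 0"
    then have "AE x in M. u x = 0"
      using AE c0 by simp
    with assms(3) show False by blast
  qed
  with c0 i show "c i = 0"
    by (cases i) (auto simp: less_Suc_eq numeral_2_eq_2)
qed

lemma bdd_below_neumann_bounds: "bdd_below neumann_bounds"
proof (rule bdd_belowI[of _ 0])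
  fix t assume "t \<in> neumann_bounds"
  then obtain \<nu> u where "\<forall>i<2::nat. neumann_eigenfunction cell (\<nu> i) (u i) \<and> \<nu> i \<le> t"
    by blast
  then have "neumann_eigenfunction cell (\<nu> 0) (u 0)" "\<nu> 0 \<le> t"
    by simp_all
  then show "0 \<le> t"
    using eigenvalue_nonneg order_trans by blast
qed

text \<open>Serves both estimates: as a member of the set for the upper bound, and for its
  nonemptiness in the lower bound on rectangles, where \<open>Inf\<close> would otherwise be
  meaningless.\<close>

lemma second_eigenvalue_in_neumann_bounds:
  obtains \<nu> where "\<nu> \<in> neumann_bounds" "\<nu> \<le> (pi * norm v')\<^sup>2"
proof -
  obtain \<nu> u where u: "neumann_eigenfunction cell \<nu> u" "0 \<le> \<nu>" "\<nu> \<le> (pi * norm v')\<^sup>2" "mean_zero u"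
    using second_eigenfunction by blast
  have "independent_AE_on cell 2 (\<lambda>i. if i = 0 then (\<lambda>_. 1) else u)"
    using u(1,4) sobolev_L2 by (intro independent_const_mean_zero) (auto simp: neumann_eigenfunction_iff)
  then have "\<nu> \<in> neumann_bounds"
    using u(1,2) eigenfunction_const
    by (intro CollectI exI[of _ "\<lambda>i. if i = 0 then 0 else \<nu>"] exI[of _ "\<lambda>i. if i = 0 then (\<lambda>_. 1) else u"]) auto
  with u(3) that show ?thesis by blast
qed

lemma neumann_mu_2_le: "neumann_mu 2 cell \<le> (pi * norm v')\<^sup>2"
proof -
  obtain \<nu> where "\<nu> \<in> neumann_bounds" "\<nu> \<le> (pi * norm v')\<^sup>2"
    by (rule second_eigenvalue_in_neumann_bounds)
  then show ?thesis
    unfolding neumann_mu_def using cInf_lower[OF _ bdd_below_neumann_bounds] order_trans by blast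
qed

text \<open>Makes \<open>G x \<bullet> v'\<close> a multiple of \<open>G x \<bullet> v\<close>,
  whose sine coefficients are known from integration by parts.\<close>

lemma rectangle_dual:
  assumes "v \<bullet> w = 0"
  shows "v' = (1 / (norm v)\<^sup>2) *\<^sub>R v"
proof -
  have "v \<noteq> 0"
    using dual(1) by auto
  have "x \<bullet> v' = x \<bullet> ((1 / (norm v)\<^sup>2) *\<^sub>R v)" for x
  proof -
    have "x \<bullet> v = ((x \<bullet> v') *\<^sub>R v + (x \<bullet> w') *\<^sub>R w) \<bullet> v"
      using spanning[of x] by simp
    also have "\<dots> = (x \<bullet> v') * (norm v)\<^sup>2"
      using assms by (simp add: inner_add_left inner_commute[of w v] dot_square_norm)
    finally show ?thesis
      using \<open>v \<noteq> 0\<close> by simp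
  qed
  then have "\<forall>x. x \<bullet> v' = x \<bullet> ((1 / (norm v)\<^sup>2) *\<^sub>R v)"
    by blast
  then show ?thesis
    by (simp only: vector_eq_ldot)
qed

text \<open>Testing the weak equation with a mode and inserting both coefficient identities gives
  \<open>(m^2 / |v|^2 + n^2 / |w|^2) * c = \<nu> * c\<close> for the Fourier coefficient
  \<open>c\<close> of \<open>u\<close>. Every nonconstant mode has a factor above
  \<open>\<nu>\<close>, so \<open>c\<close> vanishes and completeness leaves only the mean.\<close>

lemma rectangle_eigenfunction_const:
  assumes orth: "v \<bullet> w = 0" and u: "neumann_eigenfunction cell \<nu> u"
    and less: "\<nu> < (pi / max (norm v) (norm w))\<^sup>2"
  obtains c where "AE x in M. u x = c"
proof -
  obtain G where H1: "sobolev_H1 cell u G"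
    and weak: "\<And>z Z. sobolev_H1 cell z Z \<Longrightarrow> L2_inner M G Z = \<nu> * L2_inner M u z"
    using u unfolding neumann_eigenfunction_iff by blast
  note L2 = sobolev_L2[OF H1]
  have nz: "0 < norm v" "0 < norm w"
    using dual by auto
  define L where "L = max (norm v) (norm w)"
  have L: "norm v \<le> L" "norm w \<le> L"
    by (auto simp: L_def)
  with nz(1) have "0 < L"
    by linarith
  have v'_eq: "v' = (1 / (norm v)\<^sup>2) *\<^sub>R v"
    using orth by (rule rectangle_dual)
  have w'_eq: "w' = (1 / (norm w)\<^sup>2) *\<^sub>R w"
    using plane_coordinates.rectangle_dual[OF swap] orth by (simp add: inner_commute)
  have zero: "L2_inner M u (cosine i) = 0" if "i \<noteq> (0, 0)" for i
  proof -
    define m where "m = real (fst i) * pi"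
    define n where "n = real (snd i) * pi"
    let ?c = "L2_inner M u (cosine i)"
    have Gv: "L2_inner M (\<lambda>x. G x \<bullet> v) (sine1 i) = - (m * ?c)"
      and Gw: "L2_inner M (\<lambda>x. G x \<bullet> w) (sine2 i) = - (n * ?c)"
      using cosine_coefficient1[OF H1, of i] cosine_coefficient2[OF H1, of i] by (simp_all add: m_def n_def)
    have "L2_inner M G (\<lambda>x. (- m * sine1 i x) *\<^sub>R v' + (- n * sine2 i x) *\<^sub>R w') = \<nu> * ?c"
      unfolding m_def n_def by (rule weak[OF sobolev_cosine])
    moreover have "L2_inner M G (\<lambda>x. (- m * sine1 i x) *\<^sub>R v' + (- n * sine2 i x) *\<^sub>R w') =
      - (m / (norm v)\<^sup>2) * L2_inner M (\<lambda>x. G x \<bullet> v) (sine1 i)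
      + - (n / (norm w)\<^sup>2) * L2_inner M (\<lambda>x. G x \<bullet> w) (sine2 i)"
    proof -
      have "G x \<bullet> ((- m * sine1 i x) *\<^sub>R v' + (- n * sine2 i x) *\<^sub>R w') =
        - (m / (norm v)\<^sup>2) * ((G x \<bullet> v) \<bullet> sine1 i x) + - (n / (norm w)\<^sup>2) * ((G x \<bullet> w) \<bullet> sine2 i x)" for x
        unfolding v'_eq w'_eq by (simp add: inner_add_right inner_diff_right mult_ac)
      moreover have "integrable M (\<lambda>x. (G x \<bullet> v) \<bullet> sine1 i x)" "integrable M (\<lambda>x. (G x \<bullet> w) \<bullet> sine2 i x)"
        by (intro integrable_inner L2_component L2 L2_sine1 L2_sine2)+
      ultimately show ?thesis
        unfolding L2_inner_def by (simp only: Bochner_Integration.integral_add integrable_mult_right integral_mult_right_zero)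
    qed
    ultimately have "(m\<^sup>2 / (norm v)\<^sup>2 + n\<^sup>2 / (norm w)\<^sup>2) * ?c = \<nu> * ?c"
      unfolding Gv Gw by (simp add: power2_eq_square distrib_right)
    moreover have "(pi / L)\<^sup>2 \<le> m\<^sup>2 / (norm v)\<^sup>2 + n\<^sup>2 / (norm w)\<^sup>2"
    proof -
      have frac: "(pi / L)\<^sup>2 \<le> (real k * pi)\<^sup>2 / r\<^sup>2" if "0 < k" "0 < r" "r \<le> L" for k r
      proof -
        have "pi / L \<le> real k * pi / r"
          using that by (intro frac_le) auto
        then have "(pi / L)\<^sup>2 \<le> (real k * pi / r)\<^sup>2"
          using \<open>0 < L\<close> by (intro power_mono) auto
        then show ?thesis by (simp add: power_divide)
      qed
      have "0 < fst i \<or> 0 < snd i"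
        using \<open>i \<noteq> (0, 0)\<close> by (cases i) auto
      then have "(pi / L)\<^sup>2 \<le> m\<^sup>2 / (norm v)\<^sup>2 \<or> (pi / L)\<^sup>2 \<le> n\<^sup>2 / (norm w)\<^sup>2"
        unfolding m_def n_def using frac nz L by blast
      moreover have "0 \<le> m\<^sup>2 / (norm v)\<^sup>2" "0 \<le> n\<^sup>2 / (norm w)\<^sup>2"
        by simp_all
      ultimately show ?thesis by linarith
    qed
    ultimately show ?thesis
      using less by (auto simp: L_def[symmetric])
  qed
  define c where "c = L2_inner M u (\<lambda>_. 1) / measure lborel cell"
  have "AE x in M. u x - c = 0"
  proof (rule cosine_total)
    show "L2 M (\<lambda>x. u x - c)"
      by (intro L2_diff L2 L2_one)
    show "L2_inner M (\<lambda>x. u x - c) (cosine i) = 0" for i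
    proof (cases "i = (0, 0)")
      case True
      then show ?thesis
        using norm_const[of c 1] measure_cell_pos by (simp add: L2_inner_diff_left L2 L2_one c_def)
    next
      case False
      have "L2_inner M (\<lambda>_. c * 1) (cosine i) = 0"
        using cosine_orthogonal[of "(0, 0)" i] False unfolding L2_inner_mult_left by simp
      with zero[OF False] show ?thesis
        by (simp add: L2_inner_diff_left L2 L2_one L2_cosine)
    qed
  qed
  then have "AE x in M. u x = c" by simp
  with that show ?thesis .
qed

text \<open>A smaller bound would provide two independent eigenfunctions that are both constant
  almost everywhere.\<close>

lemma neumann_mu_2_rectangle_ge:
  assumes "v \<bullet> w = 0"
  shows "(pi / max (norm v) (norm w))\<^sup>2 \<le> neumann_mu 2 cell"
  unfolding neumann_mu_def
proof (rule cInf_greatest)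
  obtain \<nu> where "\<nu> \<in> neumann_bounds"
    by (rule second_eigenvalue_in_neumann_bounds)
  then show "neumann_bounds \<noteq> {}"
    unfolding ex_in_conv[symmetric] by (rule exI)
  fix t assume "t \<in> neumann_bounds"
  then obtain \<nu> u where u: "\<And>i :: nat. i < 2 \<Longrightarrow> neumann_eigenfunction cell (\<nu> i) (u i)" "\<And>i. i < 2 \<Longrightarrow> \<nu> i \<le> t"
    and indep: "independent_AE_on cell 2 u"
    by blast
  show "(pi / max (norm v) (norm w))\<^sup>2 \<le> t"
  proof (rule ccontr)
    assume "\<not> (pi / max (norm v) (norm w))\<^sup>2 \<le> t"
    then have less: "\<nu> i < (pi / max (norm v) (norm w))\<^sup>2" if "i < 2" for i
      using u(2)[OF that] by linarith
    have u0: "neumann_eigenfunction cell (\<nu> 0) (u 0)" "\<nu> 0 < (pi / max (norm v) (norm w))\<^sup>2"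
      and u1: "neumann_eigenfunction cell (\<nu> 1) (u 1)" "\<nu> 1 < (pi / max (norm v) (norm w))\<^sup>2"
      using u(1)[of 0] u(1)[of 1] less[of 0] less[of 1] by simp_all
    obtain c0 where c0: "AE x in M. u 0 x = c0"
      by (rule rectangle_eigenfunction_const[OF assms u0])
    obtain c1 where c1: "AE x in M. u 1 x = c1"
      by (rule rectangle_eigenfunction_const[OF assms u1])
    \<comment> \<open>A combination that always vanishes, even if a constant is zero. Independence
      then gives \<open>c0 = 0\<close>, so that \<open>u 0\<close> is null, which an eigenfunction
      is not.\<close>
    define c where "c i = (if i = 0 then c1 else - c0)" for i :: nat
    have "AE x in M. (\<Sum>i<2. c i * u i x) = 0"
      using c0 c1 by eventually_elim (simp add: c_def numeral_2_eq_2)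
    then have "AE x in lborel. x \<in> cell \<longrightarrow> (\<Sum>i<2. c i * u i x) = 0"
      by (simp add: AE_restrict_space_iff)
    then have "\<forall>i<2. c i = 0"
      using indep unfolding independent_AE_on_def by blast
    then have "c 1 = 0"
      by simp
    then have "AE x in M. u 0 x = 0"
      using c0 by (simp add: c_def)
    then show False
      using u(1)[of 0] by (simp add: neumann_eigenfunction_iff)
  qed
qed

lemma parallelogram_eq: "parallelogram p v w = closed_cell"
proof (intro set_eqI iffI)
  fix x assume "x \<in> closed_cell"
  then show "x \<in> parallelogram p v w"
    unfolding parallelogram_def closed_cell_def using coordinates[of x] by auto
qed (auto simp: parallelogram_def closed_cell_def)

text \<open>The closed cell is an intersection of four half-spaces with nonzero normals, and
  \<open>interior\<close> commutes with finite intersections.\<close>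

lemma interior_parallelogram: "interior (parallelogram p v w) = cell"
proof -
  have c: "c1 x = v' \<bullet> x - v' \<bullet> p" "c2 x = w' \<bullet> x - w' \<bullet> p" for x
    by (simp_all add: c1_def c2_def inner_diff_left inner_diff_right inner_commute)
  have "closed_cell = {x. v' \<bullet> x \<ge> v' \<bullet> p} \<inter> {x. v' \<bullet> x \<le> v' \<bullet> p + 1} \<inter>
      ({x. w' \<bullet> x \<ge> w' \<bullet> p} \<inter> {x. w' \<bullet> x \<le> w' \<bullet> p + 1})"
    by (auto simp: closed_cell_def c)
  moreover have "v' \<noteq> 0" "w' \<noteq> 0"
    using dual by auto
  then have "interior {x. v' \<bullet> x \<ge> v' \<bullet> p} = {x. v' \<bullet> x > v' \<bullet> p}"
    "interior {x. v' \<bullet> x \<le> v' \<bullet> p + 1} = {x. v' \<bullet> x < v' \<bullet> p + 1}"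
    "interior {x. w' \<bullet> x \<ge> w' \<bullet> p} = {x. w' \<bullet> x > w' \<bullet> p}"
    "interior {x. w' \<bullet> x \<le> w' \<bullet> p + 1} = {x. w' \<bullet> x < w' \<bullet> p + 1}"
    by simp_all
  ultimately have "interior closed_cell = {x. v' \<bullet> x > v' \<bullet> p} \<inter> {x. v' \<bullet> x < v' \<bullet> p + 1} \<inter>
      ({x. w' \<bullet> x > w' \<bullet> p} \<inter> {x. w' \<bullet> x < w' \<bullet> p + 1})"
    by (simp only: interior_Int)
  also have "\<dots> = cell"
    by (auto simp: cell_def c)
  finally show ?thesis
    unfolding parallelogram_eq .
qed

end

section \<open>Determinants in the plane, area and the comparison\<close>

definition cross :: "real ^ 2 \<Rightarrow> real ^ 2 \<Rightarrow> real"
  where "cross v w = v $ 1 * w $ 2 - v $ 2 * w $ 1"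

lemma inner_real2: "x \<bullet> y = x $ 1 * y $ 1 + x $ 2 * y $ 2" for x y :: "real ^ 2"
  by (simp add: inner_vec_def sum_2)

lemma inner_rotated:
  fixes v w x :: "real ^ 2"
  shows "x \<bullet> (c *\<^sub>R vector [w $ 2, - w $ 1]) = c * cross x w"
    and "x \<bullet> (c *\<^sub>R vector [- v $ 2, v $ 1]) = c * cross v x"
  by (simp_all add: inner_real2 cross_def algebra_simps)

lemma cross_self: "cross v v = 0"
  by (simp add: cross_def)

lemma cross_decomposition: "cross v w *\<^sub>R x = cross x w *\<^sub>R v + cross v x *\<^sub>R w"
  by (simp add: vec_eq_iff forall_2 cross_def algebra_simps)

text \<open>Cramer's rule: the dual vectors are the sides turned by a right angle and divided by the
  determinant. Hence \<open>norm v'\<close> is \<open>norm w\<close> divided by the area.\<close>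

lemma plane_coordinates_cross:
  assumes "cross v w \<noteq> 0"
  shows "plane_coordinates v w ((1 / cross v w) *\<^sub>R vector [w $ 2, - w $ 1]) ((1 / cross v w) *\<^sub>R vector [- v $ 2, v $ 1])"
proof (unfold_locales, unfold inner_rotated)
  fix x :: "real ^ 2"
  have "x = (1 / cross v w) *\<^sub>R (cross v w *\<^sub>R x)"
    using assms by simp
  also have "\<dots> = (1 / cross v w * cross x w) *\<^sub>R v + (1 / cross v w * cross v x) *\<^sub>R w"
    by (subst cross_decomposition) (simp add: scaleR_add_right)
  finally show "x = (1 / cross v w * cross x w) *\<^sub>R v + (1 / cross v w * cross v x) *\<^sub>R w" .
qed (use assms in \<open>simp_all add: cross_self\<close>)

lemma norm_rotated: "norm (vector [w $ 2, - w $ 1] :: real ^ 2) = norm w" "norm (vector [- w $ 2, w $ 1] :: real ^ 2) = norm w"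
  for w :: "real ^ 2"
  by (simp_all add: norm_eq_sqrt_inner inner_real2 add.commute)

text \<open>The condition \<open>v \<noteq> w\<close> is essential, since otherwise
  \<open>{v, w}\<close> collapses to a singleton, which may well be independent.\<close>

lemma cross_nonzero:
  assumes "independent {v, w}" "v \<noteq> w"
  shows "cross v w \<noteq> 0"
proof
  assume 0: "cross v w = 0"
  have coeff: "a = 0 \<and> b = 0" if "a *\<^sub>R v + b *\<^sub>R w = 0" for a b
  proof -
    have "(\<Sum>z\<in>{v, w}. (if z = v then a else b) *\<^sub>R z) = 0"
      using assms(2) that by simp
    then have "(if z = v then a else b) = 0" if "z \<in> {v, w}" for z
      using independentD[OF assms(1), of "{v, w}" "\<lambda>z. if z = v then a else b" z] that by auto
    from this[of v] this[of w] show ?thesis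
      using assms(2) by auto
  qed
  have *: "w $ 1 *\<^sub>R v + (- v $ 1) *\<^sub>R w = 0" "w $ 2 *\<^sub>R v + (- v $ 2) *\<^sub>R w = 0"
    using 0 by (auto simp: vec_eq_iff forall_2 cross_def mult.commute)
  from coeff[OF *(1)] coeff[OF *(2)] have "v $ 1 = 0" "v $ 2 = 0"
    by simp_all
  then have "1 *\<^sub>R v + 0 *\<^sub>R w = 0"
    by (simp add: vec_eq_iff forall_2)
  from coeff[OF this] show False by simp
qed

text \<open>The region is a translate of the image of the unit square under a linear map with
  determinant \<open>cross v w\<close>.\<close>

lemma measure_parallelogram:
  assumes "cross v w \<noteq> 0"
  shows "measure lborel (parallelogram p v w) = \<bar>cross v w\<bar>"
proof -
  interpret plane_coordinates p v w "(1 / cross v w) *\<^sub>R vector [w $ 2, - w $ 1]" "(1 / cross v w) *\<^sub>R vector [- v $ 2, v $ 1]"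
    by (rule plane_coordinates_cross[OF assms])
  define f :: "real ^ 2 \<Rightarrow> real ^ 2" where "f x = x $ 1 *\<^sub>R v + x $ 2 *\<^sub>R w" for x
  have lin: "linear f"
    unfolding f_def by (rule linearI) (auto simp: algebra_simps)
  have det: "det (matrix f) = cross v w"
    by (simp add: det_2 matrix_def f_def cross_def axis_def)
  have image: "(+) p ` f ` cbox 0 1 = parallelogram p v w"
  proof (intro set_eqI iffI)
    fix x assume "x \<in> parallelogram p v w"
    then obtain s t where x: "x = p + s *\<^sub>R v + t *\<^sub>R w" "s \<in> {0..1}" "t \<in> {0..1}"
      by (auto simp: parallelogram_def)
    then have "x = p + f (vector [s, t])" "vector [s, t] \<in> cbox (0 :: real ^ 2) 1"
      by (auto simp: f_def mem_box_cart forall_2 add.assoc)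
    then show "x \<in> (+) p ` f ` cbox 0 1"
      by blast
  next
    fix x assume "x \<in> (+) p ` f ` cbox 0 1"
    then obtain y where y: "y \<in> cbox (0 :: real ^ 2) 1" "x = p + f y"
      by blast
    then show "x \<in> parallelogram p v w"
      unfolding parallelogram_def
      by (intro CollectI exI[of _ "y $ 1"] exI[of _ "y $ 2"]) (auto simp: f_def mem_box_cart)
  qed
  have "cbox (0 :: real ^ 2) 1 \<noteq> {}"
    by (simp add: interval_ne_empty_cart)
  then have unit: "measure lebesgue (cbox (0 :: real ^ 2) 1) = 1"
    by (simp add: content_cbox_cart)
  have "compact (parallelogram p v w)"
    unfolding parallelogram_eq by (rule compact_closed_cell)
  then have "measure lborel (parallelogram p v w) = measure lebesgue (parallelogram p v w)"
    by (simp add: borel_compact)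
  also have "\<dots> = measure lebesgue (f ` cbox 0 1)"
    unfolding image[symmetric] by (rule measure_translation)
  also have "\<dots> = \<bar>cross v w\<bar>"
    using measure_linear_image[OF lin, of "cbox 0 1"] unit det by simp
  finally show ?thesis .
qed

text \<open>Either side direction supplies a trial function, the second one through
  \<open>swap\<close>; the better bound carries the shorter side in the numerator.\<close>

lemma neumann_mu_2_parallelogram_le:
  assumes "cross v w \<noteq> 0"
  shows "neumann_mu 2 (interior (parallelogram p v w)) \<le> (pi * min (norm v) (norm w) / cross v w)\<^sup>2"
proof -
  let ?v = "(1 / cross v w) *\<^sub>R vector [w $ 2, - w $ 1] :: real ^ 2"
  let ?w = "(1 / cross v w) *\<^sub>R vector [- v $ 2, v $ 1] :: real ^ 2"
  interpret plane_coordinates p v w ?v ?w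
    by (rule plane_coordinates_cross[OF assms])
  have "neumann_mu 2 cell \<le> (pi * norm ?v)\<^sup>2"
    by (rule neumann_mu_2_le)
  moreover have "neumann_mu 2 cell \<le> (pi * norm ?w)\<^sup>2"
    using plane_coordinates.neumann_mu_2_le[OF swap, of p] unfolding flip_cell .
  moreover have "(pi * norm ?v)\<^sup>2 = (pi * norm w / cross v w)\<^sup>2" "(pi * norm ?w)\<^sup>2 = (pi * norm v / cross v w)\<^sup>2"
    by (simp_all add: norm_rotated power_mult_distrib power_divide)
  ultimately show ?thesis
    unfolding interior_parallelogram by (simp add: min_def)
qed

theorem theorem1:
  fixes p v w q x y :: "real ^ 2" and Q R :: "(real ^ 2) set" and a b \<alpha> :: real
  assumes Q: "Q = parallelogram p v w" "independent {v, w}" "v \<noteq> w"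
    and sides: "a = max (norm v) (norm w)" "b = min (norm v) (norm w)"
    and angle: "\<alpha> = Min (interior_angles v w)"
    and R: "R = parallelogram q x y" "x \<noteq> 0" "y \<noteq> 0" "x \<bullet> y = 0"
    and area: "measure lborel R = measure lborel Q"
    and shorter_side: "min (norm x) (norm y) = b"
    and ratio: "b / a \<le> sin \<alpha>"
  shows "neumann_mu 2 (interior Q) \<le> neumann_mu 2 (interior R)"
proof -
  have vw: "cross v w \<noteq> 0"
    using Q(2,3) by (rule cross_nonzero)
  \<comment> \<open>Lagrange's identity; for perpendicular sides it makes the area the product of
    the side lengths.\<close>
  have "(cross x y)\<^sup>2 + (x \<bullet> y)\<^sup>2 = (x \<bullet> x) * (y \<bullet> y)"
    by (simp add: cross_def inner_real2 power2_eq_square algebra_simps)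
  then have "\<bar>cross x y\<bar>\<^sup>2 = (norm x * norm y)\<^sup>2"
    using R(4) by (simp add: power_mult_distrib power2_norm_eq_inner)
  then have xy: "\<bar>cross x y\<bar> = norm x * norm y"
    by (rule power2_eq_imp_eq) auto
  then have "cross x y \<noteq> 0"
    using R(2,3) by auto
  then interpret rect: plane_coordinates q x y
    "(1 / cross x y) *\<^sub>R vector [y $ 2, - y $ 1]" "(1 / cross x y) *\<^sub>R vector [- x $ 2, x $ 1]"
    by (rule plane_coordinates_cross)
  have "\<bar>cross v w\<bar> = \<bar>cross x y\<bar>"
    using area unfolding Q(1) R(1) measure_parallelogram[OF vw] measure_parallelogram[OF \<open>cross x y \<noteq> 0\<close>] ..
  also have "\<dots> = max (norm x) (norm y) * b"
    unfolding xy shorter_side[symmetric] by (simp add: max_def min_def)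
  finally have vw_eq: "\<bar>cross v w\<bar> = max (norm x) (norm y) * b" .
  have "neumann_mu 2 (interior Q) \<le> (pi * b / cross v w)\<^sup>2"
    unfolding Q(1) sides(2) by (rule neumann_mu_2_parallelogram_le[OF vw])
  also have "\<dots> = (pi * b / \<bar>cross v w\<bar>)\<^sup>2"
    by (simp add: power_divide)
  \<comment> \<open>Equal area and equal shorter side cancel \<open>b\<close>, leaving the longer
    side of the rectangle.\<close>
  also have "\<dots> = (pi / max (norm x) (norm y))\<^sup>2"
    using R(2,3) unfolding vw_eq shorter_side[symmetric] by (simp add: min_def)
  also have "\<dots> \<le> neumann_mu 2 (interior R)"
    unfolding R(1) rect.interior_parallelogram by (rule rect.neumann_mu_2_rectangle_ge[OF R(4)])
  finally show ?thesis .
qed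

end
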